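(* Let $X^{\pm}(\lambda)$, $\lambda\in K$, be reference paths for $A_{\pm\infty}(\lambda)=A_\infty(\lambda)$, and let $Z(\lambda,\tau)$ be the center-unstable manifold of $X^-(\lambda)$ in the $B$ system (all as defined in the context). If $X^+(\lambda)$ and $X^-(\lambda)$ are non-degenerate, then the asymptotic relative phase of $Z$, $$\lim_{\xi\to\infty} GP\big(Z(K,\tau(\xi))\big)-GP\big(X^+(K)\big),$$ equals the total multiplicity of the eigenvalues of $\mathcal{L}$ enclosed by $K$.
   Context: Let $f:\mathbb{R}\to\mathbb{R}$ be $C^2$, $c\in\mathbb{R}$, and let $U:\mathbb{R}\to\mathbb{R}$ be a travelling wave: $U''+cU'+f(U)=0$. Assume the limits $U(\pm\infty)=\lim_{\xi\to\pm\infty}U(\xi)$ exist and there are $a,C>0$ with $|U(\xi)-U(+\infty)|\le Ce^{-a\xi}$ for $\xi\ge 0$, $|U(\xi)-U(-\infty)|\le Ce^{a\xi}$ for $\xi\le 0$, and $|U'(\xi)|\le Ce^{-a|\xi|}$ for all $\xi$. Let $\mathcal{L}p=p''+cp'+f'(U(\xi))p$, acting on bounded uniformly continuous functions on $\mathbb{R}$. For $\lambda\in\mathbb{C}$, $(\mathcal{L}-\lambda)p=0$ is equivalent to the $A$ system $Y'=A(\lambda,\xi)Y$ on $\mathbb{C}^2$, with $A(\lambda,\xi)=\begin{pmatrix}0&1\\ \lambda-f'(U(\xi))&-c\end{pmatrix}$. Let $A_{\pm\infty}(\lambda)=\lim_{\xi\to\pm\infty}A(\lambda,\xi)$, and assume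 $A_{+\infty}(\lambda)=A_{-\infty}(\lambda)=:A_\infty(\lambda)$. Let $\Omega\subset\mathbb{C}$ be open and simply connected, containing no spectrum of $\mathcal{L}$ other than discrete eigenvalues, and such that for every $\lambda\in\Omega$ the matrix $A_\infty(\lambda)$ has eigenvalues $\mu_1(\lambda),\mu_2(\lambda)$ with $\mathrm{Re}\,\mu_1(\lambda)<0<\mathrm{Re}\,\mu_2(\lambda)$. Let $K\subset\Omega$ be a smooth simple closed curve containing no spectrum of $\mathcal{L}$, with positively oriented parametrization $\lambda(s)$, $s\in[0,1]$, and let $K^\circ$ be the region it encloses. "Total multiplicity" is the sum of the algebraic multiplicities of the eigenvalues of $\mathcal{L}$ in $K^\circ$. Compactified variable: fix $0<\kappa<a/2$ and let $\tau(\xi)=\tanh(\kappa\xi)$, so $\tau'=\kappa(1-\tau^2)$, with $\tau=\pm1$ corresponding to $\xi=\pm\infty$. A reference path $X^\pm(\lambda)$, $\lambda\in K$, for $A_{\pm\infty}$ is a loop of eigenvectors of $A_{\pm\infty}(\lambda)$ for the eigenvalue of largest positive real part (here $\mu_2(\lambda)$). It is non-degenerate if it is chosen analytically in $\lambda$ over $K$ and extends smoothly over $K^\circ$, as an eigenvector for the same eigenvalue, without zeros. The $B$ system is $X'=(A(\lambda,\xi)-\mu_2(\lambda)I)X$. The center-unstable manifold of $X^-(\lambda)$ in the $B$ system is parametrized by $Z(\lambda,\tau)$: $Z(\lambda,-1)=X^-(\lambda)$, and $\xi\mapsto Z(\lambda,\tau(\xi))$ is the solution of the $B$ system converging to $X^-(\lambda)$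 as $\xi\to-\infty$. Geometric phase: with $\langle v,w\rangle=\sum_j v_j\overline{w_j}$, for a nowhere-zero differentiable path $u:[0,1]\to\mathbb{C}^n$ set $GP(u)=\frac1{2\pi}\int_0^1\frac{\mathrm{Im}\langle u'(s),u(s)\rangle}{\langle u(s),u(s)\rangle}\,ds$. For $u$ defined on $K$, $GP(u(K))$ is the geometric phase of $s\mapsto u(\lambda(s))$. *)

theory Defs
  imports "HOL-Complex_Analysis.Complex_Analysis" "HOL-Library.Function_Algebras"
begin

section \<open>The linearized operator on bounded uniformly continuous functions\<close>

text \<open>Complex functions on the line as a complex vector space with pointwise operations; it
  supplies \<^verbatim>\<open>cfun.span\<close> and \<^verbatim>\<open>cfun.dim\<close>.\<close>

interpretation cfun: vector_space "\<lambda>(k::complex) (p::real \<Rightarrow> complex). (\<lambda>x. k * p x)"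
  by unfold_locales (auto simp: fun_eq_iff algebra_simps)

definition BUC :: "(real \<Rightarrow> complex) set" where
  "BUC = {p. bounded (range p) \<and> uniformly_continuous_on UNIV p}"

definition sup_norm :: "(real \<Rightarrow> complex) \<Rightarrow> real" where
  "sup_norm p = (SUP x. norm (p x))"

definition cderiv :: "(real \<Rightarrow> complex) \<Rightarrow> real \<Rightarrow> complex" where
  "cderiv p = (\<lambda>x. vector_derivative p (at x))"

definition dom_L :: "(real \<Rightarrow> complex) set" where
  "dom_L = {p. (\<forall>x. p differentiable (at x)) \<and> (\<forall>x. cderiv p differentiable (at x)) \<and>
               p \<in> BUC \<and> cderiv p \<in> BUC \<and> cderiv (cderiv p) \<in> BUC}"

definition L_op :: "real \<Rightarrow> (real \<Rightarrow> real) \<Rightarrow> (real \<Rightarrow> real) \<Rightarrow> (real \<Rightarrow> complex) \<Rightarrow> real \<Rightarrow> complex"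
  where "L_op c f U p =
    (\<lambda>x. cderiv (cderiv p) x + of_real c * cderiv p x + of_real (deriv f (U x)) * p x)"

definition L_shift ::
    "real \<Rightarrow> (real \<Rightarrow> real) \<Rightarrow> (real \<Rightarrow> real) \<Rightarrow> complex \<Rightarrow> (real \<Rightarrow> complex) \<Rightarrow> real \<Rightarrow> complex"
  where "L_shift c f U lam p = (\<lambda>x. L_op c f U p x - lam * p x)"

definition resolvent_set :: "real \<Rightarrow> (real \<Rightarrow> real) \<Rightarrow> (real \<Rightarrow> real) \<Rightarrow> complex set" where
  "resolvent_set c f U = {lam. bij_betw (L_shift c f U lam) dom_L BUC \<and>
     (\<exists>M. \<forall>p\<in>dom_L. sup_norm p \<le> M * sup_norm (L_shift c f U lam p))}"

definition spectrum_L :: "real \<Rightarrow> (real \<Rightarrow> real) \<Rightarrow> (real \<Rightarrow> real) \<Rightarrow> complex set" where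
  "spectrum_L c f U = - resolvent_set c f U"

definition eigenvalues_L :: "real \<Rightarrow> (real \<Rightarrow> real) \<Rightarrow> (real \<Rightarrow> real) \<Rightarrow> complex set" where
  "eigenvalues_L c f U = {lam. \<exists>p\<in>dom_L. p \<noteq> (\<lambda>x. 0) \<and> L_op c f U p = (\<lambda>x. lam * p x)}"

text \<open>The kernel of the k-th power of L - lam, with the natural domain of that power.\<close>

primrec ker_power ::
    "real \<Rightarrow> (real \<Rightarrow> real) \<Rightarrow> (real \<Rightarrow> real) \<Rightarrow> complex \<Rightarrow> nat \<Rightarrow> (real \<Rightarrow> complex) set"
  where
    "ker_power c f U lam 0 = {\<lambda>x. 0}"
  | "ker_power c f U lam (Suc k) = {p \<in> dom_L. L_shift c f U lam p \<in> ker_power c f U lam k}"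

definition gen_eigenspace ::
    "real \<Rightarrow> (real \<Rightarrow> real) \<Rightarrow> (real \<Rightarrow> real) \<Rightarrow> complex \<Rightarrow> (real \<Rightarrow> complex) set"
  where "gen_eigenspace c f U lam = (\<Union>k. ker_power c f U lam k)"

text \<open>Pitfall: \<^verbatim>\<open>cfun.dim\<close> is 0 on infinite-dimensional spaces, so finiteness is a separate
  requirement in the definition of a discrete eigenvalue.\<close>

definition alg_mult :: "real \<Rightarrow> (real \<Rightarrow> real) \<Rightarrow> (real \<Rightarrow> real) \<Rightarrow> complex \<Rightarrow> nat" where
  "alg_mult c f U lam = cfun.dim (gen_eigenspace c f U lam)"

definition discrete_eigenvalues_L :: "real \<Rightarrow> (real \<Rightarrow> real) \<Rightarrow> (real \<Rightarrow> real) \<Rightarrow> complex set" where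
  "discrete_eigenvalues_L c f U =
     {lam \<in> eigenvalues_L c f U. lam isolated_in spectrum_L c f U \<and>
        (\<exists>B. finite B \<and> gen_eigenspace c f U lam = cfun.span B)}"


section \<open>The first-order systems\<close>

definition A_mat :: "real \<Rightarrow> (real \<Rightarrow> real) \<Rightarrow> (real \<Rightarrow> real) \<Rightarrow> complex \<Rightarrow> real \<Rightarrow> complex^2^2" where
  "A_mat c f U lam x =
     vector [vector [0, 1], vector [lam - of_real (deriv f (U x)), - of_real c]]"

definition eigenvector :: "complex^'n^'n \<Rightarrow> complex \<Rightarrow> complex^'n \<Rightarrow> bool" where
  "eigenvector M mu v \<longleftrightarrow> v \<noteq> 0 \<and> M *v v = mu *s v"

definition eigenvalue :: "complex^'n^'n \<Rightarrow> complex \<Rightarrow> bool" where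
  "eigenvalue M mu \<longleftrightarrow> (\<exists>v. eigenvector M mu v)"

text \<open>A path of the B system is indexed by the compactified variable \<open>\<tau> = tanh (\<kappa> \<xi>)\<close>;
  the value at \<open>\<tau> = 1\<close> is left unconstrained.\<close>

definition center_unstable_manifold ::
    "(complex \<Rightarrow> real \<Rightarrow> complex^'n^'n) \<Rightarrow> (complex \<Rightarrow> complex) \<Rightarrow> real \<Rightarrow> complex set
      \<Rightarrow> (complex \<Rightarrow> complex^'n) \<Rightarrow> (complex \<Rightarrow> real \<Rightarrow> complex^'n) \<Rightarrow> bool"
  where "center_unstable_manifold A mu kappa K X Z \<longleftrightarrow>
    (\<forall>lam\<in>K. Z lam (-1) = X lam \<and>
      (\<forall>x. ((\<lambda>y. Z lam (tanh (kappa * y))) has_vector_derivative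
              ((A lam x - mat (mu lam)) *v Z lam (tanh (kappa * x)))) (at x)) \<and>
      ((\<lambda>x. Z lam (tanh (kappa * x))) \<longlongrightarrow> X lam) at_bot)"


section \<open>Curves, reference paths and geometric phase\<close>

text \<open>Smooth means continuously differentiable throughout; derivatives at the end points of the
  parameter interval are one-sided.\<close>

definition smooth_curve :: "(real \<Rightarrow> complex) \<Rightarrow> bool" where
  "smooth_curve g \<longleftrightarrow> (\<exists>g'. continuous_on {0..1} g' \<and>
     (\<forall>s\<in>{0..1}. (g has_vector_derivative g' s) (at s within {0..1}) \<and> g' s \<noteq> 0))"

definition positively_oriented :: "(real \<Rightarrow> complex) \<Rightarrow> bool" where
  "positively_oriented g \<longleftrightarrow> (\<forall>z\<in>inside (path_image g). winding_number g z = 1)"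

definition reference_path ::
    "(complex \<Rightarrow> complex^'n^'n) \<Rightarrow> (complex \<Rightarrow> complex) \<Rightarrow> complex set
      \<Rightarrow> (complex \<Rightarrow> complex^'n) \<Rightarrow> bool"
  where "reference_path M mu K X \<longleftrightarrow>
    continuous_on K X \<and> (\<forall>lam\<in>K. eigenvector (M lam) (mu lam) (X lam))"

text \<open>Only the values of \<open>X\<close> on \<open>K\<close> matter: \<open>X\<close> is the restriction to \<open>K\<close> of a map \<open>G\<close> that is
  analytic near \<open>K\<close>, and also of a map \<open>E\<close> that is continuous on \<open>K\<close> together with its interior
  domain and real-continuously differentiable in that domain. \<open>E\<close> need not be holomorphic.\<close>

definition nondegenerate ::
    "(complex \<Rightarrow> complex^'n^'n) \<Rightarrow> (complex \<Rightarrow> complex) \<Rightarrow> complex set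
      \<Rightarrow> (complex \<Rightarrow> complex^'n) \<Rightarrow> bool"
  where "nondegenerate M mu K X \<longleftrightarrow>
    (\<exists>G. (\<forall>i. (\<lambda>lam. G lam $ i) analytic_on K) \<and> (\<forall>lam\<in>K. G lam = X lam)) \<and>
    (\<exists>E. (\<forall>lam\<in>K. E lam = X lam) \<and>
         continuous_on (K \<union> inside K) E \<and>
         (\<exists>E'. continuous_on (inside K) E' \<and>
            (\<forall>lam\<in>inside K. (E has_derivative blinfun_apply (E' lam)) (at lam))) \<and>
         (\<forall>lam\<in>inside K. eigenvector (M lam) (mu lam) (E lam)))"

definition hprod :: "complex^'n \<Rightarrow> complex^'n \<Rightarrow> complex" where
  "hprod v w = (\<Sum>j\<in>UNIV. v $ j * cnj (w $ j))"

text \<open>\<open>hprod v v\<close> is real, so taking its real part loses nothing.\<close>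

definition GP :: "(real \<Rightarrow> complex^'n) \<Rightarrow> real" where
  "GP u = 1 / (2 * pi) *
     integral {0..1} (\<lambda>s. Im (hprod (vector_derivative u (at s within {0..1})) (u s))
                            / Re (hprod (u s) (u s)))"

end

theory Submission
  imports Defs
begin

text \<open>
  Near infinity the eigenvalue equation has constant coefficients, with characteristic exponents
  \<open>\<mu>\<^sub>1\<close>, \<open>\<mu>\<^sub>2\<close>. In the coordinates \<open>p = exp (\<mu>\<^sub>2 \<xi>) u\<close>, with \<open>\<nu> = \<mu>\<^sub>2 - \<mu>\<^sub>1\<close> and
  \<open>g = f' (U) - f' (U (\<plusminus>\<infinity>))\<close>, it becomes \<open>u'' + \<nu> u' + g u = 0\<close>, and the B system is this equation
  written for the vector \<open>(u, \<mu>\<^sub>2 u + u')\<close>. Since \<open>g\<close> decays exponentially, a Volterra integral equation on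
  the whole line yields the solution that tends to 1 at \<open>-\<infinity>\<close> (the Jost solution). It is holomorphic in
  \<open>\<nu>\<close>, and as \<open>\<xi> \<longrightarrow> +\<infinity>\<close> it converges, uniformly in \<open>\<nu>\<close>, to a function that is an Evans function:
  up to the factor \<open>-\<nu>\<close> it is the Wronskian of the solutions decaying at the two ends.

  The center-unstable manifold \<open>Z\<close> is the first component \<open>X\<^sub>1\<close> of \<open>X\<^sup>-\<close> times \<open>(u, \<mu>\<^sub>2 u + u')\<close>. It
  therefore converges to \<open>X\<^sub>1 * evans * (1, \<mu>\<^sub>2)\<close>, uniformly near \<open>K\<close> and hence with its
  \<open>\<lambda>\<close>-derivative, and the phases converge (\<open>GP_uniform_limit\<close>). The phase of a scalar times \<open>(1, \<mu>\<^sub>2)\<close>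
  is the winding number of the scalar plus the phase of \<open>(1, \<mu>\<^sub>2)\<close> (\<open>GP_line\<close>). Relative to the phase of
  \<open>X\<^sup>+\<close>, the limit is thus the sum of the winding numbers of the Evans function and of the first component
  of \<open>X\<^sup>-\<close>, minus that of the first component of \<open>X\<^sup>+\<close>. Non-degeneracy makes these components extend
  without zeros over the inside of \<open>K\<close>, so they do not wind (\<open>log_integral_zero\<close>), and the argument
  principle counts the zeros of the Evans function inside \<open>K\<close> with their orders (\<open>log_integral_zeros\<close>).

  It remains to identify the order of a zero \<open>\<lambda>\<^sub>0\<close> with the algebraic multiplicity. Expanding the
  solution that decays at \<open>-\<infinity>\<close> in powers of \<open>\<lambda> - \<lambda>\<^sub>0\<close> gives functions \<open>Y\<^sub>0, Y\<^sub>1, ...\<close> with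
  \<open>(L - \<lambda>\<^sub>0) Y\<^sub>k = Y\<^sub>k\<^sub>-\<^sub>1\<close>. Comparison with the solution that decays at \<open>+\<infinity>\<close> shows that the first one
  unbounded at \<open>+\<infinity>\<close> is the one whose index is the order of the zero (\<open>jordan_chain\<close>). Since bounded
  solutions are unique up to a factor, the earlier ones form a basis of the generalized eigenspace
  (\<open>ker_power_subset\<close>, \<open>gen_eigenspace_eq\<close>).
\<close>

section \<open>Integrals over half-lines\<close>

text \<open>Cauchy's inequality turns the bound by \<open>w\<close> into a bound for the \<open>z\<close>-derivative on a smaller disc.
  Hence the difference quotients at a point are dominated by a multiple of \<open>w\<close>, and their limit
  may be taken under the integral.\<close>

lemma holomorphic_on_integral_dominated:
  fixes f :: "complex \<Rightarrow> 'a \<Rightarrow> complex" and w :: "'a \<Rightarrow> real"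
  assumes A: "open A"
    and hol: "\<And>t. (\<lambda>z. f z t) holomorphic_on A"
    and meas: "\<And>z. z \<in> A \<Longrightarrow> f z \<in> borel_measurable M"
    and bound: "\<And>z t. z \<in> A \<Longrightarrow> norm (f z t) \<le> w t"
    and w: "integrable M w"
  shows "(\<lambda>z. \<integral>t. f z t \<partial>M) holomorphic_on A"
proof (unfold holomorphic_on_open[OF A], intro ballI)
  fix z0 assume z0: "z0 \<in> A"
  obtain r0 where r0: "r0 > 0" "cball z0 r0 \<subseteq> A"
    using A z0 open_contains_cball by blast
  \<comment> \<open>Half the radius: closed discs of radius \<open>r\<close> around points of \<open>ball z0 r\<close> then stay in \<open>A\<close>.\<close>
  define r where "r = r0 / 2"
  have r: "r > 0" using r0 by (simp add: r_def)
  have in_A: "cball z r \<subseteq> A" if "z \<in> ball z0 r" for z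
  proof -
    have "cball z r \<subseteq> cball z0 r0"
      using that r unfolding r_def by (intro cball_subset_cball_iff[THEN iffD2]) (auto simp: dist_commute)
    then show ?thesis using r0 by blast
  qed
  have deriv_le: "norm (deriv (\<lambda>z. f z t) z) \<le> w t / r" if "z \<in> ball z0 r" for z t
  proof -
    have "norm ((deriv ^^ 1) (\<lambda>z. f z t) z) \<le> fact 1 * w t / r ^ 1"
    proof (rule Cauchy_inequality)
      show "(\<lambda>z. f z t) holomorphic_on ball z r"
        using hol in_A[OF that] holomorphic_on_subset ball_subset_cball by blast
      show "continuous_on (cball z r) (\<lambda>z. f z t)"
        using hol in_A[OF that] holomorphic_on_imp_continuous_on continuous_on_subset by blast
      show "norm (f x t) \<le> w t" if "norm (z - x) = r" for x
      proof (rule bound)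
        have "x \<in> cball z r" using that by (simp add: dist_norm)
        then show "x \<in> A" using in_A \<open>z \<in> ball z0 r\<close> by blast
      qed
    qed (use r in auto)
    then show ?thesis by simp
  qed
  have fd: "((\<lambda>z. f z t) has_field_derivative deriv (\<lambda>z. f z t) z) (at z)" if "z \<in> ball z0 r" for z t
    using hol A in_A[OF that] r by (intro holomorphic_derivI) auto
  have lip: "norm (f z t - f z0 t) \<le> w t / r * norm (z - z0)" if "z \<in> ball z0 r" for z t
    by (rule field_differentiable_bound[where S = "ball z0 r" and f' = "deriv (\<lambda>z. f z t)"])
       (use that r fd deriv_le in \<open>auto intro: has_field_derivative_at_within\<close>)
  have int: "integrable M (f z)" if "z \<in> A" for z
    using meas[OF that] bound[OF that]
    by (intro Bochner_Integration.integrable_bound[OF w]) (auto intro!: AE_I2 intro: order_trans[OF _ abs_ge_self])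
  have "((\<lambda>z. ((\<integral>t. f z t \<partial>M) - (\<integral>t. f z0 t \<partial>M)) / (z - z0)) \<longlongrightarrow>
          (\<integral>t. deriv (\<lambda>z. f z t) z0 \<partial>M)) (at z0)"
    unfolding tendsto_at_iff_sequentially
  proof (intro allI impI)
    fix X assume X: "\<forall>i. X i \<in> UNIV - {z0}" "X \<longlonglongrightarrow> z0"
    have "eventually (\<lambda>n. X n \<in> ball z0 r) sequentially"
      using X r by (intro topological_tendstoD[OF X(2)]) auto
    then obtain N where N: "\<And>n. n \<ge> N \<Longrightarrow> X n \<in> ball z0 r"
      by (auto simp: eventually_sequentially)
    define q where "q = (\<lambda>i t. (f (X (i + N)) t - f z0 t) / (X (i + N) - z0))"
    have XN: "X (i + N) \<in> ball z0 r" "X (i + N) \<noteq> z0" for i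
      using N[of "i + N"] X(1) by auto
    have XA: "X (i + N) \<in> A" for i
      using in_A[OF XN(1)[of i]] r by auto
    have q_lim: "(\<lambda>i. q i t) \<longlonglongrightarrow> deriv (\<lambda>z. f z t) z0" for t
    proof -
      have "((\<lambda>z. (f z t - f z0 t) / (z - z0)) \<longlongrightarrow> deriv (\<lambda>z. f z t) z0) (at z0)"
        using fd[of z0 t] r by (simp add: has_field_derivative_iff)
      then have "((\<lambda>z. (f z t - f z0 t) / (z - z0)) \<circ> X) \<longlonglongrightarrow> deriv (\<lambda>z. f z t) z0"
        using X unfolding tendsto_at_iff_sequentially by blast
      then show ?thesis
        unfolding q_def o_def by (rule LIMSEQ_ignore_initial_segment)
    qed
    have q_meas: "q i \<in> borel_measurable M" for i
      unfolding q_def using meas[OF XA] meas[OF z0] by (intro borel_measurable_divide borel_measurable_diff) auto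
    have "(\<lambda>i. \<integral>t. q i t \<partial>M) \<longlonglongrightarrow> (\<integral>t. deriv (\<lambda>z. f z t) z0 \<partial>M)"
    proof (rule integral_dominated_convergence)
      show "(\<lambda>t. deriv (\<lambda>z. f z t) z0) \<in> borel_measurable M"
        by (rule borel_measurable_LIMSEQ_metric[OF q_meas q_lim])
      show "integrable M (\<lambda>t. w t / r)" using w by simp
      show "AE t in M. (\<lambda>i. q i t) \<longlonglongrightarrow> deriv (\<lambda>z. f z t) z0"
        using q_lim by simp
      show "AE t in M. norm (q i t) \<le> w t / r" for i
      proof (rule AE_I2)
        fix t
        have "norm (X (i + N) - z0) > 0" using XN by simp
        then show "norm (q i t) \<le> w t / r"
          using lip[OF XN(1), of i t] by (simp add: q_def norm_divide pos_divide_le_eq)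
      qed
    qed (rule q_meas)
    moreover have "(\<integral>t. q i t \<partial>M) =
        ((\<integral>t. f (X (i + N)) t \<partial>M) - (\<integral>t. f z0 t \<partial>M)) / (X (i + N) - z0)" for i
      unfolding q_def using int[OF XA] int[OF z0] by simp
    ultimately show "((\<lambda>z. ((\<integral>t. f z t \<partial>M) - (\<integral>t. f z0 t \<partial>M)) / (z - z0)) \<circ> X) \<longlonglongrightarrow>
        (\<integral>t. deriv (\<lambda>z. f z t) z0 \<partial>M)"
      by - (rule LIMSEQ_offset[where k = N], simp)
  qed
  then show "\<exists>f'. ((\<lambda>z. \<integral>t. f z t \<partial>M) has_field_derivative f') (at z0)"
    by (auto simp: has_field_derivative_iff)
qed

lemma set_integrable_halfline_dominated:
  fixes k :: "real \<Rightarrow> complex"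
  assumes "continuous_on UNIV k" "\<And>t. t < x \<Longrightarrow> norm (k t) \<le> w t" "set_integrable lborel {..<x} w"
  shows "set_integrable lborel {..<x} k"
proof (rule set_integrable_bound[OF assms(3)])
  show "set_borel_measurable lborel {..<x} k"
    unfolding set_borel_measurable_def
    using borel_measurable_continuous_onI[OF assms(1)] by (intro borel_measurable_scaleR borel_measurable_indicator) auto
  show "AE t in lborel. t \<in> {..<x} \<longrightarrow> norm (k t) \<le> norm (w t)"
    using assms(2) by (auto intro!: AE_I2 intro: order_trans[OF _ abs_ge_self])
qed

lemma norm_set_integral_le:
  fixes k :: "real \<Rightarrow> complex"
  assumes k: "set_integrable lborel S k" and w: "set_integrable lborel S w" and le: "\<And>t. t \<in> S \<Longrightarrow> norm (k t) \<le> w t"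
  shows "norm (LINT t:S|lborel. k t) \<le> (LINT t:S|lborel. w t)"
proof -
  have "norm (LINT t:S|lborel. k t) \<le> (LINT t:S|lborel. norm (k t))"
    using k by (rule set_integral_norm_bound)
  also have "\<dots> \<le> (LINT t:S|lborel. w t)"
    using set_integrable_norm[OF k] w le by (rule set_integral_mono)
  finally show ?thesis .
qed

text \<open>A fixed half-line is split off; the rest is an integral over a compact interval, to which the
  fundamental theorem of calculus applies.\<close>

lemma has_vector_derivative_halfline_integral:
  fixes \<phi> :: "real \<Rightarrow> complex"
  assumes cont: "continuous_on UNIV \<phi>" and int: "\<And>x. set_integrable lborel {..<x} \<phi>"
  shows "((\<lambda>x. LINT t:{..<x}|lborel. \<phi> t) has_vector_derivative \<phi> x) (at x)"
proof -
  define a b where "a = x - 1" and "b = x + 1"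
  have ab: "a < x" "x < b" by (auto simp: a_def b_def)
  have split: "(LINT t:{..<y}|lborel. \<phi> t) = (LINT t:{..<a}|lborel. \<phi> t) + (LBINT t=a..y. \<phi> t)"
    if "y \<in> {a..b}" for y
  proof -
    have "{..<y} = {..<a} \<union> {a..<y}" using that by auto
    then have "(LINT t:{..<y}|lborel. \<phi> t) = (LINT t:{..<a} \<union> {a..<y}|lborel. \<phi> t)" by simp
    also have "\<dots> = (LINT t:{..<a}|lborel. \<phi> t) + (LINT t:{a..<y}|lborel. \<phi> t)"
      by (rule set_integral_Un) (auto intro: int set_integrable_subset[OF int[of y]])
    finally show ?thesis using that by (simp add: interval_integral_Ico)
  qed
  have "((\<lambda>y. LBINT t=a..y. \<phi> t) has_vector_derivative \<phi> x) (at x within {a..b})"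
    using ab cont by (intro interval_integral_FTC2) (auto intro: continuous_on_subset)
  then have "((\<lambda>y. (LINT t:{..<a}|lborel. \<phi> t) + (LBINT t=a..y. \<phi> t)) has_vector_derivative \<phi> x) (at x within {a..b})"
    using has_vector_derivative_add[OF has_vector_derivative_const] by fastforce
  then have "((\<lambda>x. LINT t:{..<x}|lborel. \<phi> t) has_vector_derivative \<phi> x) (at x within {a..b})"
    using ab by (intro has_vector_derivative_transform[OF _ split]) auto
  then show ?thesis using ab by (simp add: at_within_Icc_at)
qed

text \<open>For \<open>Re \<nu> > 0\<close>, \<open>halfline_filter \<nu> \<phi>\<close> is the solution of \<open>v' = \<phi> - \<nu> v\<close> that vanishes at
  \<open>-\<infinity>\<close>, and \<open>volterra \<nu> \<phi>\<close> is its primitive vanishing at \<open>-\<infinity>\<close>; so \<open>u = volterra \<nu> \<phi>\<close> satisfies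
  \<open>u'' + \<nu> u' = \<phi>\<close>. Both are meant for \<open>\<phi>\<close> integrable near \<open>-\<infinity>\<close>.\<close>

definition halfline_filter :: "complex \<Rightarrow> (real \<Rightarrow> complex) \<Rightarrow> real \<Rightarrow> complex" where
  "halfline_filter \<nu> \<phi> x = (LINT t:{..<x}|lborel. exp (- \<nu> * of_real (x - t)) * \<phi> t)"

definition volterra :: "complex \<Rightarrow> (real \<Rightarrow> complex) \<Rightarrow> real \<Rightarrow> complex" where
  "volterra \<nu> \<phi> x = (LINT t:{..<x}|lborel. (1 - exp (- \<nu> * of_real (x - t))) / \<nu> * \<phi> t)"

lemma norm_kernel_le:
  fixes \<nu> :: complex
  assumes "Re \<nu> > 0" "s \<ge> 0"
  shows "norm (exp (- \<nu> * of_real s)) \<le> 1" "norm ((1 - exp (- \<nu> * of_real s)) / \<nu>) \<le> 2 / norm \<nu>"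
proof -
  have "0 \<le> Re \<nu> * s" using assms by simp
  then show *: "norm (exp (- \<nu> * of_real s)) \<le> 1"
    unfolding norm_exp_eq_Re by simp
  have "norm (1 - exp (- \<nu> * of_real s)) \<le> 1 + norm (exp (- \<nu> * of_real s))"
    using norm_triangle_ineq4[of 1 "exp (- \<nu> * of_real s)"] by simp
  then show "norm ((1 - exp (- \<nu> * of_real s)) / \<nu>) \<le> 2 / norm \<nu>"
    unfolding norm_divide using * by (intro divide_right_mono) (linarith, simp)
qed

context
  fixes w :: "real \<Rightarrow> real"
  assumes w: "integrable lborel w"
begin

lemma dominator_integrable: "set_integrable lborel {..<x} w"
  unfolding set_integrable_def using w by (intro integrable_mult_indicator) auto

lemma
  assumes \<nu>: "Re \<nu> > 0" and cont: "continuous_on UNIV \<phi>" and le: "\<And>t. norm (\<phi> t) \<le> w t"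
  shows filter_integrable: "set_integrable lborel {..<x} (\<lambda>t. exp (- \<nu> * of_real (x - t)) * \<phi> t)"
    and volterra_integrable: "set_integrable lborel {..<x} (\<lambda>t. (1 - exp (- \<nu> * of_real (x - t))) / \<nu> * \<phi> t)"
    and source_integrable: "set_integrable lborel {..<x} \<phi>"
proof -
  show "set_integrable lborel {..<x} (\<lambda>t. exp (- \<nu> * of_real (x - t)) * \<phi> t)"
  proof (rule set_integrable_halfline_dominated[OF _ _ dominator_integrable])
    fix t assume "t < x"
    then show "norm (exp (- \<nu> * of_real (x - t)) * \<phi> t) \<le> w t"
      unfolding norm_mult using mult_mono[OF norm_kernel_le(1)[OF \<nu>, of "x - t"] le[of t]] by simp
  qed (intro continuous_intros cont)
  show "set_integrable lborel {..<x} (\<lambda>t. (1 - exp (- \<nu> * of_real (x - t))) / \<nu> * \<phi> t)"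
  proof (rule set_integrable_halfline_dominated[where w = "\<lambda>t. 2 / norm \<nu> * w t"])
    fix t assume "t < x"
    then show "norm ((1 - exp (- \<nu> * of_real (x - t))) / \<nu> * \<phi> t) \<le> 2 / norm \<nu> * w t"
      unfolding norm_mult using mult_mono[OF norm_kernel_le(2)[OF \<nu>, of "x - t"] le[of t]] by simp
  next
    show "set_integrable lborel {..<x} (\<lambda>t. 2 / norm \<nu> * w t)"
      using dominator_integrable by (simp add: set_integrable_mult_right)
  next
    show "continuous_on UNIV (\<lambda>t. (1 - exp (- \<nu> * of_real (x - t))) / \<nu> * \<phi> t)"
      using \<nu> by (intro continuous_intros cont) auto
  qed
  show "set_integrable lborel {..<x} \<phi>"
    by (rule set_integrable_halfline_dominated[OF cont _ dominator_integrable]) (rule le)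
qed

text \<open>The kernel factors as \<open>exp (-\<nu> x) * exp (\<nu> t)\<close>. This moves the dependence on \<open>x\<close> out of the
  integral, so only the upper limit is differentiated.\<close>

lemma
  assumes \<nu>: "Re \<nu> > 0" and cont: "continuous_on UNIV \<phi>" and le: "\<And>t. norm (\<phi> t) \<le> w t"
  shows filter_has_derivative:
      "(halfline_filter \<nu> \<phi> has_vector_derivative \<phi> x - \<nu> * halfline_filter \<nu> \<phi> x) (at x)"
    and volterra_has_derivative:
      "(volterra \<nu> \<phi> has_vector_derivative halfline_filter \<nu> \<phi> x) (at x)"
    and volterra_eq: "volterra \<nu> \<phi> x = ((LINT t:{..<x}|lborel. \<phi> t) - halfline_filter \<nu> \<phi> x) / \<nu>"
proof -
  note int = filter_integrable[OF \<nu> cont le] volterra_integrable[OF \<nu> cont le] source_integrable[OF \<nu> cont le]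
  define Q where "Q = (\<lambda>x. LINT t:{..<x}|lborel. exp (\<nu> * of_real t) * \<phi> t)"
  have fact: "exp (- \<nu> * of_real (x - t)) = exp (- \<nu> * of_real x) * exp (\<nu> * of_real t)" for x t
    by (simp add: mult_exp_exp algebra_simps)
  have filter_Q: "halfline_filter \<nu> \<phi> x = exp (- \<nu> * of_real x) * Q x" for x
    unfolding halfline_filter_def Q_def fact mult.assoc by (rule set_integral_mult_right)
  have intQ: "set_integrable lborel {..<x} (\<lambda>t. exp (\<nu> * of_real t) * \<phi> t)" for x
  proof -
    have "set_integrable lborel {..<x} (\<lambda>t. exp (\<nu> * of_real x) * (exp (- \<nu> * of_real (x - t)) * \<phi> t))"
      using int(1) set_integrable_mult_right by blast
    moreover have "exp (\<nu> * of_real x) * (exp (- \<nu> * of_real (x - t)) * \<phi> t) = exp (\<nu> * of_real t) * \<phi> t" for t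
      unfolding fact by (simp add: exp_minus)
    ultimately show ?thesis by (simp only:)
  qed
  have "(Q has_vector_derivative exp (\<nu> * of_real x) * \<phi> x) (at x)" for x
    unfolding Q_def
    by (rule has_vector_derivative_halfline_integral[OF _ intQ]) (intro continuous_intros cont)
  moreover have "((\<lambda>x. exp (- \<nu> * of_real x)) has_vector_derivative - \<nu> * exp (- \<nu> * of_real x)) (at x)" for x
    by (rule has_vector_derivative_eq_rhs, rule has_vector_derivative_real_field)
       (auto intro!: derivative_eq_intros)
  ultimately have "((\<lambda>x. exp (- \<nu> * of_real x) * Q x) has_vector_derivative
      exp (- \<nu> * of_real x) * (exp (\<nu> * of_real x) * \<phi> x) + - \<nu> * exp (- \<nu> * of_real x) * Q x) (at x)" for x
    by (intro has_vector_derivative_mult)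
  then show filt: "(halfline_filter \<nu> \<phi> has_vector_derivative \<phi> x - \<nu> * halfline_filter \<nu> \<phi> x) (at x)" for x
    unfolding filter_Q[abs_def] by (simp add: exp_minus algebra_simps)
  have \<nu>0: "\<nu> \<noteq> 0" using \<nu> by auto
  show eq: "volterra \<nu> \<phi> x = ((LINT t:{..<x}|lborel. \<phi> t) - halfline_filter \<nu> \<phi> x) / \<nu>" for x
  proof -
    have "volterra \<nu> \<phi> x = (LINT t:{..<x}|lborel. (1/\<nu>) * (\<phi> t - exp (- \<nu> * of_real (x - t)) * \<phi> t))"
      unfolding volterra_def by (rule set_lebesgue_integral_cong) (auto simp: algebra_simps diff_divide_distrib)
    also have "\<dots> = (1/\<nu>) * (LINT t:{..<x}|lborel. \<phi> t - exp (- \<nu> * of_real (x - t)) * \<phi> t)"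
      by (rule set_integral_mult_right)
    also have "(LINT t:{..<x}|lborel. \<phi> t - exp (- \<nu> * of_real (x - t)) * \<phi> t) =
        (LINT t:{..<x}|lborel. \<phi> t) - halfline_filter \<nu> \<phi> x"
      unfolding halfline_filter_def by (rule set_integral_diff(2)) (use int in auto)
    finally show ?thesis by simp
  qed
  have "((\<lambda>x. ((LINT t:{..<x}|lborel. \<phi> t) - halfline_filter \<nu> \<phi> x) / \<nu>) has_vector_derivative
     (\<phi> x - (\<phi> x - \<nu> * halfline_filter \<nu> \<phi> x)) / \<nu>) (at x)"
    by (intro has_vector_derivative_divide has_vector_derivative_diff filt
        has_vector_derivative_halfline_integral cont int)
  then show "(volterra \<nu> \<phi> has_vector_derivative halfline_filter \<nu> \<phi> x) (at x)"
    unfolding eq[abs_def] using \<nu>0 by simp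
qed

lemma
  assumes \<nu>: "Re \<nu> > 0" and cont: "continuous_on UNIV \<phi>" and le: "\<And>t. norm (\<phi> t) \<le> w t"
  shows norm_filter_le: "norm (halfline_filter \<nu> \<phi> x) \<le> (LINT t:{..<x}|lborel. w t)"
    and norm_volterra_le: "norm (volterra \<nu> \<phi> x) \<le> 2 / norm \<nu> * (LINT t:{..<x}|lborel. w t)"
proof -
  note int = filter_integrable[OF \<nu> cont le] volterra_integrable[OF \<nu> cont le]
  show "norm (halfline_filter \<nu> \<phi> x) \<le> (LINT t:{..<x}|lborel. w t)"
    unfolding halfline_filter_def
  proof (rule norm_set_integral_le[OF int(1) dominator_integrable])
    fix t assume "t \<in> {..<x}"
    then show "norm (exp (- \<nu> * of_real (x - t)) * \<phi> t) \<le> w t"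
      unfolding norm_mult using mult_mono[OF norm_kernel_le(1)[OF \<nu>, of "x - t"] le[of t]] by simp
  qed
  have "norm (volterra \<nu> \<phi> x) \<le> (LINT t:{..<x}|lborel. 2 / norm \<nu> * w t)"
    unfolding volterra_def
  proof (rule norm_set_integral_le[OF int(2)])
    fix t assume "t \<in> {..<x}"
    then show "norm ((1 - exp (- \<nu> * of_real (x - t))) / \<nu> * \<phi> t) \<le> 2 / norm \<nu> * w t"
      unfolding norm_mult using mult_mono[OF norm_kernel_le(2)[OF \<nu>, of "x - t"] le[of t]] by simp
  qed (use dominator_integrable in \<open>simp add: set_integrable_mult_right\<close>)
  then show "norm (volterra \<nu> \<phi> x) \<le> 2 / norm \<nu> * (LINT t:{..<x}|lborel. w t)"
    by (simp only: set_integral_mult_right)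
qed

lemma
  assumes A: "open A" "\<And>\<nu>. \<nu> \<in> A \<Longrightarrow> Re \<nu> > 0"
    and hol: "\<And>t. (\<lambda>\<nu>. \<phi> \<nu> t) holomorphic_on A"
    and cont: "\<And>\<nu>. \<nu> \<in> A \<Longrightarrow> continuous_on UNIV (\<phi> \<nu>)"
    and le: "\<And>\<nu> t. \<nu> \<in> A \<Longrightarrow> norm (\<phi> \<nu> t) \<le> w t"
  shows holomorphic_filter: "(\<lambda>\<nu>. halfline_filter \<nu> (\<phi> \<nu>) x) holomorphic_on A"
    and holomorphic_volterra: "(\<lambda>\<nu>. volterra \<nu> (\<phi> \<nu>) x) holomorphic_on A"
proof -
  have w0: "w t \<ge> 0" if "\<nu> \<in> A" for \<nu> t
    using order_trans[OF norm_ge_zero le[OF that]] .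
  show filt: "(\<lambda>\<nu>. halfline_filter \<nu> (\<phi> \<nu>) x) holomorphic_on A"
    unfolding halfline_filter_def set_lebesgue_integral_def
  proof (rule holomorphic_on_integral_dominated[OF A(1) _ _ _ w])
    show "(\<lambda>\<nu>. indicat_real {..<x} t *\<^sub>R (exp (- \<nu> * of_real (x - t)) * \<phi> \<nu> t)) holomorphic_on A" for t
      unfolding scaleR_conv_of_real by (intro holomorphic_intros hol)
    show "(\<lambda>t. indicat_real {..<x} t *\<^sub>R (exp (- \<nu> * of_real (x - t)) * \<phi> \<nu> t)) \<in> borel_measurable lborel"
      if "\<nu> \<in> A" for \<nu>
      using filter_integrable[OF A(2) cont le, OF that that that]
      by (auto simp: set_integrable_def)
    show "norm (indicat_real {..<x} t *\<^sub>R (exp (- \<nu> * of_real (x - t)) * \<phi> \<nu> t)) \<le> w t"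
      if "\<nu> \<in> A" for \<nu> t
    proof (cases "t < x")
      case True
      then show ?thesis
        unfolding norm_mult using mult_mono[OF norm_kernel_le(1)[OF A(2)[OF that], of "x - t"] le[OF that, of t]]
        by (simp add: norm_mult)
    qed (use w0[OF that] in auto)
  qed
  have P: "(\<lambda>\<nu>. LINT t:{..<x}|lborel. \<phi> \<nu> t) holomorphic_on A"
    unfolding set_lebesgue_integral_def
  proof (rule holomorphic_on_integral_dominated[OF A(1) _ _ _ w])
    show "(\<lambda>\<nu>. indicat_real {..<x} t *\<^sub>R \<phi> \<nu> t) holomorphic_on A" for t
      unfolding scaleR_conv_of_real by (intro holomorphic_intros hol)
    show "(\<lambda>t. indicat_real {..<x} t *\<^sub>R \<phi> \<nu> t) \<in> borel_measurable lborel" if "\<nu> \<in> A" for \<nu>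
      using source_integrable[OF A(2) cont le, OF that that that]
      by (auto simp: set_integrable_def)
    show "norm (indicat_real {..<x} t *\<^sub>R \<phi> \<nu> t) \<le> w t" if "\<nu> \<in> A" for \<nu> t
      using le[OF that] w0[OF that] by (cases "t < x") auto
  qed
  have "(\<lambda>\<nu>. ((LINT t:{..<x}|lborel. \<phi> \<nu> t) - halfline_filter \<nu> (\<phi> \<nu>) x) / \<nu>) holomorphic_on A"
    using A(2) by (intro holomorphic_intros P filt) fastforce
  then show "(\<lambda>\<nu>. volterra \<nu> (\<phi> \<nu>) x) holomorphic_on A"
    by (rule holomorphic_transform) (use volterra_eq[OF A(2) cont le] in auto)
qed

end

section \<open>Jost solutions\<close>

lemma integral_FTC_halfline:
  fixes H h :: "real \<Rightarrow> real"
  assumes H: "\<And>x. (H has_real_derivative h x) (at x)" and h: "continuous_on UNIV h" "\<And>x. h x \<ge> 0"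
    and lim: "(H \<longlongrightarrow> A) at_bot"
  shows "set_integrable lborel {..<x} h" "(LINT t:{..<x}|lborel. h t) = H x - A"
proof -
  have ev: "einterval (-\<infinity>) (ereal x) = {..<x}" by (auto simp: einterval_iff)
  have lims: "((H \<circ> real_of_ereal) \<longlongrightarrow> A) (at_right (-\<infinity>))"
       "((H \<circ> real_of_ereal) \<longlongrightarrow> H x) (at_left (ereal x))"
    using lim DERIV_isCont[OF H[of x]]
    by (simp_all add: ereal_tendsto_simps isCont_def filterlim_at_split)
  have "set_integrable lborel (einterval (-\<infinity>) (ereal x)) h"
       "(LBINT t=-\<infinity>..ereal x. h t) = H x - A"
    by (rule interval_integral_FTC_nonneg[OF _ H _ _ lims];
        use h in \<open>auto simp: continuous_on_eq_continuous_at\<close>)+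
  then show "set_integrable lborel {..<x} h" "(LINT t:{..<x}|lborel. h t) = H x - A"
    by (auto simp: interval_lebesgue_integral_def ev)
qed

lemma integrable_FTC_line:
  fixes H h :: "real \<Rightarrow> real"
  assumes H: "\<And>x. (H has_real_derivative h x) (at x)" and h: "continuous_on UNIV h" "\<And>x. h x \<ge> 0"
    and lim: "(H \<longlongrightarrow> A) at_bot" "(H \<longlongrightarrow> B) at_top"
  shows "integrable lborel h" "(\<integral>t. h t \<partial>lborel) = B - A"
proof -
  have ev: "einterval (-\<infinity>) \<infinity> = UNIV" by (auto simp: einterval_iff)
  have lims: "((H \<circ> real_of_ereal) \<longlongrightarrow> A) (at_right (-\<infinity>))"
       "((H \<circ> real_of_ereal) \<longlongrightarrow> B) (at_left \<infinity>)"
    using lim by (simp_all add: ereal_tendsto_simps)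
  have "set_integrable lborel (einterval (-\<infinity>) \<infinity>) h"
       "(LBINT t=-\<infinity>..\<infinity>. h t) = B - A"
    by (rule interval_integral_FTC_nonneg[OF _ H _ _ lims];
        use h in \<open>auto simp: continuous_on_eq_continuous_at\<close>)+
  then show "integrable lborel h" "(\<integral>t. h t \<partial>lborel) = B - A"
    by (auto simp: interval_lebesgue_integral_def ev set_integrable_def set_lebesgue_integral_def)
qed

lemma volterra_diff:
  assumes w: "integrable lborel w" and \<nu>: "Re \<nu> > 0"
    and \<phi>: "continuous_on UNIV \<phi>" "\<And>t. norm (\<phi> t) \<le> w t"
    and \<psi>: "continuous_on UNIV \<psi>" "\<And>t. norm (\<psi> t) \<le> w t"
  shows "volterra \<nu> \<phi> x - volterra \<nu> \<psi> x = volterra \<nu> (\<lambda>t. \<phi> t - \<psi> t) x"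
  unfolding volterra_def right_diff_distrib
  by (rule set_integral_diff(2)[symmetric]) (rule volterra_integrable[OF w \<nu>] \<phi> \<psi>)+

lemma kernel_bound_pos:
  fixes \<nu> :: complex
  assumes "Re \<nu> > 0" "2 / norm \<nu> \<le> B"
  shows "B > 0"
  using assms by (smt (verit) divide_pos_pos norm_eq_zero zero_complex.simps(1) zero_less_norm_iff)

text \<open>Successive approximations of \<open>u = 1 - volterra \<nu> (g u)\<close>, the integral form of
  \<open>u'' + \<nu> u' + g u = 0\<close> with \<open>u \<longrightarrow> 1\<close> and \<open>u' \<longrightarrow> 0\<close> at \<open>-\<infinity>\<close>.\<close>

primrec picard :: "(real \<Rightarrow> complex) \<Rightarrow> nat \<Rightarrow> complex \<Rightarrow> real \<Rightarrow> complex" where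
  "picard g 0 \<nu> = (\<lambda>x. 1)"
| "picard g (Suc n) \<nu> = (\<lambda>x. 1 - volterra \<nu> (\<lambda>t. g t * picard g n \<nu> t) x)"

definition jost :: "(real \<Rightarrow> complex) \<Rightarrow> complex \<Rightarrow> real \<Rightarrow> complex" where
  "jost g \<nu> x = lim (\<lambda>n. picard g n \<nu> x)"

definition jost' :: "(real \<Rightarrow> complex) \<Rightarrow> complex \<Rightarrow> real \<Rightarrow> complex" where
  "jost' g \<nu> x = - halfline_filter \<nu> (\<lambda>t. g t * jost g \<nu> t) x"

text \<open>The limit of \<open>jost g \<nu>\<close> at \<open>+\<infinity>\<close>, see \<open>jost_uniform_at_top\<close> below.\<close>

definition transmission :: "(real \<Rightarrow> complex) \<Rightarrow> complex \<Rightarrow> complex" where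
  "transmission g \<nu> = 1 - (\<integral>t. g t * jost g \<nu> t \<partial>lborel) / \<nu>"

text \<open>The majorant \<open>w\<close> of the potential comes with an antiderivative \<open>W\<close>, so that exponentials of \<open>W\<close>
  can serve as differentiable weights.\<close>

locale integrable_potential =
  fixes g :: "real \<Rightarrow> complex" and W w :: "real \<Rightarrow> real" and Wtot :: real
  assumes g_cont: "continuous_on UNIV g" and g_le: "\<And>t. norm (g t) \<le> w t"
    and W_deriv: "\<And>x. (W has_real_derivative w x) (at x)" and w_cont: "continuous_on UNIV w"
    and W_bot: "(W \<longlongrightarrow> 0) at_bot" and W_top: "(W \<longlongrightarrow> Wtot) at_top"
begin

lemma w_nonneg: "w t \<ge> 0" using order_trans[OF norm_ge_zero g_le] .

lemma w_integrable: "integrable lborel w" and w_integral: "(\<integral>t. w t \<partial>lborel) = Wtot"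
  using integrable_FTC_line[OF W_deriv w_cont w_nonneg W_bot W_top] by auto

lemma w_halfline: "(LINT t:{..<x}|lborel. w t) = W x"
  using integral_FTC_halfline[OF W_deriv w_cont w_nonneg W_bot] by auto

lemma W_nonneg: "W x \<ge> 0"
  unfolding w_halfline[symmetric] set_lebesgue_integral_def
  using w_nonneg by (intro integral_nonneg_AE) (auto simp: indicator_def)

lemma W_mono: "x \<le> y \<Longrightarrow> W x \<le> W y"
  using DERIV_nonneg_imp_nondecreasing[of x y W] W_deriv w_nonneg by blast

lemma W_le: "W x \<le> Wtot"
  by (rule tendsto_lowerbound[OF W_top]) (auto intro!: eventually_at_top_linorderI[of x] W_mono)

definition wexp :: "real \<Rightarrow> real \<Rightarrow> real" where "wexp B t = w t * exp (2 * B * W t)"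

lemma W_cont: "continuous_on UNIV W"
  using W_deriv DERIV_isCont continuous_at_imp_continuous_on by blast

lemma
  assumes B: "B > 0"
  shows wexp_integrable: "integrable lborel (wexp B)"
    and wexp_halfline: "(LINT t:{..<x}|lborel. wexp B t) = (exp (2 * B * W x) - 1) / (2 * B)"
proof -
  have d: "((\<lambda>x. exp (2 * B * W x) / (2 * B)) has_real_derivative wexp B x) (at x)" for x
    using B by (auto intro!: derivative_eq_intros W_deriv simp: wexp_def field_simps)
  have c: "continuous_on UNIV (wexp B)"
    unfolding wexp_def by (intro continuous_intros w_cont W_cont)
  have n: "wexp B x \<ge> 0" for x unfolding wexp_def using w_nonneg by simp
  have l: "((\<lambda>x. exp (2 * B * W x) / (2 * B)) \<longlongrightarrow> exp (2 * B * 0) / (2 * B)) at_bot"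
     "((\<lambda>x. exp (2 * B * W x) / (2 * B)) \<longlongrightarrow> exp (2 * B * Wtot) / (2 * B)) at_top"
    using B by (intro tendsto_intros W_bot W_top; simp)+
  show "integrable lborel (wexp B)"
    by (rule integrable_FTC_line[OF d c n l])
  have "(LINT t:{..<x}|lborel. wexp B t) = exp (2 * B * W x) / (2 * B) - exp (2 * B * 0) / (2 * B)"
    by (rule integral_FTC_halfline[OF d c n l(1)])
  then show "(LINT t:{..<x}|lborel. wexp B t) = (exp (2 * B * W x) - 1) / (2 * B)"
    by (simp add: diff_divide_distrib)
qed

text \<open>In the weight \<open>exp (2 B W)\<close> the operator \<open>p \<mapsto> volterra \<nu> (g p)\<close> has norm at most one half: the
  kernel is bounded by \<open>B\<close>, and \<open>w exp (2 B W)\<close> is \<open>1 / (2 B)\<close> times the derivative of the weight.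
  This is what makes the approximations converge on the whole line, however large \<open>g\<close> is.\<close>

lemma norm_volterra_exp_le:
  assumes \<nu>: "Re \<nu> > 0" and B: "2 / norm \<nu> \<le> B" and k: "k \<ge> 0"
    and p: "continuous_on UNIV p" "\<And>t. norm (p t) \<le> k * exp (2 * B * W t)"
  shows "norm (volterra \<nu> (\<lambda>t. g t * p t) x) \<le> k / 2 * (exp (2 * B * W x) - 1)"
proof -
  have B0: "B > 0" using kernel_bound_pos[OF \<nu> B] .
  have "norm (volterra \<nu> (\<lambda>t. g t * p t) x) \<le> 2 / norm \<nu> * (LINT t:{..<x}|lborel. k * wexp B t)"
  proof (rule norm_volterra_le[OF _ \<nu>])
    show "integrable lborel (\<lambda>t. k * wexp B t)" using wexp_integrable[OF B0] by simp
    show "continuous_on UNIV (\<lambda>t. g t * p t)" by (intro continuous_intros g_cont p)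
    show "norm (g t * p t) \<le> k * wexp B t" for t
      using mult_mono[OF g_le[of t] p(2)[of t]] w_nonneg[of t] by (simp add: norm_mult wexp_def mult_ac)
  qed
  also have "(LINT t:{..<x}|lborel. k * wexp B t) = k * ((exp (2 * B * W x) - 1) / (2 * B))"
    using wexp_halfline[OF B0] by (simp only: set_integral_mult_right)
  also have "2 / norm \<nu> * (k * ((exp (2 * B * W x) - 1) / (2 * B))) \<le>
             B * (k * ((exp (2 * B * W x) - 1) / (2 * B)))"
    using B0 k W_nonneg[of x] by (intro mult_right_mono B) auto
  also have "\<dots> = k / 2 * (exp (2 * B * W x) - 1)" using B0 by (simp add: field_simps)
  finally show ?thesis .
qed

lemma picard_cont_le:
  assumes \<nu>: "Re \<nu> > 0" and B: "2 / norm \<nu> \<le> B"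
  shows "continuous_on UNIV (picard g n \<nu>) \<and> (\<forall>x. norm (picard g n \<nu> x) \<le> exp (2 * B * W x))"
proof (induction n)
  case 0
  have B0: "B > 0" using kernel_bound_pos[OF \<nu> B] .
  then show ?case using W_nonneg by simp
next
  case (Suc n)
  have B0: "B > 0" using kernel_bound_pos[OF \<nu> B] .
  let ?\<phi> = "\<lambda>t. g t * picard g n \<nu> t"
  have \<phi>: "continuous_on UNIV ?\<phi>" using Suc by (intro continuous_intros g_cont) auto
  have le: "norm (?\<phi> t) \<le> wexp B t" for t
    using mult_mono[OF g_le[of t], of "norm (picard g n \<nu> t)" "exp (2 * B * W t)"] Suc w_nonneg[of t]
    by (auto simp: norm_mult wexp_def)
  have "continuous_on UNIV (volterra \<nu> ?\<phi>)"
    using volterra_has_derivative[OF wexp_integrable[OF B0] \<nu> \<phi> le]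
    by (auto intro!: continuous_at_imp_continuous_on has_vector_derivative_continuous)
  then have 1: "continuous_on UNIV (picard g (Suc n) \<nu>)" by (auto intro!: continuous_intros)
  have "norm (picard g (Suc n) \<nu> x) \<le> exp (2 * B * W x)" for x
  proof -
    have "norm (picard g (Suc n) \<nu> x) \<le> 1 + norm (volterra \<nu> ?\<phi> x)"
      using norm_triangle_ineq4[of 1 "volterra \<nu> ?\<phi> x"] by simp
    also have "\<dots> \<le> 1 + 1 / 2 * (exp (2 * B * W x) - 1)"
      using Suc by (intro add_left_mono norm_volterra_exp_le[OF \<nu> B]) auto
    also have "\<dots> \<le> exp (2 * B * W x)" using B0 W_nonneg[of x] by (simp add: field_simps)
    finally show ?thesis .
  qed
  with 1 show ?case by blast
qed

lemma picard_step_le: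
  assumes \<nu>: "Re \<nu> > 0" and B: "2 / norm \<nu> \<le> B"
  shows "norm (picard g (Suc n) \<nu> x - picard g n \<nu> x) \<le> (1/2) ^ n * exp (2 * B * W x)"
proof (induction n arbitrary: x)
  case 0
  have B0: "B > 0" using kernel_bound_pos[OF \<nu> B] .
  have "norm (volterra \<nu> (\<lambda>t. g t * picard g 0 \<nu> t) x) \<le> 1 / 2 * (exp (2 * B * W x) - 1)"
    using picard_cont_le[OF \<nu> B, of 0] by (intro norm_volterra_exp_le[OF \<nu> B]) auto
  also have "\<dots> \<le> exp (2 * B * W x)" using B0 W_nonneg[of x] by (simp add: field_simps)
  finally show ?case by simp
next
  case (Suc n)
  have B0: "B > 0" using kernel_bound_pos[OF \<nu> B] .
  have c: "continuous_on UNIV (\<lambda>t. g t * picard g m \<nu> t)" for m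
    using picard_cont_le[OF \<nu> B] by (intro continuous_intros g_cont) auto
  have le: "norm (g t * picard g m \<nu> t) \<le> wexp B t" for m t
    using mult_mono[OF g_le[of t], of "norm (picard g m \<nu> t)" "exp (2 * B * W t)"]
      picard_cont_le[OF \<nu> B, of m] w_nonneg[of t]
    by (auto simp: norm_mult wexp_def)
  have "picard g (Suc (Suc n)) \<nu> x - picard g (Suc n) \<nu> x =
      volterra \<nu> (\<lambda>t. g t * picard g n \<nu> t) x - volterra \<nu> (\<lambda>t. g t * picard g (Suc n) \<nu> t) x"
    by simp
  also have "\<dots> = volterra \<nu> (\<lambda>t. g t * picard g n \<nu> t - g t * picard g (Suc n) \<nu> t) x"
    by (rule volterra_diff[OF wexp_integrable[OF B0] \<nu> c le c le])
  also have "\<dots> = volterra \<nu> (\<lambda>t. g t * (picard g n \<nu> t - picard g (Suc n) \<nu> t)) x"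
    by (simp only: right_diff_distrib)
  also have "norm \<dots> \<le> (1/2)^n / 2 * (exp (2 * B * W x) - 1)"
  proof (rule norm_volterra_exp_le[OF \<nu> B])
    show "continuous_on UNIV (\<lambda>t. picard g n \<nu> t - picard g (Suc n) \<nu> t)"
      using picard_cont_le[OF \<nu> B] by (intro continuous_intros) blast+
    show "norm (picard g n \<nu> t - picard g (Suc n) \<nu> t) \<le> (1/2) ^ n * exp (2 * B * W t)" for t
      using Suc.IH by (simp only: norm_minus_commute)
  qed simp
  also have "\<dots> \<le> (1/2) ^ Suc n * exp (2 * B * W x)" by (simp add: field_simps)
  finally show ?case .
qed

text \<open>The approximations converge uniformly in \<open>x\<close> and \<open>\<nu>\<close> together; uniformity in \<open>\<nu>\<close> is the reason why
  the limit is holomorphic in \<open>\<nu>\<close>.\<close>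

lemma picard_uniform_limit:
  assumes B: "B > 0"
  shows "uniform_limit ({\<nu>. Re \<nu> > 0 \<and> 2 / norm \<nu> \<le> B} \<times> UNIV)
      (\<lambda>n (\<nu>, x). picard g n \<nu> x) (\<lambda>(\<nu>, x). jost g \<nu> x) sequentially"
proof -
  let ?S = "{\<nu>. Re \<nu> > 0 \<and> 2 / norm \<nu> \<le> B} \<times> (UNIV :: real set)"
  have "uniform_limit ?S (\<lambda>n z. \<Sum>i<n. picard g (Suc i) (fst z) (snd z) - picard g i (fst z) (snd z))
      (\<lambda>z. \<Sum>i. picard g (Suc i) (fst z) (snd z) - picard g i (fst z) (snd z)) sequentially"
  proof (rule Weierstrass_m_test)
    show "summable (\<lambda>n. (1/2) ^ n * exp (2 * B * Wtot))"
      by (intro summable_mult2 summable_geometric) simp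
    fix n z assume "z \<in> ?S"
    then have "norm (picard g (Suc n) (fst z) (snd z) - picard g n (fst z) (snd z))
        \<le> (1/2) ^ n * exp (2 * B * W (snd z))"
      by (intro picard_step_le) auto
    also have "\<dots> \<le> (1/2) ^ n * exp (2 * B * Wtot)"
      using B W_le[of "snd z"] by (intro mult_left_mono) auto
    finally show "norm (picard g (Suc n) (fst z) (snd z) - picard g n (fst z) (snd z))
        \<le> (1/2) ^ n * exp (2 * B * Wtot)" .
  qed
  then have "uniform_limit ?S (\<lambda>n z. picard g n (fst z) (snd z) - 1)
      (\<lambda>z. \<Sum>i. picard g (Suc i) (fst z) (snd z) - picard g i (fst z) (snd z)) sequentially"
    unfolding sum_lessThan_telescope[of "\<lambda>i. picard g i _ _"] by simp
  then have "uniform_limit ?S (\<lambda>n z. (picard g n (fst z) (snd z) - 1) + 1)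
      (\<lambda>z. (\<Sum>i. picard g (Suc i) (fst z) (snd z) - picard g i (fst z) (snd z)) + 1) sequentially"
    by (intro uniform_limit_add uniform_limit_const)
  then have *: "uniform_limit ?S (\<lambda>n z. picard g n (fst z) (snd z))
      (\<lambda>z. (\<Sum>i. picard g (Suc i) (fst z) (snd z) - picard g i (fst z) (snd z)) + 1) sequentially"
    by simp
  have "jost g (fst z) (snd z) = (\<Sum>i. picard g (Suc i) (fst z) (snd z) - picard g i (fst z) (snd z)) + 1"
    if "z \<in> ?S" for z
    unfolding jost_def by (rule limI) (rule tendsto_uniform_limitI[OF * that])
  then show ?thesis
    using uniform_limit_cong'[THEN iffD1, OF _ _ *] by (simp add: case_prod_unfold)
qed


lemma picard_uniform_limit':
  assumes \<nu>: "Re \<nu> > 0"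
  shows "uniform_limit UNIV (\<lambda>n. picard g n \<nu>) (jost g \<nu>) sequentially"
proof -
  have "2 / norm \<nu> > 0" using \<nu> by (auto simp: complex_eq_iff)
  from picard_uniform_limit[OF this] show ?thesis
    using \<nu> by (fastforce simp: uniform_limit_iff elim!: eventually_mono)
qed

lemma jost_cont: "Re \<nu> > 0 \<Longrightarrow> continuous_on UNIV (jost g \<nu>)"
  by (rule uniform_limit_theorem[OF _ picard_uniform_limit']) (auto intro!: always_eventually conjunct1[OF picard_cont_le[OF _ order.refl]])

lemma jost_le:
  assumes \<nu>: "Re \<nu> > 0" and B: "2 / norm \<nu> \<le> B"
  shows "norm (jost g \<nu> x) \<le> exp (2 * B * Wtot)"
proof (rule tendsto_upperbound)
  show "(\<lambda>n. norm (picard g n \<nu> x)) \<longlonglongrightarrow> norm (jost g \<nu> x)"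
    by (intro tendsto_norm tendsto_uniform_limitI[OF picard_uniform_limit'[OF \<nu>]]) simp
  have "norm (picard g n \<nu> x) \<le> exp (2 * B * Wtot)" for n
    using picard_cont_le[OF \<nu> B, of n] W_le[of x] kernel_bound_pos[OF \<nu> B]
    by (intro order_trans[OF conjunct2[OF picard_cont_le[OF \<nu> B], rule_format]]) auto
  then show "\<forall>\<^sub>F n in sequentially. norm (picard g n \<nu> x) \<le> exp (2 * B * Wtot)" by simp
qed simp

lemma source_cont: "Re \<nu> > 0 \<Longrightarrow> continuous_on UNIV (\<lambda>t. g t * jost g \<nu> t)"
  by (intro continuous_intros g_cont jost_cont)

lemma source_le:
  assumes \<nu>: "Re \<nu> > 0" and B: "2 / norm \<nu> \<le> B"
  shows "norm (g t * jost g \<nu> t) \<le> exp (2 * B * Wtot) * w t"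
  using mult_mono[OF g_le[of t] jost_le[OF \<nu> B, of t]] w_nonneg[of t] by (simp add: norm_mult mult.commute)

lemma scaled_w: "integrable lborel (\<lambda>t. M * w t)" "(LINT t:{..<x}|lborel. M * w t) = M * W x"
  using w_integrable w_halfline by (simp_all only: set_integral_mult_right integrable_mult_right)

lemma jost_fixed_point:
  assumes \<nu>: "Re \<nu> > 0"
  shows "jost g \<nu> x = 1 - volterra \<nu> (\<lambda>t. g t * jost g \<nu> t) x"
proof (rule LIMSEQ_unique)
  show "(\<lambda>n. picard g (Suc n) \<nu> x) \<longlonglongrightarrow> jost g \<nu> x"
    by (rule LIMSEQ_Suc, rule tendsto_uniform_limitI[OF picard_uniform_limit'[OF \<nu>]]) simp
  let ?V = "\<lambda>p. volterra \<nu> (\<lambda>t. g t * p t) x"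
  let ?M = "exp (2 * (2 / norm \<nu>) * Wtot)"
  have conts: "continuous_on UNIV (\<lambda>t. g t * picard g n \<nu> t)" for n
    using picard_cont_le[OF \<nu> order.refl] by (intro continuous_intros g_cont) auto
  have les: "norm (g t * picard g n \<nu> t) \<le> ?M * w t" for n t
  proof -
    have "norm (picard g n \<nu> t) \<le> ?M"
      using W_le[of t] \<nu> by (intro order_trans[OF conjunct2[OF picard_cont_le[OF \<nu> order.refl], rule_format]])
         (auto intro!: divide_right_mono)
    from mult_mono[OF g_le[of t] this] w_nonneg[of t] show ?thesis by (simp add: norm_mult mult.commute)
  qed
  have "(\<lambda>n. ?V (picard g n \<nu>) - ?V (jost g \<nu>)) \<longlonglongrightarrow> 0"
  proof (rule metric_LIMSEQ_I)
    fix e :: real assume e: "e > 0"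
    \<comment> \<open>If \<open>picard g n \<nu>\<close> is within \<open>d\<close> of its limit, the Volterra terms differ by at most
      \<open>2 / norm \<nu> * d * Wtot < e\<close>; the summand 1 avoids a division by zero.\<close>
    define d where "d = e / (2 / norm \<nu> * Wtot + 1)"
    have pos: "2 / norm \<nu> * Wtot + 1 > 0"
      using order_trans[OF W_nonneg W_le] by (smt (verit) divide_nonneg_nonneg mult_nonneg_nonneg norm_ge_zero)
    then have d: "d > 0" using e by (simp add: d_def)
    from uniform_limitD[OF picard_uniform_limit'[OF \<nu>] d]
    obtain N where N: "\<And>n t. n \<ge> N \<Longrightarrow> dist (picard g n \<nu> t) (jost g \<nu> t) < d"
      by (auto simp: eventually_sequentially)
    show "\<exists>N. \<forall>n\<ge>N. dist (?V (picard g n \<nu>) - ?V (jost g \<nu>)) 0 < e"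
    proof (intro exI allI impI)
      fix n assume n: "n \<ge> N"
      have "?V (picard g n \<nu>) - ?V (jost g \<nu>) = volterra \<nu> (\<lambda>t. g t * picard g n \<nu> t - g t * jost g \<nu> t) x"
        by (rule volterra_diff[OF scaled_w(1) \<nu> conts les source_cont[OF \<nu>] source_le[OF \<nu> order.refl]])
      also have "norm \<dots> \<le> 2 / norm \<nu> * (LINT t:{..<x}|lborel. d * w t)"
      proof (rule norm_volterra_le[OF scaled_w(1) \<nu>])
        show "continuous_on UNIV (\<lambda>t. g t * picard g n \<nu> t - g t * jost g \<nu> t)"
          by (intro continuous_on_diff conts source_cont \<nu>)
        show "norm (g t * picard g n \<nu> t - g t * jost g \<nu> t) \<le> d * w t" for t
          using mult_mono[OF g_le[of t] less_imp_le[OF N[OF n, of t]]] w_nonneg[of t]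
          by (simp add: dist_norm norm_mult mult.commute flip: right_diff_distrib)
      qed
      also have "\<dots> = 2 / norm \<nu> * (d * W x)" by (simp only: scaled_w)
      also have "\<dots> \<le> 2 / norm \<nu> * (d * Wtot)"
        using d W_le by (intro mult_left_mono) auto
      also have "\<dots> = d * (2 / norm \<nu> * Wtot)" by simp
      also have "\<dots> < d * (2 / norm \<nu> * Wtot + 1)" using d by (intro mult_strict_left_mono) auto
      also have "\<dots> = e" using pos by (simp add: d_def)
      finally show "dist (?V (picard g n \<nu>) - ?V (jost g \<nu>)) 0 < e" by simp
    qed
  qed
  then have "(\<lambda>n. ?V (picard g n \<nu>)) \<longlonglongrightarrow> ?V (jost g \<nu>)" by (simp only: LIM_zero_iff)
  then show "(\<lambda>n. picard g (Suc n) \<nu> x) \<longlonglongrightarrow> 1 - ?V (jost g \<nu>)"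
    by (auto intro!: tendsto_intros)
qed

lemma jost_has_derivative:
  assumes \<nu>: "Re \<nu> > 0"
  shows "(jost g \<nu> has_vector_derivative jost' g \<nu> x) (at x)"
    and "(jost' g \<nu> has_vector_derivative - \<nu> * jost' g \<nu> x - g x * jost g \<nu> x) (at x)"
proof -
  note s = source_cont[OF \<nu>] source_le[OF \<nu> order.refl]
  have "((\<lambda>x. 1 - volterra \<nu> (\<lambda>t. g t * jost g \<nu> t) x) has_vector_derivative
      0 - halfline_filter \<nu> (\<lambda>t. g t * jost g \<nu> t) x) (at x)"
    by (intro has_vector_derivative_diff has_vector_derivative_const volterra_has_derivative[OF scaled_w(1) \<nu> s])
  then show "(jost g \<nu> has_vector_derivative jost' g \<nu> x) (at x)"
    unfolding jost'_def jost_fixed_point[OF \<nu>, symmetric] by simp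
  have "((\<lambda>x. - halfline_filter \<nu> (\<lambda>t. g t * jost g \<nu> t) x) has_vector_derivative
      - (g x * jost g \<nu> x - \<nu> * halfline_filter \<nu> (\<lambda>t. g t * jost g \<nu> t) x)) (at x)"
    by (intro has_vector_derivative_minus filter_has_derivative[OF scaled_w(1) \<nu> s])
  then show "(jost' g \<nu> has_vector_derivative - \<nu> * jost' g \<nu> x - g x * jost g \<nu> x) (at x)"
    unfolding jost'_def[abs_def] by (simp add: algebra_simps)
qed

lemma jost'_le_W:
  assumes \<nu>: "Re \<nu> > 0" and B: "2 / norm \<nu> \<le> B"
  shows "norm (jost' g \<nu> x) \<le> exp (2 * B * Wtot) * W x"
  using norm_filter_le[OF scaled_w(1) \<nu> source_cont[OF \<nu>] source_le[OF \<nu> B], of x]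
  unfolding scaled_w(2) by (simp add: jost'_def)

lemma jost'_le:
  assumes \<nu>: "Re \<nu> > 0" and B: "2 / norm \<nu> \<le> B"
  shows "norm (jost' g \<nu> x) \<le> exp (2 * B * Wtot) * Wtot"
  using order_trans[OF jost'_le_W[OF \<nu> B] mult_left_mono[OF W_le]] by simp

lemma jost_at_bot:
  assumes \<nu>: "Re \<nu> > 0"
  shows "(jost g \<nu> \<longlongrightarrow> 1) at_bot" "(jost' g \<nu> \<longlongrightarrow> 0) at_bot"
proof -
  let ?M = "exp (2 * (2 / norm \<nu>) * Wtot)"
  show "(jost' g \<nu> \<longlongrightarrow> 0) at_bot"
  proof (rule Lim_null_comparison)
    show "((\<lambda>x. ?M * W x) \<longlongrightarrow> 0) at_bot" using tendsto_mult_left[OF W_bot] by force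
  qed (intro always_eventually allI jost'_le_W \<nu> order.refl)
  have "(volterra \<nu> (\<lambda>t. g t * jost g \<nu> t) \<longlongrightarrow> 0) at_bot"
  proof (rule Lim_null_comparison)
    show "\<forall>\<^sub>F x in at_bot. norm (volterra \<nu> (\<lambda>t. g t * jost g \<nu> t) x) \<le> 2 / norm \<nu> * (?M * W x)"
      using norm_volterra_le[OF scaled_w(1) \<nu> source_cont[OF \<nu>] source_le[OF \<nu> order.refl]]
      unfolding scaled_w(2) by (intro always_eventually) blast
    show "((\<lambda>x. 2 / norm \<nu> * (?M * W x)) \<longlongrightarrow> 0) at_bot"
      using tendsto_mult_left[OF tendsto_mult_left[OF W_bot, of ?M], of "2 / norm \<nu>"] by simp
  qed
  then have "((\<lambda>x. 1 - volterra \<nu> (\<lambda>t. g t * jost g \<nu> t) x) \<longlongrightarrow> 1 - 0) at_bot"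
    by (intro tendsto_intros)
  then show "(jost g \<nu> \<longlongrightarrow> 1) at_bot"
    unfolding jost_fixed_point[OF \<nu>, symmetric] by simp
qed

lemma picard_holomorphic:
  assumes B: "B > 0"
  shows "(\<lambda>\<nu>. picard g n \<nu> x) holomorphic_on {\<nu>. Re \<nu> > 0} \<inter> {\<nu>. 2 / B < norm \<nu>}"
proof (induction n arbitrary: x)
  case (Suc n)
  let ?A = "{\<nu>. Re \<nu> > 0} \<inter> {\<nu>. 2 / B < norm \<nu>}"
  have nB: "2 / norm \<nu> \<le> B" if "\<nu> \<in> ?A" for \<nu>
    using that B by (auto simp: field_simps complex_eq_iff)
  have "(\<lambda>\<nu>. volterra \<nu> (\<lambda>t. g t * picard g n \<nu> t) x) holomorphic_on ?A"
  proof (rule holomorphic_volterra[OF wexp_integrable[OF B]])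
    show "open ?A" by (intro open_Int open_halfspace_Re_gt open_Collect_less continuous_intros)
    show "continuous_on UNIV (\<lambda>t. g t * picard g n \<nu> t)" if "\<nu> \<in> ?A" for \<nu>
      using picard_cont_le[OF _ nB[OF that]] that by (intro continuous_intros g_cont) auto
    show "norm (g t * picard g n \<nu> t) \<le> wexp B t" if "\<nu> \<in> ?A" for \<nu> t
      using mult_mono[OF g_le[of t], of "norm (picard g n \<nu> t)" "exp (2 * B * W t)"]
        picard_cont_le[OF _ nB[OF that], of n] w_nonneg[of t] that
      by (auto simp: norm_mult wexp_def)
  qed (auto intro!: holomorphic_intros Suc)
  then show ?case by (auto intro!: holomorphic_intros)
qed simp

text \<open>The uniform estimates hold where \<open>norm \<nu> > 2 / B\<close>. These sets exhaust the half-plane as \<open>B\<close> grows.\<close>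

lemma halfplane_localize:
  assumes "\<And>B. B > 0 \<Longrightarrow> F holomorphic_on {\<nu>. Re \<nu> > 0} \<inter> {\<nu>. 2 / B < norm \<nu>}"
  shows "F holomorphic_on {\<nu>. Re \<nu> > 0}"
proof -
  have "open {\<nu>::complex. Re \<nu> > 0}" by (rule open_halfspace_Re_gt)
  moreover have "F field_differentiable at \<nu>" if "Re \<nu> > 0" for \<nu>
  proof -
    have n: "norm \<nu> > 0" using that by auto
    have "open ({\<nu>::complex. Re \<nu> > 0} \<inter> {\<nu>. 2 / (3 / norm \<nu>') < norm \<nu>})" for \<nu>' :: complex
      by (intro open_Int open_halfspace_Re_gt open_Collect_less continuous_intros)
    then show ?thesis
      using assms[of "3 / norm \<nu>"] n that
      by (auto intro!: holomorphic_on_imp_differentiable_at)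
  qed
  ultimately show ?thesis
    by (auto simp: holomorphic_on_def intro: field_differentiable_at_within)
qed

lemma jost_holomorphic: "(\<lambda>\<nu>. jost g \<nu> x) holomorphic_on {\<nu>. Re \<nu> > 0}"
proof (rule halfplane_localize)
  fix B :: real assume B: "B > 0"
  let ?A = "{\<nu>. Re \<nu> > 0} \<inter> {\<nu>. 2 / B < norm \<nu>}"
  have op: "open ?A" by (intro open_Int open_halfspace_Re_gt open_Collect_less continuous_intros)
  have "uniform_limit ?A (\<lambda>n \<nu>. picard g n \<nu> x) (\<lambda>\<nu>. jost g \<nu> x) sequentially"
  proof (rule uniform_limitI)
    fix e :: real assume "e > 0"
    from uniform_limitD[OF picard_uniform_limit[OF B] this]
    show "\<forall>\<^sub>F n in sequentially. \<forall>\<nu>\<in>?A. dist (picard g n \<nu> x) (jost g \<nu> x) < e"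
    proof (elim eventually_mono, intro ballI)
      fix n \<nu>
      assume all: "\<forall>z\<in>{\<nu>. Re \<nu> > 0 \<and> 2 / norm \<nu> \<le> B} \<times> UNIV.
           dist (case z of (\<nu>, x) \<Rightarrow> picard g n \<nu> x) (case z of (\<nu>, x) \<Rightarrow> jost g \<nu> x) < e"
        and \<nu>: "\<nu> \<in> ?A"
      have "2 / norm \<nu> \<le> B" using \<nu> B by (auto simp: field_simps complex_eq_iff)
      then show "dist (picard g n \<nu> x) (jost g \<nu> x) < e"
        using \<nu> bspec[OF all, of "(\<nu>, x)"] by simp
    qed
  qed
  then show "(\<lambda>\<nu>. jost g \<nu> x) holomorphic_on ?A"
    using op open_contains_cball[of ?A]
    by (intro holomorphic_uniform_sequence[where f = "\<lambda>n \<nu>. picard g n \<nu> x", OF op picard_holomorphic[OF B]])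
       (meson uniform_limit_on_subset)
qed

lemma jost'_holomorphic: "(\<lambda>\<nu>. jost' g \<nu> x) holomorphic_on {\<nu>. Re \<nu> > 0}"
proof (rule halfplane_localize)
  fix B :: real assume B: "B > 0"
  let ?A = "{\<nu>. Re \<nu> > 0} \<inter> {\<nu>. 2 / B < norm \<nu>}"
  have "(\<lambda>\<nu>. halfline_filter \<nu> (\<lambda>t. g t * jost g \<nu> t) x) holomorphic_on ?A"
  proof (rule holomorphic_filter[OF scaled_w(1)])
    show "open ?A" by (intro open_Int open_halfspace_Re_gt open_Collect_less continuous_intros)
    show "norm (g t * jost g \<nu> t) \<le> exp (2 * B * Wtot) * w t" if "\<nu> \<in> ?A" for \<nu> t
      using that B by (intro source_le) (auto simp: field_simps complex_eq_iff)
  qed (auto intro!: source_cont holomorphic_intros holomorphic_on_subset[OF jost_holomorphic])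
  then show "(\<lambda>\<nu>. jost' g \<nu> x) holomorphic_on ?A"
    unfolding jost'_def by (intro holomorphic_intros)
qed

text \<open>The part of \<open>\<phi>\<close> to the left of \<open>y\<close> reaches \<open>x\<close> damped by \<open>exp (-Re \<nu> (x - y))\<close>, and the part between
  \<open>y\<close> and \<open>x\<close> contributes at most \<open>W x - W y\<close>. For \<open>y = x / 2\<close> both bounds tend to 0 as \<open>x \<longrightarrow> \<infinity>\<close>.\<close>

lemma norm_filter_split_le:
  assumes \<nu>: "Re \<nu> > 0" and M: "M \<ge> 0" and cont: "continuous_on UNIV \<phi>"
    and le: "\<And>t. norm (\<phi> t) \<le> M * w t" and yx: "y \<le> x"
  shows "norm (halfline_filter \<nu> \<phi> x) \<le> M * (exp (- Re \<nu> * (x - y)) * W y + (W x - W y))"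
proof -
  define e where "e = exp (- Re \<nu> * (x - y))"
  have e: "0 \<le> e" "e \<le> 1" using \<nu> yx by (auto simp: e_def)
  \<comment> \<open>The pointwise majorant \<open>e M w\<close> left of \<open>y\<close> and \<open>M w\<close> right of it, written without case distinction.\<close>
  define k where "k = (\<lambda>t. M * w t - (1 - e) * (indicator {..<y} t * (M * w t)))"
  have i1: "set_integrable lborel {..<x} (\<lambda>t. M * w t)" using dominator_integrable[OF scaled_w(1)] .
  have eq: "indicator {..<x} t *\<^sub>R (indicator {..<y} t * (M * w t)) = indicator {..<y} t *\<^sub>R (M * w t)" for t
    using yx by (auto simp: indicator_def)
  have i2: "set_integrable lborel {..<x} (\<lambda>t. indicator {..<y} t * (M * w t))"
    using dominator_integrable[OF scaled_w(1), of y M] unfolding set_integrable_def eq by simp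
  have i3: "set_integrable lborel {..<x} (\<lambda>t. (1 - e) * (indicator {..<y} t * (M * w t)))"
    using i2 by (simp add: set_integrable_mult_right)
  have int_k: "set_integrable lborel {..<x} k"
    unfolding k_def by (rule set_integral_diff(1)[OF i1 i3])
  have "(LINT t:{..<x}|lborel. k t) = M * W x - (1 - e) * (M * W y)"
  proof -
    have "(LINT t:{..<x}|lborel. k t) = (LINT t:{..<x}|lborel. M * w t) -
        (LINT t:{..<x}|lborel. (1 - e) * (indicator {..<y} t * (M * w t)))"
      unfolding k_def by (rule set_integral_diff(2)[OF i1 i3])
    also have "(LINT t:{..<x}|lborel. (1 - e) * (indicator {..<y} t * (M * w t))) =
       (1 - e) * (LINT t:{..<x}|lborel. indicator {..<y} t * (M * w t))"
      by (rule set_integral_mult_right)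
    also have "(LINT t:{..<x}|lborel. indicator {..<y} t * (M * w t)) = (LINT t:{..<y}|lborel. M * w t)"
      unfolding set_lebesgue_integral_def eq ..
    finally show ?thesis by (simp only: scaled_w)
  qed
  moreover have "norm (halfline_filter \<nu> \<phi> x) \<le> (LINT t:{..<x}|lborel. k t)"
    unfolding halfline_filter_def
  proof (rule norm_set_integral_le[OF filter_integrable[OF scaled_w(1) \<nu> cont le] int_k])
    fix t assume t: "t \<in> {..<x}"
    have Mw: "M * w t \<ge> 0" using M w_nonneg by simp
    show "norm (exp (- \<nu> * of_real (x - t)) * \<phi> t) \<le> k t"
    proof (cases "t < y")
      case True
      have "norm (exp (- \<nu> * of_real (x - t))) \<le> e"
        unfolding norm_exp_eq_Re e_def using \<nu> True by (simp add: mult_left_mono)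
      from mult_mono[OF this le[of t]] e True show ?thesis
        by (simp add: norm_mult k_def algebra_simps)
    next
      case False
      have "norm (exp (- \<nu> * of_real (x - t))) \<le> 1" using norm_kernel_le(1)[OF \<nu>, of "x - t"] t by simp
      from mult_mono[OF this le[of t]] False Mw show ?thesis
        by (simp add: norm_mult k_def)
    qed
  qed
  ultimately show ?thesis by (simp add: e_def algebra_simps)
qed

text \<open>The convergence at \<open>+\<infinity>\<close> is uniform on half-planes \<open>Re \<nu> \<ge> \<rho>\<close>. For \<open>jost'\<close> this is the preceding
  estimate; for \<open>jost\<close>, the fixed-point equation gives
  \<open>jost g \<nu> x = 1 - ((LINT t:{..<x}|lborel. g t * jost g \<nu> t) + jost' g \<nu> x) / \<nu>\<close>, which differs from
  its limit by the tail of the integral and by a multiple of \<open>jost'\<close>.\<close>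

lemma
  assumes \<rho>: "\<rho> > 0"
  shows jost'_uniform_at_top: "uniform_limit {\<nu>. Re \<nu> \<ge> \<rho>} (\<lambda>x \<nu>. jost' g \<nu> x) (\<lambda>_. 0) at_top"
    and jost_uniform_at_top: "uniform_limit {\<nu>. Re \<nu> \<ge> \<rho>} (\<lambda>x \<nu>. jost g \<nu> x) (transmission g) at_top"
proof -
  define M where "M = exp (2 * (2 / \<rho>) * Wtot)"
  have M: "M \<ge> 0" by (simp add: M_def)
  have n\<rho>: "\<rho> \<le> norm \<nu>" if "Re \<nu> \<ge> \<rho>" for \<nu>
    using that complex_Re_le_cmod[of \<nu>] by linarith
  have B: "2 / norm \<nu> \<le> 2 / \<rho>" if "Re \<nu> \<ge> \<rho>" for \<nu>
    using n\<rho>[OF that] \<rho> by (intro divide_left_mono mult_pos_pos) linarith+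
  have le: "norm (g t * jost g \<nu> t) \<le> M * w t" if "Re \<nu> \<ge> \<rho>" for \<nu> t
    unfolding M_def using that \<rho> by (intro source_le B) auto
  define b1 where "b1 = (\<lambda>x. M * (exp (- \<rho> * (x / 2)) * Wtot + (W x - W (x / 2))))"
  have half: "filterlim (\<lambda>x::real. x / 2) at_top at_top"
    by (rule filterlim_at_top_mult_tendsto_pos[of "\<lambda>_. 1/2" "1/2" _ "\<lambda>x. x", simplified]) (auto simp: filterlim_ident)
  have b1_lim: "(b1 \<longlongrightarrow> 0) at_top"
  proof -
    have "((\<lambda>x. exp (- (\<rho> * (x / 2)))) \<longlongrightarrow> 0) at_top"
      by (rule filterlim_compose[OF exp_at_bot], subst filterlim_uminus_at_top[symmetric])
         (rule filterlim_tendsto_pos_mult_at_top[OF tendsto_const \<rho> half])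
    then have "(b1 \<longlongrightarrow> M * (0 * Wtot + (Wtot - Wtot))) at_top"
      unfolding b1_def by (intro tendsto_intros W_top filterlim_compose[OF W_top half]) simp
    then show ?thesis by simp
  qed
  have filt: "norm (jost' g \<nu> x) \<le> b1 x" if "Re \<nu> \<ge> \<rho>" "x \<ge> 0" for \<nu> x
  proof -
    have "norm (jost' g \<nu> x) \<le> M * (exp (- Re \<nu> * (x - x / 2)) * W (x / 2) + (W x - W (x / 2)))"
      unfolding jost'_def norm_minus_cancel
      using that \<rho> by (intro norm_filter_split_le M source_cont le) auto
    also have "\<dots> \<le> b1 x"
      unfolding b1_def using that W_le W_nonneg
      by (intro mult_left_mono add_right_mono mult_mono M) (auto intro!: mult_right_mono)
    finally show ?thesis .
  qed
  show "uniform_limit {\<nu>. Re \<nu> \<ge> \<rho>} (\<lambda>x \<nu>. jost' g \<nu> x) (\<lambda>_. 0) at_top"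
  proof (rule uniform_limitI)
    fix e :: real assume "e > 0"
    then have "\<forall>\<^sub>F x in at_top. b1 x < e" using b1_lim by (simp add: order_tendsto_iff)
    then show "\<forall>\<^sub>F x in at_top. \<forall>\<nu>\<in>{\<nu>. Re \<nu> \<ge> \<rho>}. dist (jost' g \<nu> x) 0 < e"
      using eventually_ge_at_top[of 0] by eventually_elim (use filt in fastforce)
  qed
  define b2 where "b2 = (\<lambda>x. (M * (Wtot - W x) + b1 x) / \<rho>)"
  have b2_lim: "(b2 \<longlongrightarrow> 0) at_top"
  proof -
    have "(b2 \<longlongrightarrow> (M * (Wtot - Wtot) + 0) / \<rho>) at_top"
      unfolding b2_def using \<rho> by (intro tendsto_intros W_top b1_lim) auto
    then show ?thesis by simp
  qed
  have dev: "norm (jost g \<nu> x - transmission g \<nu>) \<le> b2 x" if \<nu>: "Re \<nu> \<ge> \<rho>" and x: "x \<ge> 0" for \<nu> x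
  proof -
    have \<nu>0: "Re \<nu> > 0" "\<nu> \<noteq> 0" using \<nu> \<rho> by auto
    let ?\<phi> = "\<lambda>t. g t * jost g \<nu> t"
    have int: "integrable lborel ?\<phi>"
      by (rule Bochner_Integration.integrable_bound[OF scaled_w(1)[of M]])
         (use le[OF \<nu>] source_cont[OF \<nu>0(1)] M w_nonneg in \<open>auto intro!: borel_measurable_continuous_onI\<close>)
    have sint: "set_integrable lborel S ?\<phi>" if "S \<in> sets borel" for S
      unfolding set_integrable_def using int that by (intro integrable_mult_indicator) auto
    have sintw: "set_integrable lborel S (\<lambda>t. M * w t)" if "S \<in> sets borel" for S
      unfolding set_integrable_def using scaled_w(1) that by (intro integrable_mult_indicator) auto
    have split: "{..<x} \<union> {x..} = (UNIV :: real set)" by auto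
    have "(\<integral>t. ?\<phi> t \<partial>lborel) = (LINT t:{..<x}|lborel. ?\<phi> t) + (LINT t:{x..}|lborel. ?\<phi> t)"
      by (subst set_integral_Un[symmetric]) (auto simp: split set_lebesgue_integral_def intro!: sint)
    moreover have "(\<integral>t. M * w t \<partial>lborel) = (LINT t:{..<x}|lborel. M * w t) + (LINT t:{x..}|lborel. M * w t)"
      by (subst set_integral_Un[symmetric]) (auto simp: split set_lebesgue_integral_def intro!: sintw)
    then have "(LINT t:{x..}|lborel. M * w t) = M * (Wtot - W x)"
      unfolding scaled_w(2) using w_integral by (simp add: algebra_simps)
    then have tail: "norm (LINT t:{x..}|lborel. ?\<phi> t) \<le> M * (Wtot - W x)"
      using norm_set_integral_le[where S = "{x..}", OF sint sintw le[OF \<nu>]] by (metis atLeast_borel)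
    have "jost g \<nu> x = 1 - ((LINT t:{..<x}|lborel. ?\<phi> t) - halfline_filter \<nu> ?\<phi> x) / \<nu>"
      unfolding volterra_eq[OF scaled_w(1) \<nu>0(1) source_cont[OF \<nu>0(1)] le[OF \<nu>], symmetric]
      by (rule jost_fixed_point[OF \<nu>0(1)])
    ultimately have "jost g \<nu> x - transmission g \<nu> = ((LINT t:{x..}|lborel. ?\<phi> t) - jost' g \<nu> x) / \<nu>"
      unfolding transmission_def jost'_def using \<nu>0 by (simp add: field_simps)
    also have "norm \<dots> \<le> (M * (Wtot - W x) + b1 x) / norm \<nu>"
      unfolding norm_divide using tail filt[OF \<nu> x]
      by (intro divide_right_mono order_trans[OF norm_triangle_ineq4] add_mono) auto
    also have "\<dots> \<le> b2 x"
      unfolding b2_def using n\<rho>[OF \<nu>] \<rho> M W_le[of x] order_trans[OF norm_ge_zero filt[OF \<nu> x]]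
      by (intro divide_left_mono add_nonneg_nonneg mult_nonneg_nonneg mult_pos_pos) auto
    finally show ?thesis .
  qed
  show "uniform_limit {\<nu>. Re \<nu> \<ge> \<rho>} (\<lambda>x \<nu>. jost g \<nu> x) (transmission g) at_top"
  proof (rule uniform_limitI)
    fix e :: real assume "e > 0"
    then have "\<forall>\<^sub>F x in at_top. b2 x < e" using b2_lim by (simp add: order_tendsto_iff)
    then show "\<forall>\<^sub>F x in at_top. \<forall>\<nu>\<in>{\<nu>. Re \<nu> \<ge> \<rho>}. dist (jost g \<nu> x) (transmission g \<nu>) < e"
      using eventually_ge_at_top[of 0]
      by eventually_elim (use dev in \<open>force simp: dist_norm\<close>)
  qed
qed

end

text \<open>The majorant is \<open>C / cosh (a t)\<close>, written with exponentials. It dominates \<open>C exp (-a \<bar>t\<bar>)\<close>, is smooth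
  and has an elementary antiderivative.\<close>

lemma exponential_decay_potential:
  fixes g :: "real \<Rightarrow> complex"
  assumes a: "a > 0" and C: "C \<ge> 0" and cont: "continuous_on UNIV g"
    and le: "\<And>t. norm (g t) \<le> C * exp (- a * \<bar>t\<bar>)"
  defines "W \<equiv> (\<lambda>t. 2 * C / a * arctan (exp (a * t)))"
    and "w \<equiv> (\<lambda>t. 2 * C * exp (a * t) / (1 + (exp (a * t))\<^sup>2))"
  shows "integrable_potential g W w (C * pi / a)"
proof
  have pos: "1 + (exp (a * t))\<^sup>2 > 0" for t :: real
    by (smt (verit) zero_le_power2)
  show "norm (g t) \<le> w t" for t
  proof -
    have "exp (- a * \<bar>t\<bar>) * (1 + (exp (a * t))\<^sup>2) \<le> 2 * exp (a * t)"
    proof (cases "t \<ge> 0")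
      case True
      then have "exp (- a * \<bar>t\<bar>) * (1 + (exp (a * t))\<^sup>2) = exp (- (a * t)) + exp (a * t)"
        by (simp add: algebra_simps power2_eq_square mult_exp_exp)
      moreover have "exp (- (a * t)) \<le> exp (a * t)" using True a by simp
      ultimately show ?thesis by simp
    next
      case False
      then have "exp (- a * \<bar>t\<bar>) * (1 + (exp (a * t))\<^sup>2) = exp (a * t) + exp (a * t) * (exp (a * t))\<^sup>2"
        by (simp add: algebra_simps)
      moreover have "(exp (a * t))\<^sup>2 \<le> 1" using False a
        by (simp add: power_le_one mult_le_0_iff)
      then have "exp (a * t) * (exp (a * t))\<^sup>2 \<le> exp (a * t)"
        by (metis exp_ge_zero mult.right_neutral mult_left_mono)
      ultimately show ?thesis by simp
    qed
    then have "exp (- a * \<bar>t\<bar>) \<le> 2 * exp (a * t) / (1 + (exp (a * t))\<^sup>2)"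
      using pos by (simp add: pos_le_divide_eq)
    then have "C * exp (- a * \<bar>t\<bar>) \<le> C * (2 * exp (a * t) / (1 + (exp (a * t))\<^sup>2))"
      using C by (rule mult_left_mono)
    with le[of t] show ?thesis by (simp add: w_def mult_ac)
  qed
  show "(W has_real_derivative w x) (at x)" for x
  proof -
    have "(W has_real_derivative 2 * C / a * (inverse (1 + (exp (a * x))\<^sup>2) * (exp (a * x) * a))) (at x)"
      unfolding W_def by (auto intro!: derivative_eq_intros)
    also have "2 * C / a * (inverse (1 + (exp (a * x))\<^sup>2) * (exp (a * x) * a)) = w x"
      unfolding w_def using a by (simp add: inverse_eq_divide)
    finally show ?thesis .
  qed
  show "continuous_on UNIV w"
    unfolding w_def using pos by (intro continuous_intros) (metis less_irrefl)
  have lin: "filterlim (\<lambda>t. a * t) at_top at_top" "filterlim (\<lambda>t. a * t) at_bot at_bot"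
    using a filterlim_tendsto_pos_mult_at_top[OF tendsto_const a filterlim_ident]
      filterlim_tendsto_pos_mult_at_bot[OF tendsto_const a filterlim_ident] by auto
  have "(W \<longlongrightarrow> 2 * C / a * arctan 0) at_bot"
    unfolding W_def by (intro tendsto_intros filterlim_compose[OF exp_at_bot lin(2)])
  then show "(W \<longlongrightarrow> 0) at_bot" by simp
  have "(W \<longlongrightarrow> 2 * C / a * (pi / 2)) at_top"
    unfolding W_def
    by (intro tendsto_mult tendsto_const filterlim_compose[OF tendsto_arctan_at_top]
        filterlim_compose[OF exp_at_top lin(1)])
  then show "(W \<longlongrightarrow> C * pi / a) at_top" by simp
qed (rule cont)

section \<open>Linear second-order equations\<close>

text \<open>The equation \<open>y'' + b y' + q y = h\<close>, written as a first-order system with \<open>z = y'\<close>.\<close>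

definition lin2 :: "complex \<Rightarrow> (real \<Rightarrow> complex) \<Rightarrow> (real \<Rightarrow> complex) \<Rightarrow> (real \<Rightarrow> complex) \<Rightarrow> (real \<Rightarrow> complex) \<Rightarrow> bool"
  where "lin2 b q h y z \<longleftrightarrow> (\<forall>x. (y has_vector_derivative z x) (at x) \<and>
     (z has_vector_derivative (h x - b * z x - q x * y x)) (at x))"

lemma lin2D:
  assumes "lin2 b q h y z"
  shows "(y has_vector_derivative z x) (at x)"
    "(z has_vector_derivative (h x - b * z x - q x * y x)) (at x)"
  using assms by (auto simp: lin2_def)

lemma lin2_add:
  assumes "lin2 b q h y z" "lin2 b q h' y' z'"
  shows "lin2 b q (\<lambda>x. h x + h' x) (\<lambda>x. y x + y' x) (\<lambda>x. z x + z' x)"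
  unfolding lin2_def
proof (intro allI conjI)
  fix x
  show "((\<lambda>x. y x + y' x) has_vector_derivative z x + z' x) (at x)"
    by (intro has_vector_derivative_add lin2D(1)[OF assms(1)] lin2D(1)[OF assms(2)])
  have "((\<lambda>x. z x + z' x) has_vector_derivative (h x - b * z x - q x * y x) + (h' x - b * z' x - q x * y' x)) (at x)"
    by (intro has_vector_derivative_add lin2D(2)[OF assms(1)] lin2D(2)[OF assms(2)])
  then show "((\<lambda>x. z x + z' x) has_vector_derivative (h x + h' x - b * (z x + z' x) - q x * (y x + y' x))) (at x)"
    by (simp add: algebra_simps)
qed

lemma lin2_scale:
  assumes "lin2 b q h y z"
  shows "lin2 b q (\<lambda>x. k * h x) (\<lambda>x. k * y x) (\<lambda>x. k * z x)"
  unfolding lin2_def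
proof (intro allI conjI)
  fix x
  show "((\<lambda>x. k * y x) has_vector_derivative k * z x) (at x)"
    by (intro has_vector_derivative_mult_right lin2D(1)[OF assms])
  have "((\<lambda>x. k * z x) has_vector_derivative k * (h x - b * z x - q x * y x)) (at x)"
    by (intro has_vector_derivative_mult_right lin2D(2)[OF assms])
  then show "((\<lambda>x. k * z x) has_vector_derivative (k * h x - b * (k * z x) - q x * (k * y x))) (at x)"
    by (simp add: algebra_simps)
qed

lemma lin2_zero: "lin2 b q (\<lambda>_. 0) (\<lambda>_. 0) (\<lambda>_. 0)"
  by (simp add: lin2_def)

lemma lin2_sum:
  assumes "\<And>i. i \<in> I \<Longrightarrow> lin2 b q (h i) (y i) (z i)"
  shows "lin2 b q (\<lambda>x. \<Sum>i\<in>I. k i * h i x) (\<lambda>x. \<Sum>i\<in>I. k i * y i x) (\<lambda>x. \<Sum>i\<in>I. k i * z i x)"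
proof (cases "finite I")
  case True
  then show ?thesis using assms
  proof (induction I rule: finite_induct)
    case (insert j I)
    then have "lin2 b q (\<lambda>x. k j * h j x + (\<Sum>i\<in>I. k i * h i x)) (\<lambda>x. k j * y j x + (\<Sum>i\<in>I. k i * y i x))
        (\<lambda>x. k j * z j x + (\<Sum>i\<in>I. k i * z i x))"
      by (intro lin2_add lin2_scale) auto
    then show ?case using insert by simp
  qed (simp add: lin2_zero)
qed (simp add: lin2_zero)

lemma lin2_diff:
  assumes "lin2 b q h y z" "lin2 b q h' y' z'"
  shows "lin2 b q (\<lambda>x. h x - h' x) (\<lambda>x. y x - y' x) (\<lambda>x. z x - z' x)"
  using lin2_add[OF assms(1) lin2_scale[OF assms(2), of "-1"]] by simp

text \<open>Gronwall's argument: \<open>N = |y|\<^sup>2 + |z|\<^sup>2\<close> satisfies \<open>|N'| \<le> k N\<close>, so \<open>N exp (-k x)\<close> decreases and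
  \<open>N exp (k x)\<close> increases; both vanish at \<open>x0\<close>.\<close>

lemma lin2_unique:
  assumes sol: "lin2 b q (\<lambda>_. 0) y z" and Q: "\<And>x. norm (q x) \<le> Q"
    and init: "y x0 = 0" "z x0 = 0"
  shows "y x = 0" "z x = 0"
proof -
  define N where "N = (\<lambda>x. y x \<bullet> y x + z x \<bullet> z x)"
  define z' where "z' = (\<lambda>x. 0 - b * z x - q x * y x)"
  define N' where "N' = (\<lambda>x. (y x \<bullet> z x + z x \<bullet> y x) + (z x \<bullet> z' x + z' x \<bullet> z x))"
  define k where "k = 1 + Q + 2 * norm b"
  have N0: "N x \<ge> 0" for x by (simp add: N_def)
  have dz: "(z has_vector_derivative z' x) (at x)" for x
    using lin2D(2)[OF sol] by (simp add: z'_def)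
  have dN: "(N has_real_derivative N' x) (at x)" for x
    unfolding has_real_derivative_iff_has_vector_derivative N_def N'_def
    by (intro has_vector_derivative_add bounded_bilinear.has_vector_derivative[OF bounded_bilinear_inner]
        lin2D(1)[OF sol] dz)
  have bound: "\<bar>N' x\<bar> \<le> k * N x" for x
  proof -
    have 1: "\<bar>y x \<bullet> z x\<bar> \<le> norm (y x) * norm (z x)" by (rule Cauchy_Schwarz_ineq2)
    have "norm (z' x) \<le> norm b * norm (z x) + Q * norm (y x)"
    proof -
      have "norm (z' x) \<le> norm (b * z x) + norm (q x * y x)"
        unfolding z'_def by (metis diff_0 norm_minus_cancel norm_triangle_ineq4)
      also have "\<dots> \<le> norm b * norm (z x) + Q * norm (y x)"
        using Q[of x] by (auto simp: norm_mult intro!: mult_right_mono)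
      finally show ?thesis .
    qed
    then have "norm (z x) * norm (z' x) \<le> norm (z x) * (norm b * norm (z x) + Q * norm (y x))"
      by (intro mult_left_mono) auto
    then have 2: "\<bar>z x \<bullet> z' x\<bar> \<le> norm (z x) * (norm b * norm (z x) + Q * norm (y x))"
      using Cauchy_Schwarz_ineq2[of "z x" "z' x"] by linarith
    have eq: "N' x = 2 * (y x \<bullet> z x) + 2 * (z x \<bullet> z' x)" by (simp add: N'_def inner_commute)
    have am: "2 * (norm (y x) * norm (z x)) \<le> norm (y x) ^ 2 + norm (z x) ^ 2"
      using sum_squares_bound[of "norm (y x)" "norm (z x)"] by (simp add: mult_ac)
    have Q0: "Q \<ge> 0" using order_trans[OF norm_ge_zero Q] .
    have "\<bar>N' x\<bar> \<le> 2 * (norm (y x) * norm (z x)) + 2 * (norm (z x) * (norm b * norm (z x) + Q * norm (y x)))"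
      using 1 2 unfolding eq by linarith
    also have "\<dots> = (1 + Q) * (2 * (norm (y x) * norm (z x))) + 2 * norm b * norm (z x) ^ 2"
      by (simp add: algebra_simps power2_eq_square)
    also have "\<dots> \<le> (1 + Q) * (norm (y x) ^ 2 + norm (z x) ^ 2) + 2 * norm b * (norm (y x) ^ 2 + norm (z x) ^ 2)"
      using am Q0 by (intro add_mono mult_left_mono) auto
    also have "\<dots> = k * N x" by (simp add: k_def N_def power2_norm_eq_inner algebra_simps)
    finally show ?thesis .
  qed
  have "N x = 0"
  proof (cases "x0 \<le> x")
    case True
    have "N x * exp (- k * x) \<le> N x0 * exp (- k * x0)"
    proof (rule DERIV_nonpos_imp_nonincreasing[OF True])
      fix t
      have "((\<lambda>x. N x * exp (- k * x)) has_real_derivative (N' t - k * N t) * exp (- k * t)) (at t)"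
        by (auto intro!: derivative_eq_intros dN simp: algebra_simps)
      moreover have "(N' t - k * N t) * exp (- k * t) \<le> 0"
        using bound[of t] by (intro mult_nonpos_nonneg) auto
      ultimately show "\<exists>y. ((\<lambda>x. N x * exp (- k * x)) has_real_derivative y) (at t) \<and> y \<le> 0" by blast
    qed
    then have "N x * exp (- k * x) \<le> 0" by (simp add: N_def init)
    then have "N x \<le> 0" by (simp add: mult_le_0_iff)
    with N0[of x] show ?thesis by simp
  next
    case False
    then have le: "x \<le> x0" by simp
    have "N x * exp (k * x) \<le> N x0 * exp (k * x0)"
    proof (rule DERIV_nonneg_imp_nondecreasing[OF le])
      fix t
      have "((\<lambda>x. N x * exp (k * x)) has_real_derivative (N' t + k * N t) * exp (k * t)) (at t)"
        by (auto intro!: derivative_eq_intros dN simp: algebra_simps)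
      moreover have "(N' t + k * N t) * exp (k * t) \<ge> 0"
        using bound[of t] by (intro mult_nonneg_nonneg) auto
      ultimately show "\<exists>y. ((\<lambda>x. N x * exp (k * x)) has_real_derivative y) (at t) \<and> 0 \<le> y" by blast
    qed
    then have "N x * exp (k * x) \<le> 0" by (simp add: N_def init)
    then have "N x \<le> 0" by (simp add: mult_le_0_iff)
    with N0[of x] show ?thesis by simp
  qed
  moreover have "y x \<bullet> y x \<ge> 0" "z x \<bullet> z x \<ge> 0" by simp_all
  ultimately have "y x \<bullet> y x = 0" "z x \<bullet> z x = 0" unfolding N_def by linarith+
  then show "y x = 0" "z x = 0" by simp_all
qed

lemma has_vector_derivative_exp_linear:
  "((\<lambda>x. exp (m * complex_of_real x)) has_vector_derivative m * exp (m * of_real x)) (at x within S)"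
  by (rule has_vector_derivative_eq_rhs, rule has_vector_derivative_real_field)
     (auto intro!: derivative_eq_intros)

text \<open>Abel's identity.\<close>

lemma wronskian_exp:
  assumes "lin2 b q (\<lambda>_. 0) y z" "lin2 b q (\<lambda>_. 0) y' z'"
  shows "exp (b * of_real x) * (y x * z' x - z x * y' x) = exp (b * of_real x0) * (y x0 * z' x0 - z x0 * y' x0)"
proof -
  let ?w = "\<lambda>x. exp (b * complex_of_real x) * (y x * z' x - z x * y' x)"
  have "(?w has_vector_derivative
     exp (b * of_real x) * ((y x * (0 - b * z' x - q x * y' x) + z x * z' x) - (z x * z' x + (0 - b * z x - q x * y x) * y' x))
      + b * exp (b * of_real x) * (y x * z' x - z x * y' x)) (at x within UNIV)" for x
    by (intro has_vector_derivative_mult has_vector_derivative_exp_linear has_vector_derivative_diff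
         lin2D(1)[OF assms(1)] lin2D(2)[OF assms(1)] lin2D(1)[OF assms(2)] lin2D(2)[OF assms(2)])
  then have "(?w has_vector_derivative 0) (at x within UNIV)" for x
    by (rule has_vector_derivative_eq_rhs) (simp add: algebra_simps)
  then obtain k where "?w x = k" for x
    using has_vector_derivative_zero_constant[of UNIV ?w] by auto
  then show ?thesis by metis
qed

text \<open>By Abel's identity the Wronskian times \<open>exp (b x)\<close> is constant. It tends to 0 along \<open>F\<close> when one
  solution beats the weight \<open>exp (b x)\<close> and the other one stays bounded.\<close>

lemma wronskian_vanishes:
  assumes sol: "lin2 b q (\<lambda>_. 0) y z" and p: "lin2 b q (\<lambda>_. 0) p p'" and F: "F \<noteq> bot"
    and lim: "((\<lambda>x. exp (b * of_real x) * y x) \<longlongrightarrow> 0) F" "((\<lambda>x. exp (b * of_real x) * z x) \<longlongrightarrow> 0) F"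
    and bd: "\<forall>\<^sub>F x in F. norm (p x) \<le> B \<and> norm (p' x) \<le> B"
  shows "y x * p' x - z x * p x = 0"
proof -
  let ?e = "\<lambda>x. exp (b * complex_of_real x)"
  let ?w = "\<lambda>x. ?e x * (y x * p' x - z x * p x)"
  have "(?w \<longlongrightarrow> 0) F"
  proof (rule Lim_null_comparison)
    show "\<forall>\<^sub>F x in F. norm (?w x) \<le> norm (?e x * y x) * B + norm (?e x * z x) * B"
      using bd
    proof eventually_elim
      case (elim x)
      have "norm (?w x) \<le> norm (?e x * y x * p' x) + norm (?e x * z x * p x)"
        using norm_triangle_ineq4[of "?e x * y x * p' x" "?e x * z x * p x"] by (simp add: algebra_simps)
      also have "\<dots> \<le> norm (?e x * y x) * B + norm (?e x * z x) * B"
        unfolding norm_mult[of "?e x * y x"] norm_mult[of "?e x * z x"] using elim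
        by (intro add_mono mult_left_mono) auto
      finally show ?case .
    qed
    have "((\<lambda>x. norm (?e x * y x) * B + norm (?e x * z x) * B) \<longlongrightarrow> norm (0::complex) * B + norm (0::complex) * B) F"
      by (intro tendsto_intros lim)
    then show "((\<lambda>x. norm (?e x * y x) * B + norm (?e x * z x) * B) \<longlongrightarrow> 0) F" by simp
  qed
  moreover have "?w = (\<lambda>_. ?w x)" using wronskian_exp[OF sol p] by (intro ext) blast
  ultimately have "((\<lambda>_. ?w x) \<longlongrightarrow> 0) F" by simp
  then have "?w x = 0" using F by (simp add: tendsto_const_iff)
  then show ?thesis by simp
qed

lemma exp_linear_tendsto_0:
  fixes m :: complex
  shows "0 < Re m \<Longrightarrow> ((\<lambda>x. exp (m * of_real x)) \<longlongrightarrow> 0) at_bot"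
    and "Re m < 0 \<Longrightarrow> ((\<lambda>x. exp (m * of_real x)) \<longlongrightarrow> 0) at_top"
proof -
  have *: "((\<lambda>x. exp (m * of_real x)) \<longlongrightarrow> 0) F" if "filterlim (\<lambda>x. Re m * x) at_bot F" for F
  proof (rule tendsto_norm_zero_cancel)
    show "((\<lambda>x. norm (exp (m * complex_of_real x))) \<longlongrightarrow> 0) F"
      using filterlim_compose[OF exp_at_bot that] by (simp add: norm_exp_eq_Re)
  qed
  show "0 < Re m \<Longrightarrow> ((\<lambda>x. exp (m * of_real x)) \<longlongrightarrow> 0) at_bot"
    by (intro * filterlim_tendsto_pos_mult_at_bot[OF tendsto_const _ filterlim_ident])
  show "Re m < 0 \<Longrightarrow> ((\<lambda>x. exp (m * of_real x)) \<longlongrightarrow> 0) at_top"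
    by (intro * filterlim_tendsto_neg_mult_at_bot[OF tendsto_const _ filterlim_ident])
qed

text \<open>Passing from \<open>y\<close> to \<open>exp (m x) y\<close> changes the coefficients by constants. With \<open>m\<close> a characteristic
  exponent at infinity it carries Jost solutions to solutions of the eigenvalue equation.\<close>

lemma lin2_gauge:
  assumes sol: "lin2 b q (\<lambda>_. 0) y z"
  shows "lin2 (b - 2 * m) (\<lambda>x. q x + m\<^sup>2 - b * m) (\<lambda>_. 0)
     (\<lambda>x. exp (m * of_real x) * y x) (\<lambda>x. exp (m * of_real x) * (m * y x + z x))"
  unfolding lin2_def
proof (intro allI conjI)
  fix x
  let ?e = "\<lambda>x. exp (m * complex_of_real x)"
  have "((\<lambda>x. ?e x * y x) has_vector_derivative ?e x * z x + m * ?e x * y x) (at x)"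
    by (intro has_vector_derivative_mult has_vector_derivative_exp_linear lin2D(1)[OF sol])
  then show "((\<lambda>x. ?e x * y x) has_vector_derivative ?e x * (m * y x + z x)) (at x)"
    by (simp add: algebra_simps)
  have "((\<lambda>x. ?e x * (m * y x + z x)) has_vector_derivative
     ?e x * (m * z x + (0 - b * z x - q x * y x)) + m * ?e x * (m * y x + z x)) (at x)"
    by (intro has_vector_derivative_mult has_vector_derivative_exp_linear has_vector_derivative_add
        has_vector_derivative_mult_right lin2D[OF sol])
  then show "((\<lambda>x. ?e x * (m * y x + z x)) has_vector_derivative
      0 - (b - 2 * m) * (?e x * (m * y x + z x)) - (q x + m\<^sup>2 - b * m) * (?e x * y x)) (at x)"
    by (rule has_vector_derivative_eq_rhs) (simp add: algebra_simps power2_eq_square)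
qed

lemma lin2_reflect:
  assumes sol: "lin2 b q (\<lambda>_. 0) y z"
  shows "lin2 (- b) (\<lambda>x. q (- x)) (\<lambda>_. 0) (\<lambda>x. y (- x)) (\<lambda>x. - z (- x))"
proof -
  have refl: "((\<lambda>x. f (- x)) has_vector_derivative - d) (at x)"
    if "(f has_vector_derivative d) (at (- x))" for f :: "real \<Rightarrow> complex" and d x
  proof -
    have "((\<lambda>x::real. - x) has_vector_derivative - 1) (at x)"
      by (auto intro!: derivative_eq_intros simp: has_real_derivative_iff_has_vector_derivative[symmetric])
    from vector_diff_chain_at[OF this that] show ?thesis by (simp add: o_def)
  qed
  show ?thesis
    unfolding lin2_def
  proof (intro allI conjI)
    fix x
    show "((\<lambda>x. y (- x)) has_vector_derivative - z (- x)) (at x)" by (rule refl[OF lin2D(1)[OF sol]])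
    have "((\<lambda>x. - z (- x)) has_vector_derivative - (- (0 - b * z (- x) - q (- x) * y (- x)))) (at x)"
      by (rule has_vector_derivative_minus, rule refl[OF lin2D(2)[OF sol]])
    then show "((\<lambda>x. - z (- x)) has_vector_derivative 0 - - b * - z (- x) - q (- x) * y (- x)) (at x)"
      by (rule has_vector_derivative_eq_rhs) simp
  qed
qed

text \<open>A vanishing Wronskian makes the initial values at one point proportional, and uniqueness does the
  rest.\<close>

lemma lin2_proportional:
  assumes s: "lin2 b q (\<lambda>_. 0) y z" and s': "lin2 b q (\<lambda>_. 0) y' z'"
    and Q: "\<And>x. norm (q x) \<le> Q"
    and wr: "y x0 * z' x0 - z x0 * y' x0 = 0" and nz: "y x0 \<noteq> 0 \<or> z x0 \<noteq> 0"
  obtains k where "\<And>x. y' x = k * y x" "\<And>x. z' x = k * z x"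
proof -
  define k where "k = (if y x0 \<noteq> 0 then y' x0 / y x0 else z' x0 / z x0)"
  have k: "y' x0 = k * y x0" "z' x0 = k * z x0"
    using wr nz by (auto simp: k_def field_simps)
  have "lin2 b q (\<lambda>_. 0) (\<lambda>x. y' x - k * y x) (\<lambda>x. z' x - k * z x)"
    using lin2_diff[OF s' lin2_scale[OF s, of k]] by simp
  from lin2_unique[OF this Q, of x0] k show ?thesis by (intro that[of k]) auto
qed

section \<open>Decaying solutions and the Evans function\<close>

text \<open>The eigenvalue equation \<open>y'' + c y' + (d + g x - lam) y = 0\<close>, where \<open>d\<close> is the common limit of
  \<open>f' (U x)\<close> at both ends and \<open>g\<close> the decaying remainder. Assumption \<open>hyp\<close> says that the roots of
  \<open>\<mu>\<^sup>2 + c \<mu> = lam - d\<close> have real parts of opposite strict sign: their difference is the square root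
  and their sum is \<open>-c\<close>.\<close>

locale pulse_operator =
  fixes c d a C Lg :: real and g :: "real \<Rightarrow> complex" and Omega :: "complex set"
  assumes a: "a > 0" and C: "C \<ge> 0" and g_decay: "\<And>t. norm (g t) \<le> C * exp (- a * \<bar>t\<bar>)"
    and g_lip: "\<And>s t. norm (g s - g t) \<le> Lg * \<bar>s - t\<bar>"
    and Omega_open: "open Omega"
    and hyp: "\<And>lam. lam \<in> Omega \<Longrightarrow> \<bar>c\<bar> < Re (csqrt (of_real (c\<^sup>2) + 4 * (lam - of_real d)))"
begin

text \<open>\<open>mup\<close> and \<open>mum\<close> are the characteristic exponents with positive and with negative real part, and
  \<open>nu\<close> is their difference.\<close>

definition nu :: "complex \<Rightarrow> complex" where "nu lam = csqrt (of_real (c\<^sup>2) + 4 * (lam - of_real d))"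
definition mup :: "complex \<Rightarrow> complex" where "mup lam = (nu lam - of_real c) / 2"
definition mum :: "complex \<Rightarrow> complex" where "mum lam = (- nu lam - of_real c) / 2"

abbreviation gr :: "real \<Rightarrow> complex" where "gr \<equiv> \<lambda>x. g (- x)"
abbreviation W :: "real \<Rightarrow> real" where "W \<equiv> \<lambda>t. 2 * C / a * arctan (exp (a * t))"
abbreviation w :: "real \<Rightarrow> real" where "w \<equiv> \<lambda>t. 2 * C * exp (a * t) / (1 + (exp (a * t))\<^sup>2)"
abbreviation Wt :: real where "Wt \<equiv> C * pi / a"

lemma g_continuous: "continuous_on UNIV g"
proof -
  have "Lg-lipschitz_on UNIV g"
  proof (rule lipschitz_onI)
    show "Lg \<ge> 0" using order_trans[OF norm_ge_zero g_lip[of 1 0]] by simp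
  qed (use g_lip in \<open>simp add: dist_norm\<close>)
  then show ?thesis by (rule lipschitz_on_continuous_on)
qed

lemma g_bounded: "norm (g t) \<le> C"
proof -
  have "C * exp (- a * \<bar>t\<bar>) \<le> C * 1" using a C by (intro mult_left_mono) auto
  with g_decay[of t] show ?thesis by linarith
qed

sublocale left: integrable_potential g W w Wt
  by (rule exponential_decay_potential[OF a C g_continuous g_decay])

sublocale right: integrable_potential gr W w Wt
proof (rule exponential_decay_potential[OF a C])
  show "continuous_on UNIV gr"
    by (rule continuous_on_compose2[OF g_continuous]) (auto intro: continuous_intros)
  show "norm (gr t) \<le> C * exp (- a * \<bar>t\<bar>)" for t using g_decay[of "- t"] by simp
qed

lemma nu_sq: "(nu lam)\<^sup>2 = of_real (c\<^sup>2) + 4 * (lam - of_real d)"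
  by (simp add: nu_def)

lemma mu_sum: "mup lam + mum lam = - of_real c" and mu_diff: "mup lam - mum lam = nu lam"
  by (simp_all add: mup_def mum_def field_simps)

lemma mu_prod: "mup lam * mum lam = of_real d - lam"
proof -
  have "4 * (mup lam * mum lam) = of_real (c\<^sup>2) - (nu lam)\<^sup>2"
    by (simp add: mup_def mum_def field_simps power2_eq_square)
  also have "\<dots> = 4 * (of_real d - lam)" by (simp add: nu_sq)
  finally show ?thesis by (simp only: mult_cancel_left) simp
qed

lemma nu_pos: "lam \<in> Omega \<Longrightarrow> \<bar>c\<bar> < Re (nu lam)" "lam \<in> Omega \<Longrightarrow> 0 < Re (nu lam)"
  unfolding nu_def using hyp le_less_trans[OF abs_ge_zero hyp] by blast+

lemma nu_nz: "lam \<in> Omega \<Longrightarrow> nu lam \<noteq> 0"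
  using nu_pos(2)[of lam] by auto

lemma mu_signs: "lam \<in> Omega \<Longrightarrow> 0 < Re (mup lam)" "lam \<in> Omega \<Longrightarrow> Re (mum lam) < 0"
  using nu_pos(1)[of lam] by (auto simp: mup_def mum_def)

lemma nu_holomorphic: "nu holomorphic_on Omega"
  unfolding nu_def
proof (intro holomorphic_intros)
  fix z assume z: "z \<in> Omega"
  show "of_real (c\<^sup>2) + 4 * (z - of_real d) \<notin> \<real>\<^sub>\<le>\<^sub>0"
  proof
    assume n: "of_real (c\<^sup>2) + 4 * (z - of_real d) \<in> \<real>\<^sub>\<le>\<^sub>0"
    then obtain r where r: "of_real (c\<^sup>2) + 4 * (z - of_real d) = of_real r" "r \<le> 0"
      by (elim nonpos_Reals_cases)
    then have "Re (nu z) = 0" unfolding nu_def by simp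
    with nu_pos(2)[OF z] show False by simp
  qed
qed

lemma mup_holomorphic: "mup holomorphic_on Omega" and mum_holomorphic: "mum holomorphic_on Omega"
  unfolding mup_def[abs_def] mum_def[abs_def] by (intro holomorphic_intros nu_holomorphic; simp)+

definition q :: "complex \<Rightarrow> real \<Rightarrow> complex" where "q lam x = of_real d + g x - lam"

text \<open>\<open>ym\<close> solves the eigenvalue equation and decays at \<open>-\<infinity>\<close>; \<open>yp\<close> is built from the reflected potential
  and decays at \<open>+\<infinity>\<close>. The primed versions are the derivatives in \<open>x\<close>.\<close>

definition ym :: "complex \<Rightarrow> real \<Rightarrow> complex" where
  "ym lam x = exp (mup lam * of_real x) * jost g (nu lam) x"
definition ym' :: "complex \<Rightarrow> real \<Rightarrow> complex" where
  "ym' lam x = exp (mup lam * of_real x) * (mup lam * jost g (nu lam) x + jost' g (nu lam) x)"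
definition yp :: "complex \<Rightarrow> real \<Rightarrow> complex" where
  "yp lam x = exp (mum lam * of_real x) * jost gr (nu lam) (- x)"
definition yp' :: "complex \<Rightarrow> real \<Rightarrow> complex" where
  "yp' lam x = exp (mum lam * of_real x) * (mum lam * jost gr (nu lam) (- x) - jost' gr (nu lam) (- x))"

text \<open>An Evans function: up to the factor \<open>-nu\<close> it is the weighted Wronskian of \<open>ym\<close> and \<open>yp\<close>
  (\<open>wronskian_evans\<close>), so it vanishes where these two are proportional.\<close>

definition evans :: "complex \<Rightarrow> complex" where "evans lam = transmission g (nu lam)"

lemma jost_lin2: "lam \<in> Omega \<Longrightarrow> lin2 (nu lam) g (\<lambda>_. 0) (jost g (nu lam)) (jost' g (nu lam))"
  using left.jost_has_derivative nu_pos(2) by (simp add: lin2_def)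

lemma q_bounded: "norm (q lam x) \<le> \<bar>d\<bar> + C + norm lam"
proof -
  have "norm (q lam x) \<le> norm (of_real d + g x) + norm lam" unfolding q_def by (rule norm_triangle_ineq4)
  also have "norm (of_real d + g x) \<le> \<bar>d\<bar> + C"
    using norm_triangle_le[of "of_real d" "g x" "\<bar>d\<bar> + C"] g_bounded[of x] by simp
  finally show ?thesis by simp
qed

text \<open>The gauge \<open>m = mup lam\<close> turns \<open>nu\<close> into \<open>nu - 2 mup = c\<close>, and the constant added to the potential is
  \<open>mup\<^sup>2 - nu mup = mup mum = d - lam\<close>.\<close>

lemma ym_lin2:
  assumes lam: "lam \<in> Omega"
  shows "lin2 (of_real c) (q lam) (\<lambda>_. 0) (ym lam) (ym' lam)"
proof -
  have 1: "nu lam - 2 * mup lam = of_real c" by (simp add: mup_def diff_divide_distrib)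
  have 2: "g x + (mup lam)\<^sup>2 - nu lam * mup lam = q lam x" for x
  proof -
    have "(mup lam)\<^sup>2 - nu lam * mup lam = mup lam * (mup lam - nu lam)" by (simp add: power2_eq_square algebra_simps)
    also have "mup lam - nu lam = mum lam" using mu_diff[of lam] by (simp add: algebra_simps)
    finally have "(mup lam)\<^sup>2 - nu lam * mup lam = of_real d - lam" by (simp add: mu_prod)
    moreover have "g x + (mup lam)\<^sup>2 - nu lam * mup lam = g x + ((mup lam)\<^sup>2 - nu lam * mup lam)" by simp
    ultimately show ?thesis by (simp add: q_def)
  qed
  show ?thesis
    using lin2_gauge[OF jost_lin2[OF lam], of "mup lam"] unfolding 1 2
    by (simp add: ym_def[abs_def] ym'_def[abs_def])
qed

lemma yp_lin2:
  assumes lam: "lam \<in> Omega"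
  shows "lin2 (of_real c) (q lam) (\<lambda>_. 0) (yp lam) (yp' lam)"
proof -
  have "lin2 (nu lam) gr (\<lambda>_. 0) (jost gr (nu lam)) (jost' gr (nu lam))"
    using right.jost_has_derivative nu_pos(2) lam by (simp add: lin2_def)
  from lin2_reflect[OF this]
  have s: "lin2 (- nu lam) g (\<lambda>_. 0) (\<lambda>x. jost gr (nu lam) (- x)) (\<lambda>x. - jost' gr (nu lam) (- x))" by simp
  have 1: "- nu lam - 2 * mum lam = of_real c" by (simp add: mum_def diff_divide_distrib)
  have 2: "g x + (mum lam)\<^sup>2 - - nu lam * mum lam = q lam x" for x
  proof -
    have "(mum lam)\<^sup>2 - - nu lam * mum lam = mum lam * (mum lam + nu lam)" by (simp add: power2_eq_square algebra_simps)
    also have "mum lam + nu lam = mup lam" using mu_diff[of lam] by (simp add: algebra_simps)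
    also have "mum lam * mup lam = of_real d - lam" using mu_prod[of lam] by (simp only: mult.commute)
    finally have "(mum lam)\<^sup>2 - - nu lam * mum lam = of_real d - lam" .
    moreover have "g x + (mum lam)\<^sup>2 - - nu lam * mum lam = g x + ((mum lam)\<^sup>2 - - nu lam * mum lam)" by simp
    ultimately show ?thesis by (simp add: q_def)
  qed
  show ?thesis
    using lin2_gauge[OF s, of "mum lam"] unfolding 1 2
    by (simp add: yp_def[abs_def] yp'_def[abs_def])
qed

lemma jost_hol:
  "(\<lambda>lam. jost g (nu lam) x) holomorphic_on Omega" "(\<lambda>lam. jost' g (nu lam) x) holomorphic_on Omega"
  "(\<lambda>lam. jost gr (nu lam) x) holomorphic_on Omega" "(\<lambda>lam. jost' gr (nu lam) x) holomorphic_on Omega"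
  using holomorphic_on_compose_gen[OF nu_holomorphic left.jost_holomorphic]
    holomorphic_on_compose_gen[OF nu_holomorphic left.jost'_holomorphic]
    holomorphic_on_compose_gen[OF nu_holomorphic right.jost_holomorphic]
    holomorphic_on_compose_gen[OF nu_holomorphic right.jost'_holomorphic] nu_pos(2)
  by (auto simp: o_def image_subset_iff)

lemma ym_holomorphic: "(\<lambda>lam. ym lam x) holomorphic_on Omega" "(\<lambda>lam. ym' lam x) holomorphic_on Omega"
  and yp_holomorphic: "(\<lambda>lam. yp lam x) holomorphic_on Omega" "(\<lambda>lam. yp' lam x) holomorphic_on Omega"
  unfolding ym_def ym'_def yp_def yp'_def
  by (intro holomorphic_intros jost_hol mup_holomorphic mum_holomorphic)+

lemma jost_at_top:
  assumes lam: "lam \<in> Omega"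
  shows "(jost g (nu lam) \<longlongrightarrow> evans lam) at_top" "(jost' g (nu lam) \<longlongrightarrow> 0) at_top"
  unfolding evans_def
  using tendsto_uniform_limitI[OF left.jost_uniform_at_top[OF nu_pos(2)[OF lam]], of "nu lam"]
    tendsto_uniform_limitI[OF left.jost'_uniform_at_top[OF nu_pos(2)[OF lam]], of "nu lam"]
  by auto

lemma reflected_jost_at_top:
  assumes "lam \<in> Omega"
  shows "((\<lambda>x. jost gr (nu lam) (- x)) \<longlongrightarrow> 1) at_top" "((\<lambda>x. jost' gr (nu lam) (- x)) \<longlongrightarrow> 0) at_top"
  by (rule filterlim_compose[OF right.jost_at_bot(1)[OF nu_pos(2)[OF assms]] filterlim_uminus_at_bot_at_top]
        filterlim_compose[OF right.jost_at_bot(2)[OF nu_pos(2)[OF assms]] filterlim_uminus_at_bot_at_top])+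

text \<open>By Abel's identity the left side is the same for all \<open>x\<close>. The three exponentials cancel because
  \<open>c + mup + mum = 0\<close>, and the limit of what remains at \<open>+\<infinity>\<close> is \<open>evans lam * (mum lam - mup lam)\<close>.\<close>

lemma wronskian_evans:
  assumes lam: "lam \<in> Omega"
  shows "exp (of_real c * of_real x) * (ym lam x * yp' lam x - ym' lam x * yp lam x) = - nu lam * evans lam"
proof -
  define E where "E = (\<lambda>x. exp (of_real c * complex_of_real x) * (ym lam x * yp' lam x - ym' lam x * yp lam x))"
  have const: "E x = E 0" for x
    unfolding E_def by (rule wronskian_exp[OF ym_lin2[OF lam] yp_lin2[OF lam]])
  let ?u = "jost g (nu lam)" and ?v = "jost' g (nu lam)"
  let ?ur = "\<lambda>x. jost gr (nu lam) (- x)" and ?vr = "\<lambda>x. jost' gr (nu lam) (- x)"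
  have E_eq: "E x = ?u x * (mum lam * ?ur x - ?vr x) - (mup lam * ?u x + ?v x) * ?ur x" for x
  proof -
    have "exp (of_real c * complex_of_real x) * (exp (mup lam * of_real x) * exp (mum lam * of_real x)) =
        exp ((of_real c + (mup lam + mum lam)) * of_real x)"
      by (simp add: mult_exp_exp algebra_simps)
    also have "\<dots> = 1" by (simp add: mu_sum)
    finally have 1: "exp (of_real c * complex_of_real x) * (exp (mup lam * of_real x) * exp (mum lam * of_real x)) = 1" .
    have "E x = (exp (of_real c * complex_of_real x) * (exp (mup lam * of_real x) * exp (mum lam * of_real x))) *
       (?u x * (mum lam * ?ur x - ?vr x) - (mup lam * ?u x + ?v x) * ?ur x)"
      unfolding E_def ym_def ym'_def yp_def yp'_def by (simp add: algebra_simps)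
    then show ?thesis unfolding 1 by simp
  qed
  have "(E \<longlongrightarrow> evans lam * (mum lam * 1 - 0) - (mup lam * evans lam + 0) * 1) at_top"
    unfolding E_eq[abs_def] by (intro tendsto_intros reflected_jost_at_top jost_at_top lam)
  moreover have "evans lam * (mum lam * 1 - 0) - (mup lam * evans lam + 0) * 1 = - nu lam * evans lam"
    unfolding mu_diff[symmetric] by (simp add: algebra_simps)
  ultimately have lim: "(E \<longlongrightarrow> - nu lam * evans lam) at_top" by simp
  have "E 0 = - nu lam * evans lam"
    by (rule tendsto_unique[OF _ tendsto_eventually lim]) (auto intro!: always_eventually const)
  with const show ?thesis unfolding E_def by metis
qed

lemma evans_holomorphic: "evans holomorphic_on Omega"
proof -
  have "(\<lambda>lam. - (exp (of_real c * of_real 0) * (ym lam 0 * yp' lam 0 - ym' lam 0 * yp lam 0)) / nu lam) holomorphic_on Omega"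
    using nu_nz by (intro holomorphic_intros ym_holomorphic yp_holomorphic nu_holomorphic) auto
  then show ?thesis
    by (rule holomorphic_transform) (use wronskian_evans[of _ 0] nu_nz in auto)
qed

lemma ym_nonzero:
  assumes "lam \<in> Omega"
  obtains x where "ym lam x \<noteq> 0"
proof -
  have "\<forall>\<^sub>F x in at_bot. jost g (nu lam) x \<noteq> 0"
    by (rule tendsto_imp_eventually_ne[OF left.jost_at_bot(1)[OF nu_pos(2)[OF assms]]]) simp
  then obtain x where "jost g (nu lam) x \<noteq> 0" by (meson eventually_happens trivial_limit_at_bot_linorder)
  then show ?thesis by (intro that[of x]) (simp add: ym_def)
qed

lemma yp_nonzero:
  assumes "lam \<in> Omega"
  obtains x where "yp lam x \<noteq> 0"
proof -
  have "\<forall>\<^sub>F x in at_bot. jost gr (nu lam) x \<noteq> 0"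
    by (rule tendsto_imp_eventually_ne[OF right.jost_at_bot(1)[OF nu_pos(2)[OF assms]]]) simp
  then obtain x where "jost gr (nu lam) x \<noteq> 0" by (meson eventually_happens trivial_limit_at_bot_linorder)
  then show ?thesis by (intro that[of "- x"]) (simp add: yp_def)
qed

text \<open>Estimates that hold uniformly for spectral parameters near \<open>lam0\<close>. Through Cauchy's inequality
  they pass to the Taylor coefficients in the spectral parameter.\<close>

lemma local_bounds:
  assumes lam0: "lam0 \<in> Omega"
  obtains r M \<delta> R where "r > 0" "cball lam0 r \<subseteq> Omega" "\<delta> > 0" "M > 0"
    "\<And>lam x. lam \<in> cball lam0 r \<Longrightarrow> x \<le> 0 \<Longrightarrow> norm (ym lam x) \<le> M * exp (\<delta> * x) \<and> norm (ym' lam x) \<le> M * exp (\<delta> * x)"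
    "\<And>lam x. lam \<in> cball lam0 r \<Longrightarrow> x \<ge> 0 \<Longrightarrow> norm (yp lam x) \<le> M * exp (- \<delta> * x) \<and> norm (yp' lam x) \<le> M * exp (- \<delta> * x)"
    "\<And>lam x. lam \<in> cball lam0 r \<Longrightarrow> norm (ym lam x) \<le> M * exp (R * \<bar>x\<bar>) \<and> norm (ym' lam x) \<le> M * exp (R * \<bar>x\<bar>)
        \<and> norm (yp lam x) \<le> M * exp (R * \<bar>x\<bar>) \<and> norm (yp' lam x) \<le> M * exp (R * \<bar>x\<bar>)"
proof -
  \<comment> \<open>Any number strictly between \<open>\<bar>c\<bar>\<close> and \<open>Re (nu lam0)\<close> would do.\<close>
  define \<rho> where "\<rho> = (Re (nu lam0) + \<bar>c\<bar>) / 2"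
  have \<rho>: "\<bar>c\<bar> < \<rho>" "\<rho> < Re (nu lam0)" "\<rho> > 0" using nu_pos(1)[OF lam0] by (auto simp: \<rho>_def)
  have cont: "continuous_on Omega nu" by (rule holomorphic_on_imp_continuous_on[OF nu_holomorphic])
  have "\<forall>\<^sub>F lam in nhds lam0. lam \<in> Omega \<and> \<rho> < Re (nu lam)"
  proof (intro eventually_conj)
    show "\<forall>\<^sub>F lam in nhds lam0. lam \<in> Omega" by (rule eventually_nhds_in_open[OF Omega_open lam0])
    have "isCont nu lam0" using cont Omega_open lam0 continuous_on_eq_continuous_at by blast
    then have "((\<lambda>lam. Re (nu lam)) \<longlongrightarrow> Re (nu lam0)) (nhds lam0)"
      by (intro tendsto_Re) (simp add: continuous_at tendsto_at_iff_tendsto_nhds)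
    then show "\<forall>\<^sub>F lam in nhds lam0. \<rho> < Re (nu lam)" using \<rho>(2) by (rule order_tendstoD)
  qed
  then obtain r0 where r0: "r0 > 0" "\<And>lam. dist lam lam0 < r0 \<Longrightarrow> lam \<in> Omega \<and> \<rho> < Re (nu lam)"
    unfolding eventually_nhds_metric by blast
  define r where "r = r0 / 2"
  have r: "r > 0" "\<And>lam. lam \<in> cball lam0 r \<Longrightarrow> lam \<in> Omega \<and> \<rho> < Re (nu lam)"
    using r0 by (auto simp: r_def dist_commute)
  then have sub: "cball lam0 r \<subseteq> Omega" by blast
  have "compact ((\<lambda>lam. norm (nu lam)) ` cball lam0 r)"
    by (intro compact_continuous_image continuous_on_norm continuous_on_subset[OF cont sub]) simp
  then have "bounded ((\<lambda>lam. norm (nu lam)) ` cball lam0 r)" by (rule compact_imp_bounded)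
  then obtain N where "\<forall>y\<in>(\<lambda>lam. norm (nu lam)) ` cball lam0 r. norm y \<le> N"
    unfolding bounded_iff by blast
  then have N: "norm (nu lam) \<le> N" if "lam \<in> cball lam0 r" for lam using that by simp
  define R where "R = N + \<bar>c\<bar>"
  have mu_le: "norm (mup lam) \<le> R" "norm (mum lam) \<le> R" if "lam \<in> cball lam0 r" for lam
    using N[OF that] norm_triangle_ineq4[of "nu lam" "of_real c"] norm_triangle_ineq4[of "- nu lam" "of_real c"] norm_ge_zero[of "nu lam"]
    unfolding R_def mup_def mum_def norm_divide by (auto simp: norm_minus_commute) (smt (verit) norm_ge_zero abs_ge_zero)+
  define M0 where "M0 = exp (2 * (2 / \<rho>) * Wt)"
  have Wt0: "Wt \<ge> 0" using C a by simp
  define M where "M = (R + Wt + 1) * M0"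
  have M0: "M0 > 0" by (simp add: M0_def)
  have R0: "R \<ge> 0" using order_trans[OF norm_ge_zero mu_le(1)[of lam0]] r(1) by simp
  have M: "M > 0" unfolding M_def using M0 R0 Wt0 by (intro mult_pos_pos) auto
  define \<delta> where "\<delta> = (\<rho> - \<bar>c\<bar>) / 2"
  have \<delta>: "\<delta> > 0" using \<rho> by (simp add: \<delta>_def)
  have B: "Re (nu lam) > 0" "2 / norm (nu lam) \<le> 2 / \<rho>" if "lam \<in> cball lam0 r" for lam
  proof -
    have "\<rho> < Re (nu lam)" using r(2)[OF that] by blast
    then show "Re (nu lam) > 0" using \<rho> by linarith
    show "2 / norm (nu lam) \<le> 2 / \<rho>"
      using \<open>\<rho> < Re (nu lam)\<close> complex_Re_le_cmod[of "nu lam"] \<rho>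
      by (intro divide_left_mono mult_pos_pos) linarith+
  qed
  have fac: "norm (jost g (nu lam) x) \<le> M" "norm (m * jost g (nu lam) x + jost' g (nu lam) x) \<le> M"
     "norm (jost gr (nu lam) x) \<le> M" "norm (m * jost gr (nu lam) x - jost' gr (nu lam) x) \<le> M"
    if lam: "lam \<in> cball lam0 r" and m: "norm m \<le> R" for lam x m
  proof -
    have "M0 * 1 \<le> M0 * (R + Wt + 1)" using M0 R0 Wt0 by (intro mult_left_mono) auto
    then have M0M: "M0 \<le> M" by (simp add: M_def mult.commute)
    have 1: "norm (jost g (nu lam) x) \<le> M0" "norm (jost gr (nu lam) x) \<le> M0"
      unfolding M0_def using left.jost_le[OF B[OF lam]] right.jost_le[OF B[OF lam]] by auto
    have 2: "norm (jost' g (nu lam) x) \<le> M0 * Wt" "norm (jost' gr (nu lam) x) \<le> M0 * Wt"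
      unfolding M0_def using left.jost'_le[OF B[OF lam]] right.jost'_le[OF B[OF lam]] by auto
    show "norm (jost g (nu lam) x) \<le> M" "norm (jost gr (nu lam) x) \<le> M" using 1 M0M by auto
    have 3: "norm (m * jost g (nu lam) x) \<le> R * M0" "norm (m * jost gr (nu lam) x) \<le> R * M0"
      unfolding norm_mult using m 1 R0 by (auto intro!: mult_mono)
    have 4: "R * M0 + M0 * Wt \<le> M" using M0 by (simp add: M_def algebra_simps)
    show "norm (m * jost g (nu lam) x + jost' g (nu lam) x) \<le> M"
      using norm_triangle_ineq[of "m * jost g (nu lam) x" "jost' g (nu lam) x"] 2(1) 3(1) 4 by linarith
    show "norm (m * jost gr (nu lam) x - jost' gr (nu lam) x) \<le> M"
      using norm_triangle_ineq4[of "m * jost gr (nu lam) x" "jost' gr (nu lam) x"] 2(2) 3(2) 4 by linarith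
  qed
  have prod: "norm (exp z * k) \<le> M * exp s" if "Re z \<le> s" "norm k \<le> M" for z k s
    using mult_mono[of "exp (Re z)" "exp s" "norm k" M] that by (simp add: norm_mult mult.commute)
  have Re_le: "Re (m * complex_of_real x) \<le> R * \<bar>x\<bar>" if "norm m \<le> R" for m x
  proof -
    have "Re (m * complex_of_real x) \<le> norm m * \<bar>x\<bar>"
      using complex_Re_le_cmod[of "m * complex_of_real x"] by (simp add: norm_mult)
    also have "\<dots> \<le> R * \<bar>x\<bar>" using that by (rule mult_right_mono) simp
    finally show ?thesis .
  qed
  show ?thesis
  proof (rule that[OF r(1) sub \<delta> M])
    fix lam x assume lam: "lam \<in> cball lam0 r"
    have mp: "\<delta> \<le> Re (mup lam)" and mm: "Re (mum lam) \<le> - \<delta>"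
    proof -
      have "Re (mup lam) = (Re (nu lam) - c) / 2" "Re (mum lam) = (- Re (nu lam) - c) / 2"
        by (simp_all add: mup_def mum_def)
      moreover have "\<rho> < Re (nu lam)" using r(2)[OF lam] by blast
      moreover have "\<delta> = \<rho> / 2 - \<bar>c\<bar> / 2" by (simp add: \<delta>_def diff_divide_distrib)
      ultimately show "\<delta> \<le> Re (mup lam)" "Re (mum lam) \<le> - \<delta>"
        using abs_ge_self[of c] abs_ge_minus_self[of c] by (simp_all add: field_simps)
    qed
    show "norm (ym lam x) \<le> M * exp (\<delta> * x) \<and> norm (ym' lam x) \<le> M * exp (\<delta> * x)" if "x \<le> 0"
    proof -
      have "Re (mup lam * of_real x) \<le> \<delta> * x" using mp that by (simp add: mult_right_mono_neg)
      then show ?thesis unfolding ym_def ym'_def using fac[OF lam mu_le(1)[OF lam]] by (blast intro: prod)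
    qed
    show "norm (yp lam x) \<le> M * exp (- \<delta> * x) \<and> norm (yp' lam x) \<le> M * exp (- \<delta> * x)" if "x \<ge> 0"
    proof -
      have "Re (mum lam * of_real x) \<le> - \<delta> * x" using mult_right_mono[OF mm that] by simp
      then show ?thesis unfolding yp_def yp'_def using fac[OF lam mu_le(2)[OF lam]] by (blast intro: prod)
    qed
    show "norm (ym lam x) \<le> M * exp (R * \<bar>x\<bar>) \<and> norm (ym' lam x) \<le> M * exp (R * \<bar>x\<bar>)
        \<and> norm (yp lam x) \<le> M * exp (R * \<bar>x\<bar>) \<and> norm (yp' lam x) \<le> M * exp (R * \<bar>x\<bar>)"
      unfolding ym_def ym'_def yp_def yp'_def
      using fac[OF lam mu_le(1)[OF lam]] fac[OF lam mu_le(2)[OF lam]] Re_le mu_le[OF lam]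
      by (blast intro: prod)
  qed
qed

lemma exp_mult_cancel:
  assumes "m + m' = - of_real c"
  shows "exp (of_real c * complex_of_real x) * (exp (m * of_real x) * k) = exp (- m' * of_real x) * k"
proof -
  have cm: "of_real c + m = - m'" using assms by algebra
  have e: "exp (of_real c * complex_of_real x) * exp (m * of_real x) = exp ((of_real c + m) * of_real x)"
    by (simp add: mult_exp_exp distrib_right)
  show ?thesis unfolding mult.assoc[symmetric] e cm ..
qed

text \<open>\<open>exp (c x) * ym lam x\<close> behaves like \<open>exp (-mum lam x)\<close> at \<open>-\<infinity>\<close> and tends to 0 there, so the
  Wronskian with a bounded solution vanishes: only multiples of \<open>ym\<close> are bounded on the left.\<close>

lemma bounded_left_multiple:
  assumes lam: "lam \<in> Omega" and p: "lin2 (of_real c) (q lam) (\<lambda>_. 0) p p'"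
    and bd: "\<And>x. x \<le> 0 \<Longrightarrow> norm (p x) \<le> B \<and> norm (p' x) \<le> B"
  obtains k where "\<And>x. p x = k * ym lam x" "\<And>x. p' x = k * ym' lam x"
proof -
  note J = left.jost_at_bot[OF nu_pos(2)[OF lam]]
  have e: "((\<lambda>x. exp (- mum lam * complex_of_real x)) \<longlongrightarrow> 0) at_bot"
    using mu_signs(2)[OF lam] by (intro exp_linear_tendsto_0) simp
  have l: "((\<lambda>x. exp (of_real c * of_real x) * ym lam x) \<longlongrightarrow> 0 * 1) at_bot"
    "((\<lambda>x. exp (of_real c * of_real x) * ym' lam x) \<longlongrightarrow> 0 * (mup lam * 1 + 0)) at_bot"
    unfolding ym_def ym'_def exp_mult_cancel[OF mu_sum] by (intro tendsto_intros e J)+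
  have "ym lam x * p' x - ym' lam x * p x = 0" for x
    by (rule wronskian_vanishes[OF ym_lin2[OF lam] p, of at_bot B])
       (use l eventually_mono[OF eventually_le_at_bot[of "0::real"] bd] in auto)
  moreover obtain x0 where "ym lam x0 \<noteq> 0" using ym_nonzero[OF lam] .
  ultimately show ?thesis using lin2_proportional[OF ym_lin2[OF lam] p q_bounded] that by metis
qed

text \<open>The mirror image at \<open>+\<infinity>\<close>; the conclusion is kept in the form of a Wronskian because it is used to
  refute boundedness.\<close>

lemma bounded_right_wronskian:
  assumes lam: "lam \<in> Omega" and p: "lin2 (of_real c) (q lam) (\<lambda>_. 0) p p'"
    and bd: "\<And>x. x \<ge> 0 \<Longrightarrow> norm (p x) \<le> B \<and> norm (p' x) \<le> B"
  shows "yp lam x * p' x - yp' lam x * p x = 0"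
proof -
  note J = reflected_jost_at_top[OF lam]
  have e: "((\<lambda>x. exp (- mup lam * complex_of_real x)) \<longlongrightarrow> 0) at_top"
    using mu_signs(1)[OF lam] by (intro exp_linear_tendsto_0) simp
  have sum: "mum lam + mup lam = - of_real c" using mu_sum[of lam] by (simp add: add.commute)
  have l: "((\<lambda>x. exp (of_real c * of_real x) * yp lam x) \<longlongrightarrow> 0 * 1) at_top"
    "((\<lambda>x. exp (of_real c * of_real x) * yp' lam x) \<longlongrightarrow> 0 * (mum lam * 1 - 0)) at_top"
    unfolding yp_def yp'_def exp_mult_cancel[OF sum] by (intro tendsto_intros e J)+
  show ?thesis
    by (rule wronskian_vanishes[OF yp_lin2[OF lam] p, of at_top B])
       (use l eventually_mono[OF eventually_ge_at_top[of "0::real"] bd] in auto)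
qed

end

section \<open>Jordan chains from Taylor coefficients\<close>

definition taylor :: "nat \<Rightarrow> (complex \<Rightarrow> complex) \<Rightarrow> complex \<Rightarrow> complex" where
  "taylor k f z = (deriv ^^ k) f z / fact k"

context
  fixes A :: "complex set" and z :: complex
  assumes A: "open A" "z \<in> A"
begin

lemma taylor_diff:
  assumes "f holomorphic_on A" "h holomorphic_on A"
  shows "taylor k (\<lambda>w. f w - h w) z = taylor k f z - taylor k h z"
  using higher_deriv_diff[OF assms A] by (simp add: taylor_def diff_divide_distrib)

lemma taylor_add:
  assumes "f holomorphic_on A" "h holomorphic_on A"
  shows "taylor k (\<lambda>w. f w + h w) z = taylor k f z + taylor k h z"
  using higher_deriv_add[OF assms A] by (simp add: taylor_def add_divide_distrib)

lemma taylor_cmult: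
  assumes "f holomorphic_on A"
  shows "taylor k (\<lambda>w. b * f w) z = b * taylor k f z"
  using higher_deriv_cmult[OF assms A(2,1)] by (simp add: taylor_def)

lemma taylor_mult:
  assumes "f holomorphic_on A" "h holomorphic_on A"
  shows "taylor k (\<lambda>w. f w * h w) z = (\<Sum>i\<le>k. taylor i f z * taylor (k - i) h z)"
proof -
  have "taylor k (\<lambda>w. f w * h w) z =
      (\<Sum>i = 0..k. of_nat (k choose i) * (deriv ^^ i) f z * (deriv ^^ (k - i)) h z / fact k)"
    unfolding taylor_def higher_deriv_mult[OF assms A] by (rule sum_divide_distrib)
  also have "\<dots> = (\<Sum>i = 0..k. taylor i f z * taylor (k - i) h z)"
  proof (rule sum.cong[OF refl])
    fix i assume "i \<in> {0..k}"
    then have "(of_nat (k choose i) :: complex) = fact k / (fact i * fact (k - i))"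
      by (intro binomial_fact) auto
    then show "of_nat (k choose i) * (deriv ^^ i) f z * (deriv ^^ (k - i)) h z / fact k =
        taylor i f z * taylor (k - i) h z"
      by (simp add: taylor_def field_simps)
  qed
  finally show ?thesis by (simp add: atMost_atLeast0)
qed

lemma taylor_shift:
  assumes "f holomorphic_on A"
  shows "taylor k (\<lambda>w. (w - z) * f w) z = (if k = 0 then 0 else taylor (k - 1) f z)"
proof -
  have lin: "taylor i (\<lambda>w. w - z) z = (if i = 1 then 1 else 0)" for i
  proof -
    have "(deriv ^^ i) (\<lambda>w. w - z) z = (if i = 1 then 1 else 0)"
      using higher_deriv_diff[of "\<lambda>w. w" UNIV "\<lambda>_. z" z i] by (simp split: if_splits)
    then show ?thesis by (simp add: taylor_def)
  qed
  have "taylor k (\<lambda>w. (w - z) * f w) z = (\<Sum>i\<le>k. taylor i (\<lambda>w. w - z) z * taylor (k - i) f z)"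
    by (rule taylor_mult) (auto intro!: holomorphic_intros assms)
  also have "\<dots> = (\<Sum>i\<le>k. if i = 1 then taylor (k - 1) f z else 0)"
    unfolding lin by (rule sum.cong) auto
  finally show ?thesis by (simp add: sum.delta)
qed

lemma taylor_cong:
  assumes "f holomorphic_on A" "\<And>w. w \<in> A \<Longrightarrow> f w = h w"
  shows "taylor k f z = taylor k h z"
  unfolding taylor_def
  using higher_deriv_transform_within_open[OF assms(1) _ A assms(2)] holomorphic_transform[OF assms] by simp

lemma taylor_bound:
  assumes f: "f holomorphic_on A" and r: "r > 0" "cball z r \<subseteq> A"
    and bd: "\<And>w. w \<in> cball z r \<Longrightarrow> norm (f w) \<le> B"
  shows "norm (taylor k f z) \<le> B / r ^ k"
proof -
  have "norm ((deriv ^^ k) f z) \<le> fact k * B / r ^ k"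
  proof (rule Cauchy_inequality)
    show "f holomorphic_on ball z r" using f r(2) ball_subset_cball by (blast intro: holomorphic_on_subset)
    show "continuous_on (cball z r) f" using f r(2) holomorphic_on_imp_continuous_on continuous_on_subset by blast
    show "norm (f x) \<le> B" if "norm (z - x) = r" for x using that by (intro bd) (simp add: dist_norm)
  qed (rule r)
  then show ?thesis by (simp add: taylor_def norm_divide field_simps)
qed

text \<open>The Lipschitz bound makes the first-order Taylor remainder in \<open>x\<close> quadratically small, uniformly in
  \<open>w\<close> on the disc. By Cauchy's inequality the same holds for the Taylor coefficients in \<open>w\<close>.\<close>

lemma taylor_has_vector_derivative:
  fixes F F' :: "complex \<Rightarrow> real \<Rightarrow> complex"
  assumes hol: "\<And>x. (\<lambda>w. F w x) holomorphic_on A" "\<And>x. (\<lambda>w. F' w x) holomorphic_on A"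
    and r: "r > 0" "cball z r \<subseteq> A"
    and deriv: "\<And>w x. w \<in> cball z r \<Longrightarrow> (F w has_vector_derivative F' w x) (at x)"
    and lip: "\<And>w t. w \<in> cball z r \<Longrightarrow> \<bar>t - x\<bar> \<le> 1 \<Longrightarrow> norm (F' w t - F' w x) \<le> L * \<bar>t - x\<bar>"
    and L: "L \<ge> 0"
  shows "((\<lambda>x. taylor k (\<lambda>w. F w x) z) has_vector_derivative taylor k (\<lambda>w. F' w x) z) (at x)"
proof -
  let ?T = "\<lambda>x. taylor k (\<lambda>w. F w x) z"
  let ?T' = "taylor k (\<lambda>w. F' w x) z"
  have est: "norm (?T t - ?T x - (t - x) *\<^sub>R ?T') \<le> L * \<bar>t - x\<bar>\<^sup>2 / r ^ k" if t: "\<bar>t - x\<bar> \<le> 1" for t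
  proof -
    have lin: "norm (F w t - F w x - (t - x) *\<^sub>R F' w x) \<le> L * \<bar>t - x\<bar>\<^sup>2" if w: "w \<in> cball z r" for w
    proof -
      have "norm (F w t - F w x - (t - x) *\<^sub>R F' w x) \<le> norm (t - x) * (L * \<bar>t - x\<bar>)"
      proof (rule vector_differentiable_bound_linearization[where S = "closed_segment x t"])
        fix s assume s: "s \<in> closed_segment x t"
        show "(F w has_vector_derivative F' w s) (at s within closed_segment x t)"
          by (rule has_vector_derivative_at_within[OF deriv[OF w]])
        have "\<bar>s - x\<bar> \<le> \<bar>t - x\<bar>" using s by (auto simp: closed_segment_eq_real_ivl split: if_splits)
        then show "norm (F' w s - F' w x) \<le> L * \<bar>t - x\<bar>"
          using t L by (intro order_trans[OF lip[OF w]]) (auto intro!: mult_left_mono)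
      qed auto
      then show ?thesis by (simp add: power2_eq_square mult_ac)
    qed
    have eq: "taylor k (\<lambda>w. F w t - F w x - of_real (t - x) * F' w x) z = ?T t - ?T x - (t - x) *\<^sub>R ?T'"
      unfolding scaleR_conv_of_real
      by (subst taylor_diff taylor_cmult; (intro holomorphic_intros hol)?)+ simp
    have "norm (taylor k (\<lambda>w. F w t - F w x - of_real (t - x) * F' w x) z) \<le> L * \<bar>t - x\<bar>\<^sup>2 / r ^ k"
      using lin by (intro taylor_bound r) (auto intro!: holomorphic_intros hol simp: scaleR_conv_of_real)
    then show ?thesis unfolding eq .
  qed
  show ?thesis
    unfolding has_vector_derivative_def has_derivative_iff_norm
  proof
    show "bounded_linear (\<lambda>h. h *\<^sub>R ?T')" by (rule bounded_linear_scaleR_left)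
    show "((\<lambda>t. norm (?T t - ?T x - (t - x) *\<^sub>R ?T') / norm (t - x)) \<longlongrightarrow> 0) (at x)"
    proof (rule Lim_null_comparison)
      have "\<forall>\<^sub>F t in at x. dist t x < 1" by (rule eventually_at_ball'[THEN eventually_mono, of 1 x UNIV]) (auto simp: dist_commute)
      then show "\<forall>\<^sub>F t in at x. norm (norm (?T t - ?T x - (t - x) *\<^sub>R ?T') / norm (t - x)) \<le> L / r ^ k * \<bar>t - x\<bar>"
      proof eventually_elim
        case (elim t)
        then have "norm (?T t - ?T x - (t - x) *\<^sub>R ?T') \<le> L * \<bar>t - x\<bar>\<^sup>2 / r ^ k"
          by (intro est) (simp add: dist_real_def)
        also have "\<dots> = (L / r ^ k * \<bar>t - x\<bar>) * norm (t - x)" by (simp add: power2_eq_square)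
        finally show ?case
          using r L by (cases "t = x") (auto simp: pos_divide_le_eq)
      qed
      have "((\<lambda>t. L / r ^ k * \<bar>t - x\<bar>) \<longlongrightarrow> L / r ^ k * \<bar>x - x\<bar>) (at x)" by (intro tendsto_intros)
      then show "((\<lambda>t. L / r ^ k * \<bar>t - x\<bar>) \<longlongrightarrow> 0) (at x)" by simp
    qed
  qed
qed

end

text \<open>A sequence of solutions of \<open>(L - \<lambda>) (Y k) = Y (k - 1)\<close>, all bounded on the left, whose first unbounded
  member is \<open>Y m\<close> (a function counts as bounded if its derivative is bounded too). Together with the fact that bounded-on-the-left solutions of the homogeneous
  equation are multiples of \<open>Y 0\<close>, this pins down the generalized eigenspace: a Jordan chain of
  length \<open>m\<close>.\<close>

locale jordan_tower =
  fixes b :: complex and q :: "real \<Rightarrow> complex" and Y Y' :: "nat \<Rightarrow> real \<Rightarrow> complex" and m :: nat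
  assumes Y_lin: "\<And>k. lin2 b q (\<lambda>x. if k = 0 then 0 else Y (k - 1) x) (Y k) (Y' k)"
    and Y_bd: "\<And>k. k < m \<Longrightarrow> \<exists>B. \<forall>x. norm (Y k x) \<le> B \<and> norm (Y' k x) \<le> B"
    and Y_left: "\<And>k. \<exists>B. \<forall>x\<le>0. norm (Y k x) \<le> B \<and> norm (Y' k x) \<le> B"
    and Y_unbd: "\<not> (\<exists>B. \<forall>x\<ge>0. norm (Y m x) \<le> B \<and> norm (Y' m x) \<le> B)"
    and Y_nz: "\<exists>x. Y 0 x \<noteq> 0"
    and Y_prop: "\<And>p p' B. lin2 b q (\<lambda>_. 0) p p' \<Longrightarrow>
        (\<And>x. x \<le> 0 \<Longrightarrow> norm (p x) \<le> B \<and> norm (p' x) \<le> B) \<Longrightarrow>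
        \<exists>k. \<forall>x. p x = k * Y 0 x \<and> p' x = k * Y' 0 x"

context pulse_operator
begin

text \<open>The \<open>k\<close>-th Taylor coefficient in \<open>w\<close> of \<open>(L - lam0) F = (w - lam0) F\<close>. What has to be checked are
  the Lipschitz bounds in \<open>x\<close>, uniform for \<open>w\<close> near \<open>lam0\<close>, that allow to exchange the derivatives.\<close>

lemma taylor_lin2:
  assumes lam0: "lam0 \<in> Omega" and r: "r > 0" "cball lam0 r \<subseteq> Omega"
    and hol: "\<And>x. (\<lambda>w. F w x) holomorphic_on Omega" "\<And>x. (\<lambda>w. F' w x) holomorphic_on Omega"
    and sol: "\<And>w. w \<in> Omega \<Longrightarrow> lin2 (of_real c) (q w) (\<lambda>_. 0) (F w) (F' w)"
    and bd: "\<And>w x. w \<in> cball lam0 r \<Longrightarrow> norm (F w x) \<le> M * exp (R * \<bar>x\<bar>) \<and> norm (F' w x) \<le> M * exp (R * \<bar>x\<bar>)"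
  shows "lin2 (of_real c) (q lam0) (\<lambda>x. if k = 0 then 0 else taylor (k - 1) (\<lambda>w. F w x) lam0)
     (\<lambda>x. taylor k (\<lambda>w. F w x) lam0) (\<lambda>x. taylor k (\<lambda>w. F' w x) lam0)"
  unfolding lin2_def
proof (intro allI conjI)
  fix x
  define F'' where "F'' = (\<lambda>w x. - of_real c * F' w x - q w x * F w x)"
  \<comment> \<open>Bounds on the window \<open>\<bar>t - x\<bar> \<le> 1\<close>: \<open>B\<close> for \<open>F\<close> and \<open>F'\<close>, \<open>Q\<close> for \<open>q\<close>, and below \<open>K\<close> for \<open>F''\<close>
    and \<open>L\<close> for the Lipschitz constant of \<open>F''\<close>.\<close>
  define B where "B = \<bar>M\<bar> * exp (\<bar>R\<bar> * (\<bar>x\<bar> + 1))"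
  define Q where "Q = \<bar>d\<bar> + C + (norm lam0 + r)"
  have B0: "B \<ge> 0" by (simp add: B_def)
  have Q0: "Q \<ge> 0" using C r by (simp add: Q_def)
  have Lg0: "Lg \<ge> 0" using order_trans[OF norm_ge_zero g_lip[of 1 0]] by simp
  have cb: "norm (F w t) \<le> B" "norm (F' w t) \<le> B" if "w \<in> cball lam0 r" "\<bar>t - x\<bar> \<le> 1" for w t
  proof -
    have "R * \<bar>t\<bar> \<le> \<bar>R\<bar> * (\<bar>x\<bar> + 1)" using that(2) by (intro mult_mono) auto
    then have "M * exp (R * \<bar>t\<bar>) \<le> B" unfolding B_def by (intro mult_mono) auto
    with bd[OF that(1), of t] show "norm (F w t) \<le> B" "norm (F' w t) \<le> B" by auto
  qed
  have qb: "norm (q w t) \<le> Q" if "w \<in> cball lam0 r" for w t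
  proof -
    have "norm w \<le> norm lam0 + r" using that norm_triangle_sub[of w lam0] by (simp add: dist_norm norm_minus_commute)
    with q_bounded[of w t] show ?thesis by (simp add: Q_def)
  qed
  have d1: "(F w has_vector_derivative F' w t) (at t)" and d2: "(F' w has_vector_derivative F'' w t) (at t)"
    if "w \<in> cball lam0 r" for w t
    using lin2D[OF sol, of w t] that r by (auto simp: F''_def)
  define K where "K = \<bar>c\<bar> * B + Q * B"
  have K0: "K \<ge> 0" using B0 Q0 by (simp add: K_def)
  have F''_le: "norm (F'' w t) \<le> K" if w: "w \<in> cball lam0 r" and t: "\<bar>t - x\<bar> \<le> 1" for w t
  proof -
    have "norm (F'' w t) \<le> norm (of_real c * F' w t) + norm (q w t * F w t)"
      unfolding F''_def by (metis mult_minus_left norm_minus_cancel norm_triangle_ineq4)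
    also have "\<dots> \<le> K"
      unfolding norm_mult K_def using cb[OF w t] qb[OF w] Q0 B0
      by (intro add_mono mult_mono) auto
    finally show ?thesis .
  qed
  have lipg: "norm (H t - H x) \<le> S * \<bar>t - x\<bar>"
    if H: "\<And>s. (H has_vector_derivative H' s) (at s)" and S: "\<And>s. \<bar>s - x\<bar> \<le> 1 \<Longrightarrow> norm (H' s) \<le> S"
      and t: "\<bar>t - x\<bar> \<le> 1" for H H' :: "real \<Rightarrow> complex" and S t
  proof -
    have "norm (H t - H x) \<le> S * norm (t - x)"
    proof (rule differentiable_bound[where S = "{x - 1..x + 1}" and f' = "\<lambda>s h. h *\<^sub>R H' s"])
      fix s assume s: "s \<in> {x - 1..x + 1}"
      show "(H has_derivative (\<lambda>h. h *\<^sub>R H' s)) (at s within {x - 1..x + 1})"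
        using H[of s] by (auto simp: has_vector_derivative_def intro: has_derivative_at_withinI)
      show "onorm (\<lambda>h. h *\<^sub>R H' s) \<le> S"
        using S[of s] s onorm_scaleR_left_lemma[OF bounded_linear_ident, of "H' s"]
        by (auto simp: onorm_scaleR_left[OF bounded_linear_ident] onorm_id)
    qed (use t in auto)
    then show ?thesis by simp
  qed
  have lip1: "norm (F w t - F w x) \<le> B * \<bar>t - x\<bar>" if "w \<in> cball lam0 r" "\<bar>t - x\<bar> \<le> 1" for w t
    by (rule lipg[OF d1[OF that(1)]]) (use cb(2)[OF that(1)] that in auto)
  have lip2: "norm (F' w t - F' w x) \<le> K * \<bar>t - x\<bar>" if "w \<in> cball lam0 r" "\<bar>t - x\<bar> \<le> 1" for w t
    by (rule lipg[OF d2[OF that(1)]]) (use F''_le[OF that(1)] that in auto)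
  define L where "L = \<bar>c\<bar> * K + (Q * B + Lg * B)"
  have L0: "L \<ge> 0" using K0 Q0 B0 Lg0 by (simp add: L_def)
  have lip3: "norm (F'' w t - F'' w x) \<le> L * \<bar>t - x\<bar>" if w: "w \<in> cball lam0 r" and t: "\<bar>t - x\<bar> \<le> 1" for w t
  proof -
    have "F'' w t - F'' w x = - of_real c * (F' w t - F' w x) - (q w t * (F w t - F w x) + (g t - g x) * F w x)"
      by (simp add: F''_def q_def algebra_simps)
    also have "norm \<dots> \<le> norm (- of_real c * (F' w t - F' w x)) + norm (q w t * (F w t - F w x) + (g t - g x) * F w x)"
      by (rule norm_triangle_ineq4)
    also have "\<dots> \<le> \<bar>c\<bar> * (K * \<bar>t - x\<bar>) + (Q * (B * \<bar>t - x\<bar>) + (Lg * \<bar>t - x\<bar>) * B)"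
    proof (intro add_mono order_trans[OF norm_triangle_ineq])
      show "norm (- complex_of_real c * (F' w t - F' w x)) \<le> \<bar>c\<bar> * (K * \<bar>t - x\<bar>)"
        using mult_left_mono[OF lip2[OF w t], of "\<bar>c\<bar>"] by (simp add: norm_mult)
      show "norm (q w t * (F w t - F w x)) \<le> Q * (B * \<bar>t - x\<bar>)"
        unfolding norm_mult using lip1[OF w t] qb[OF w] Q0 by (intro mult_mono) auto
      show "norm ((g t - g x) * F w x) \<le> Lg * \<bar>t - x\<bar> * B"
        unfolding norm_mult using g_lip[of t x] cb(1)[OF w, of x] Lg0 by (intro mult_mono) auto
    qed
    also have "\<dots> = L * \<bar>t - x\<bar>" by (simp add: L_def algebra_simps)
    finally show ?thesis .
  qed
  have hol'': "(\<lambda>w. F'' w x) holomorphic_on Omega" for x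
    unfolding F''_def q_def by (intro holomorphic_intros hol)
  show "((\<lambda>x. taylor k (\<lambda>w. F w x) lam0) has_vector_derivative taylor k (\<lambda>w. F' w x) lam0) (at x)"
    by (rule taylor_has_vector_derivative[OF Omega_open lam0 hol r d1 lip2 K0])
  have "((\<lambda>x. taylor k (\<lambda>w. F' w x) lam0) has_vector_derivative taylor k (\<lambda>w. F'' w x) lam0) (at x)"
    by (rule taylor_has_vector_derivative[OF Omega_open lam0 hol(2) hol'' r d2 lip3 L0])
  also have "taylor k (\<lambda>w. F'' w x) lam0 =
      taylor k (\<lambda>w. (w - lam0) * F w x - (of_real c * F' w x + q lam0 x * F w x)) lam0"
    by (rule arg_cong[where f = "\<lambda>f. taylor k f lam0"]) (auto simp: F''_def q_def algebra_simps)
  also have "\<dots> = taylor k (\<lambda>w. (w - lam0) * F w x) lam0 - (of_real c * taylor k (\<lambda>w. F' w x) lam0 + q lam0 x * taylor k (\<lambda>w. F w x) lam0)"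
    by (subst taylor_diff[OF Omega_open lam0] taylor_add[OF Omega_open lam0] taylor_cmult[OF Omega_open lam0];
        (intro holomorphic_intros hol)?)+ simp
  also have "\<dots> = (if k = 0 then 0 else taylor (k - 1) (\<lambda>w. F w x) lam0) - of_real c * taylor k (\<lambda>w. F' w x) lam0 - q lam0 x * taylor k (\<lambda>w. F w x) lam0"
    by (subst taylor_shift[OF Omega_open lam0 hol(1)]) simp
  finally show "((\<lambda>x. taylor k (\<lambda>w. F' w x) lam0) has_vector_derivative
      (if k = 0 then 0 else taylor (k - 1) (\<lambda>w. F w x) lam0) - of_real c * taylor k (\<lambda>w. F' w x) lam0 - q lam0 x * taylor k (\<lambda>w. F w x) lam0) (at x)" .
qed

text \<open>The order \<open>m\<close> of the zero of \<open>evans\<close> at \<open>lam0\<close> is the length of the Jordan chain given by the Taylor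
  coefficients \<open>Y k\<close> of \<open>ym\<close>. To see this, \<open>ym\<close> is compared with the multiple \<open>b yp\<close> that agrees with it
  at a point \<open>x0\<close>. The difference solves the equation for every parameter, vanishes at \<open>x0\<close>, and has
  derivative \<open>evans * \<psi>\<close> there, with \<open>\<psi> lam0 \<noteq> 0\<close>. Hence its Taylor coefficients \<open>rho k\<close> vanish
  identically for \<open>k < m\<close>, so that \<open>Y k\<close> is a combination of Taylor coefficients of \<open>yp\<close> and decays on
  the right; and \<open>rho m\<close> is a homogeneous solution not proportional to \<open>yp\<close>, hence not bounded
  on the right together with its derivative, and neither is \<open>Y m\<close>.\<close>

lemma jordan_chain:
  assumes lam0: "lam0 \<in> Omega"
    and m: "\<And>i. i < m \<Longrightarrow> taylor i evans lam0 = 0" "taylor m evans lam0 \<noteq> 0"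
  obtains Y Y' where "jordan_tower (of_real c) (q lam0) Y Y' m"
proof -
  from local_bounds[OF lam0] obtain r M \<delta> R where r: "r > 0" "cball lam0 r \<subseteq> Omega" and \<delta>: "\<delta> > 0" and M: "M > 0"
    and ym_dec: "\<And>lam x. lam \<in> cball lam0 r \<Longrightarrow> x \<le> 0 \<Longrightarrow> norm (ym lam x) \<le> M * exp (\<delta> * x) \<and> norm (ym' lam x) \<le> M * exp (\<delta> * x)"
    and yp_dec: "\<And>lam x. lam \<in> cball lam0 r \<Longrightarrow> x \<ge> 0 \<Longrightarrow> norm (yp lam x) \<le> M * exp (- \<delta> * x) \<and> norm (yp' lam x) \<le> M * exp (- \<delta> * x)"
    and growth: "\<And>lam x. lam \<in> cball lam0 r \<Longrightarrow> norm (ym lam x) \<le> M * exp (R * \<bar>x\<bar>) \<and> norm (ym' lam x) \<le> M * exp (R * \<bar>x\<bar>)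
        \<and> norm (yp lam x) \<le> M * exp (R * \<bar>x\<bar>) \<and> norm (yp' lam x) \<le> M * exp (R * \<bar>x\<bar>)"
    by metis
  define Y where "Y = (\<lambda>k x. taylor k (\<lambda>w. ym w x) lam0)"
  define Y' where "Y' = (\<lambda>k x. taylor k (\<lambda>w. ym' w x) lam0)"
  define P where "P = (\<lambda>k x. taylor k (\<lambda>w. yp w x) lam0)"
  define P' where "P' = (\<lambda>k x. taylor k (\<lambda>w. yp' w x) lam0)"
  have Y_lin: "lin2 (of_real c) (q lam0) (\<lambda>x. if k = 0 then 0 else Y (k - 1) x) (Y k) (Y' k)" for k
    unfolding Y_def Y'_def using growth by (intro taylor_lin2[OF lam0 r ym_holomorphic ym_lin2]) auto
  have P_lin: "lin2 (of_real c) (q lam0) (\<lambda>x. if k = 0 then 0 else P (k - 1) x) (P k) (P' k)" for k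
    unfolding P_def P'_def using growth by (intro taylor_lin2[OF lam0 r yp_holomorphic yp_lin2]) auto
  have Y_left: "norm (Y k x) \<le> M / r ^ k \<and> norm (Y' k x) \<le> M / r ^ k" if "x \<le> 0" for k x
  proof -
    have "M * exp (\<delta> * x) \<le> M * 1" using M \<delta> that by (intro mult_left_mono) (auto simp: mult_le_0_iff)
    then show ?thesis unfolding Y_def Y'_def
      using ym_dec that by (intro conjI taylor_bound[OF Omega_open lam0 _ r] ym_holomorphic) fastforce+
  qed
  have P_right: "norm (P k x) \<le> M / r ^ k \<and> norm (P' k x) \<le> M / r ^ k" if "x \<ge> 0" for k x
  proof -
    have "M * exp (- \<delta> * x) \<le> M * 1" using M \<delta> that by (intro mult_left_mono) auto
    then show ?thesis unfolding P_def P'_def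
      using yp_dec that by (intro conjI taylor_bound[OF Omega_open lam0 _ r] yp_holomorphic) fastforce+
  qed
  obtain x0 where x0: "yp lam0 x0 \<noteq> 0" using yp_nonzero[OF lam0] .
  \<comment> \<open>Where \<open>b = ym / yp\<close> at \<open>x0\<close> is defined and holomorphic.\<close>
  define A0 where "A0 = {lam \<in> Omega. yp lam x0 \<noteq> 0}"
  have A0: "open A0" "lam0 \<in> A0" "A0 \<subseteq> Omega"
  proof -
    have "open (Omega \<inter> (\<lambda>lam. yp lam x0) -` (- {0}))"
      by (intro continuous_open_preimage holomorphic_on_imp_continuous_on yp_holomorphic Omega_open) auto
    then show "open A0" by (simp add: A0_def vimage_def Int_def)
  qed (use x0 lam0 in \<open>auto simp: A0_def\<close>)
  have hol0: "(\<lambda>lam. ym lam x) holomorphic_on A0" "(\<lambda>lam. ym' lam x) holomorphic_on A0"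
     "(\<lambda>lam. yp lam x) holomorphic_on A0" "(\<lambda>lam. yp' lam x) holomorphic_on A0"
     "evans holomorphic_on A0" "nu holomorphic_on A0" for x
    by (rule holomorphic_on_subset[OF _ A0(3)];
        rule ym_holomorphic yp_holomorphic evans_holomorphic nu_holomorphic)+
  define b where "b = (\<lambda>lam. ym lam x0 / yp lam x0)"
  have b_hol: "b holomorphic_on A0" unfolding b_def by (intro holomorphic_intros hol0) (auto simp: A0_def)
  define bb where "bb = (\<lambda>i. taylor i b lam0)"
  \<comment> \<open>Taylor coefficients of \<open>ym - b yp\<close>, by the product rule.\<close>
  define rho where "rho = (\<lambda>k x. Y k x - (\<Sum>i\<le>k. bb i * P (k - i) x))"
  define rho' where "rho' = (\<lambda>k x. Y' k x - (\<Sum>i\<le>k. bb i * P' (k - i) x))"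
  have rho_lin: "lin2 (of_real c) (q lam0) (\<lambda>x. if k = 0 then 0 else rho (k - 1) x) (rho k) (rho' k)" for k
  proof -
    have "lin2 (of_real c) (q lam0)
       (\<lambda>x. (if k = 0 then 0 else Y (k - 1) x) - (\<Sum>i\<le>k. bb i * (if k - i = 0 then 0 else P (k - i - 1) x)))
       (rho k) (rho' k)"
      unfolding rho_def rho'_def by (intro lin2_diff Y_lin lin2_sum P_lin)
    moreover have "(if k = 0 then 0 else Y (k - 1) x) - (\<Sum>i\<le>k. bb i * (if k - i = 0 then 0 else P (k - i - 1) x))
        = (if k = 0 then 0 else rho (k - 1) x)" for x
      by (cases k) (auto simp: rho_def intro!: sum.cong)
    ultimately show ?thesis by simp
  qed
  have rho0: "rho k x0 = 0" for k
  proof -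
    have "rho k x0 = taylor k (\<lambda>lam. ym lam x0 - b lam * yp lam x0) lam0"
      unfolding rho_def Y_def P_def bb_def
      by (subst taylor_diff[OF A0(1,2)] taylor_mult[OF A0(1,2)]; (intro holomorphic_intros b_hol hol0)?)+ simp
    also have "\<dots> = taylor k (\<lambda>_. 0) lam0"
    proof (rule taylor_cong[OF A0(1,2)])
      show "(\<lambda>lam. ym lam x0 - b lam * yp lam x0) holomorphic_on A0" by (intro holomorphic_intros b_hol hol0)
    qed (simp add: b_def A0_def)
    finally show ?thesis by (simp add: taylor_def)
  qed
  define \<psi> where "\<psi> = (\<lambda>lam. exp (- of_real c * of_real x0) * nu lam / yp lam x0)"
  have \<psi>_hol: "\<psi> holomorphic_on A0" unfolding \<psi>_def by (intro holomorphic_intros hol0) (auto simp: A0_def)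
  have \<psi>_nz: "taylor 0 \<psi> lam0 \<noteq> 0" using nu_nz[OF lam0] x0 by (simp add: taylor_def \<psi>_def)
  have rho'0: "rho' k x0 = (\<Sum>i\<le>k. taylor i evans lam0 * taylor (k - i) \<psi> lam0)" for k
  proof -
    have "rho' k x0 = taylor k (\<lambda>lam. ym' lam x0 - b lam * yp' lam x0) lam0"
      unfolding rho'_def Y'_def P'_def bb_def
      by (subst taylor_diff[OF A0(1,2)] taylor_mult[OF A0(1,2)]; (intro holomorphic_intros b_hol hol0)?)+ simp
    also have "\<dots> = taylor k (\<lambda>lam. evans lam * \<psi> lam) lam0"
    proof (rule taylor_cong[OF A0(1,2)])
      fix lam assume "lam \<in> A0"
      then have lam: "lam \<in> Omega" and nz: "yp lam x0 \<noteq> 0" by (auto simp: A0_def)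
      have "ym' lam x0 - b lam * yp' lam x0 = - (ym lam x0 * yp' lam x0 - ym' lam x0 * yp lam x0) / yp lam x0"
        using nz by (simp add: b_def field_simps)
      also have "ym lam x0 * yp' lam x0 - ym' lam x0 * yp lam x0 = exp (- of_real c * of_real x0) * (- nu lam * evans lam)"
        unfolding wronskian_evans[OF lam, of x0, symmetric] mult.assoc[symmetric] mult_exp_exp by simp
      finally show "ym' lam x0 - b lam * yp' lam x0 = evans lam * \<psi> lam" by (simp add: \<psi>_def)
    qed (intro holomorphic_intros b_hol hol0)
    also have "\<dots> = (\<Sum>i\<le>k. taylor i evans lam0 * taylor (k - i) \<psi> lam0)"
      by (rule taylor_mult[OF A0(1,2) hol0(5) \<psi>_hol])
    finally show ?thesis .
  qed
  have rho_zero: "rho k x = 0 \<and> rho' k x = 0" if "k < m" for k x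
    using that
  proof (induction k arbitrary: x)
    case 0
    have lin: "lin2 (of_real c) (q lam0) (\<lambda>_. 0) (rho 0) (rho' 0)" using rho_lin[of 0] by simp
    have r': "rho' 0 x0 = 0" using 0 m(1) by (simp add: rho'0)
    show ?case using lin2_unique[where q = "q lam0" and Q = "\<bar>d\<bar> + C + norm lam0", OF lin q_bounded rho0 r'] by blast
  next
    case (Suc k)
    have lin: "lin2 (of_real c) (q lam0) (\<lambda>_. 0) (rho (Suc k)) (rho' (Suc k))" using rho_lin[of "Suc k"] Suc by simp
    have r': "rho' (Suc k) x0 = 0" unfolding rho'0 using Suc m(1) by (intro sum.neutral) auto
    show ?case using lin2_unique[where q = "q lam0" and Q = "\<bar>d\<bar> + C + norm lam0", OF lin q_bounded rho0 r'] by blast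
  qed
  have sum_P: "norm (\<Sum>i\<le>k. bb i * P (k - i) x) \<le> (\<Sum>i\<le>k. norm (bb i) * (M / r ^ (k - i)))"
      "norm (\<Sum>i\<le>k. bb i * P' (k - i) x) \<le> (\<Sum>i\<le>k. norm (bb i) * (M / r ^ (k - i)))" if "x \<ge> 0" for k x
    using P_right[OF that] by (intro sum_norm_le; unfold norm_mult; intro mult_left_mono; auto)+
  show ?thesis
  proof (rule that[of Y Y'], unfold_locales)
    show "lin2 (of_real c) (q lam0) (\<lambda>x. if k = 0 then 0 else Y (k - 1) x) (Y k) (Y' k)" for k by (rule Y_lin)
    show "\<exists>B. \<forall>x\<le>0. norm (Y k x) \<le> B \<and> norm (Y' k x) \<le> B" for k using Y_left by blast
    show "\<exists>B. \<forall>x. norm (Y k x) \<le> B \<and> norm (Y' k x) \<le> B" if k: "k < m" for k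
    proof -
      let ?B1 = "M / r ^ k" and ?B2 = "\<Sum>i\<le>k. norm (bb i) * (M / r ^ (k - i))"
      have "norm (Y k x) \<le> max ?B1 ?B2 \<and> norm (Y' k x) \<le> max ?B1 ?B2" for x
      proof (cases "x \<le> 0")
        case True
        then show ?thesis using Y_left[OF True, of k] by (auto simp: le_max_iff_disj)
      next
        case False
        then have "x \<ge> 0" by simp
        moreover have "Y k x = (\<Sum>i\<le>k. bb i * P (k - i) x)" "Y' k x = (\<Sum>i\<le>k. bb i * P' (k - i) x)"
          using rho_zero[OF k, of x] by (auto simp: rho_def rho'_def)
        ultimately show ?thesis using sum_P[of x k] by (auto simp: le_max_iff_disj)
      qed
      then show ?thesis by blast
    qed
    show "\<not> (\<exists>B. \<forall>x\<ge>0. norm (Y m x) \<le> B \<and> norm (Y' m x) \<le> B)"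
    proof
      assume "\<exists>B. \<forall>x\<ge>0. norm (Y m x) \<le> B \<and> norm (Y' m x) \<le> B"
      then obtain B where B: "\<And>x. x \<ge> 0 \<Longrightarrow> norm (Y m x) \<le> B \<and> norm (Y' m x) \<le> B" by blast
      let ?B2 = "\<Sum>i\<le>m. norm (bb i) * (M / r ^ (m - i))"
      have "(\<lambda>x. if m = 0 then 0 else rho (m - 1) x) = (\<lambda>_. 0)" using rho_zero by (auto simp: fun_eq_iff)
      then have lin: "lin2 (of_real c) (q lam0) (\<lambda>_. 0) (rho m) (rho' m)" using rho_lin[of m] by simp
      have bd: "norm (rho m x) \<le> B + ?B2 \<and> norm (rho' m x) \<le> B + ?B2" if "x \<ge> 0" for x
        unfolding rho_def rho'_def using B[OF that] sum_P[OF that, of m]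
        by (intro conjI order_trans[OF norm_triangle_ineq4] add_mono) auto
      have "yp lam0 x0 * rho' m x0 - yp' lam0 x0 * rho m x0 = 0"
        by (rule bounded_right_wronskian[OF lam0 lin bd])
      then have "rho' m x0 = 0" using x0 rho0 by simp
      moreover have "rho' m x0 = taylor m evans lam0 * taylor 0 \<psi> lam0"
      proof -
        have "rho' m x0 = (\<Sum>i\<le>m. if i = m then taylor m evans lam0 * taylor 0 \<psi> lam0 else 0)"
          unfolding rho'0 using m(1) by (intro sum.cong) auto
        then show ?thesis by (simp add: sum.delta)
      qed
      ultimately show False using m(2) \<psi>_nz by simp
    qed
    have Y0: "Y 0 = ym lam0" "Y' 0 = ym' lam0" by (auto simp: Y_def Y'_def taylor_def fun_eq_iff)
    show "\<exists>x. Y 0 x \<noteq> 0" unfolding Y0 using ym_nonzero[OF lam0] by metis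
    show "\<exists>k. \<forall>x. p x = k * Y 0 x \<and> p' x = k * Y' 0 x"
      if "lin2 (of_real c) (q lam0) (\<lambda>_. 0) p p'" "\<And>x. x \<le> 0 \<Longrightarrow> norm (p x) \<le> B \<and> norm (p' x) \<le> B" for p p' B
      unfolding Y0 using bounded_left_multiple[OF lam0 that] by metis
  qed
qed

end

section \<open>Generalized eigenspaces\<close>

lemma lipschitz_real_imp_uniformly_continuous:
  fixes p :: "real \<Rightarrow> complex"
  assumes "\<And>s t. norm (p s - p t) \<le> L * \<bar>s - t\<bar>"
  shows "uniformly_continuous_on UNIV p"
proof -
  have "L-lipschitz_on UNIV p"
  proof (rule lipschitz_onI)
    show "L \<ge> 0" using order_trans[OF norm_ge_zero assms[of 1 0]] by simp
  qed (use assms in \<open>simp add: dist_norm\<close>)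
  then show ?thesis by (rule lipschitz_on_uniformly_continuous)
qed

lemma lipschitz_of_bounded_derivative:
  fixes p p' :: "real \<Rightarrow> complex"
  assumes d: "\<And>x. (p has_vector_derivative p' x) (at x)" and B: "\<And>x. norm (p' x) \<le> B"
  shows "norm (p s - p t) \<le> B * \<bar>s - t\<bar>"
proof -
  have "norm (p s - p t) \<le> B * norm (s - t)"
  proof (rule differentiable_bound[where S = UNIV and f' = "\<lambda>s h. h *\<^sub>R p' s"])
    fix s
    show "(p has_derivative (\<lambda>h. h *\<^sub>R p' s)) (at s within UNIV)"
      using d[of s] by (simp add: has_vector_derivative_def)
    show "onorm (\<lambda>h. h *\<^sub>R p' s) \<le> B"
      using B[of s] by (auto simp: onorm_scaleR_left[OF bounded_linear_ident] onorm_id)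
  qed auto
  then show ?thesis by simp
qed

lemma BUC_of_bounded_derivative:
  assumes "\<And>x. (p has_vector_derivative p' x) (at x)" "\<And>x. norm (p x) \<le> B" "\<And>x. norm (p' x) \<le> B'"
  shows "p \<in> BUC"
  using assms lipschitz_real_imp_uniformly_continuous[OF lipschitz_of_bounded_derivative[OF assms(1,3)]]
  by (auto simp: BUC_def bounded_iff)

lemma BUC_bounded: "p \<in> BUC \<Longrightarrow> \<exists>B. \<forall>x. norm (p x) \<le> B"
  by (auto simp: BUC_def bounded_iff)

lemma BUC_add: "p \<in> BUC \<Longrightarrow> r \<in> BUC \<Longrightarrow> (\<lambda>x. p x + r x) \<in> BUC"
  unfolding BUC_def by (auto intro!: uniformly_continuous_on_add bounded_plus_comp)

lemma BUC_cmult: "p \<in> BUC \<Longrightarrow> (\<lambda>x. k * p x) \<in> BUC"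
  unfolding BUC_def
  using bounded_linear_image[OF _ bounded_linear_mult_right, of "range p" k]
  by (auto intro!: uniformly_continuous_on_cmul_left simp: image_image)

lemma BUC_zero: "(\<lambda>x. 0) \<in> BUC"
  unfolding BUC_def by (auto intro: uniformly_continuous_on_const)

lemma BUC_sum: "(\<And>i. i \<in> I \<Longrightarrow> p i \<in> BUC) \<Longrightarrow> (\<lambda>x. \<Sum>i\<in>I. k i * p i x) \<in> BUC"
  by (induction I rule: infinite_finite_induct) (auto intro!: BUC_zero BUC_add BUC_cmult)

lemma BUC_mult:
  assumes p: "p \<in> BUC" and r: "r \<in> BUC"
  shows "(\<lambda>x. p x * r x) \<in> BUC"
proof -
  obtain A B where A: "\<And>x. norm (p x) \<le> A" and B: "\<And>x. norm (r x) \<le> B"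
    using BUC_bounded[OF p] BUC_bounded[OF r] by blast
  have A0: "A \<ge> 0" and B0: "B \<ge> 0" using order_trans[OF norm_ge_zero A] order_trans[OF norm_ge_zero B] by auto
  have "norm (p x * r x) \<le> A * B" for x
    unfolding norm_mult by (intro mult_mono A B A0) simp
  then have "bounded (range (\<lambda>x. p x * r x))" by (auto simp: bounded_iff)
  moreover have "uniformly_continuous_on UNIV (\<lambda>x. p x * r x)"
    unfolding uniformly_continuous_on_def
  proof (intro allI impI)
    fix e :: real assume e: "e > 0"
    define d where "d = e / (A + B + 1)"
    have d: "d > 0" using e A0 B0 by (simp add: d_def)
    obtain d1 where d1: "d1 > 0" "\<And>x y. dist y x < d1 \<Longrightarrow> dist (p y) (p x) < d"
      using p d unfolding BUC_def uniformly_continuous_on_def by blast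
    obtain d2 where d2: "d2 > 0" "\<And>x y. dist y x < d2 \<Longrightarrow> dist (r y) (r x) < d"
      using r d unfolding BUC_def uniformly_continuous_on_def by blast
    have "dist (p y * r y) (p x * r x) < e" if "dist y x < min d1 d2" for x y
    proof -
      have "norm (p y * r y - p x * r x) = norm ((p y - p x) * r y + p x * (r y - r x))"
        by (simp add: algebra_simps)
      also have "\<dots> \<le> norm (p y - p x) * norm (r y) + norm (p x) * norm (r y - r x)"
        by (metis norm_mult norm_triangle_ineq)
      also have "\<dots> \<le> d * B + A * d"
        using d1(2)[of y x] d2(2)[of y x] that A B A0 B0 d
        by (intro add_mono mult_mono) (auto simp: dist_norm intro: less_imp_le)
      also have "\<dots> < d * (A + B + 1)" using d by (simp add: algebra_simps)
      also have "\<dots> = e" using A0 B0 by (simp add: d_def)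
      finally show ?thesis by (simp add: dist_norm)
    qed
    then show "\<exists>d>0. \<forall>x\<in>UNIV. \<forall>x'\<in>UNIV. dist x' x < d \<longrightarrow> dist (p x' * r x') (p x * r x) < e"
      using d1(1) d2(1) by (intro exI[of _ "min d1 d2"]) auto
  qed
  ultimately show ?thesis by (simp add: BUC_def)
qed

lemma dom_L_lin2:
  assumes "p \<in> dom_L"
  shows "lin2 (of_real c) (\<lambda>x. of_real (deriv f (U x)) - lam) (L_shift c f U lam p) p (cderiv p)"
proof -
  have "(p has_vector_derivative cderiv p x) (at x)"
       "(cderiv p has_vector_derivative cderiv (cderiv p) x) (at x)" for x
    using assms vector_derivative_works[of p "at x"] vector_derivative_works[of "cderiv p" "at x"]
    by (auto simp: dom_L_def cderiv_def)
  then show ?thesis by (simp add: lin2_def L_shift_def L_op_def algebra_simps)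
qed

text \<open>The equation expresses \<open>p''\<close> through functions that are already known to be bounded and uniformly
  continuous; boundedness of \<open>p'\<close> and \<open>p''\<close> gives uniform continuity of \<open>p\<close> and \<open>p'\<close>.\<close>

lemma lin2_dom_L:
  assumes sol: "lin2 (of_real c) (\<lambda>x. of_real (deriv f (U x)) - lam) h p p'"
    and bd: "\<And>x. norm (p x) \<le> B" "\<And>x. norm (p' x) \<le> B" and h: "h \<in> BUC"
    and pot: "(\<lambda>x. of_real (deriv f (U x)) - lam) \<in> BUC"
  shows "p \<in> dom_L" "L_shift c f U lam p = h" "cderiv p = p'"
proof -
  define p'' where "p'' = (\<lambda>x. h x - of_real c * p' x - (of_real (deriv f (U x)) - lam) * p x)"
  have d: "(p has_vector_derivative p' x) (at x)" "(p' has_vector_derivative p'' x) (at x)" for x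
    using lin2D[OF sol] by (auto simp: p''_def)
  have c1: "cderiv p = p'" using d(1) by (auto simp: cderiv_def fun_eq_iff intro: vector_derivative_at)
  have c2: "cderiv p' = p''" using d(2) by (auto simp: cderiv_def fun_eq_iff intro: vector_derivative_at)
  have p: "p \<in> BUC" by (rule BUC_of_bounded_derivative[OF d(1) bd])
  obtain H where H: "\<And>x. norm (h x) \<le> H" using BUC_bounded[OF h] by blast
  obtain Q where Q: "\<And>x. norm (of_real (deriv f (U x)) - lam) \<le> Q" using BUC_bounded[OF pot] by blast
  have Q0: "Q \<ge> 0" using order_trans[OF norm_ge_zero Q] .
  have "norm (p'' x) \<le> H + \<bar>c\<bar> * B + Q * B" for x
  proof -
    have "norm (p'' x) \<le> norm (h x) + norm (of_real c * p' x) + norm ((of_real (deriv f (U x)) - lam) * p x)"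
      unfolding p''_def by (meson norm_triangle_ineq4 order_trans add_right_mono)
    also have "\<dots> \<le> H + \<bar>c\<bar> * B + Q * B"
      unfolding norm_mult using H Q bd Q0 by (intro add_mono mult_mono) auto
    finally show ?thesis .
  qed
  then have p': "p' \<in> BUC" by (rule BUC_of_bounded_derivative[OF d(2) bd(2)])
  have "p'' = (\<lambda>x. h x + ((- of_real c) * p' x + (-1) * ((of_real (deriv f (U x)) - lam) * p x)))"
    by (simp add: p''_def fun_eq_iff)
  then have p'': "p'' \<in> BUC" by (simp only:) (intro BUC_add BUC_cmult BUC_mult p' p h pot)
  show "p \<in> dom_L"
    unfolding dom_L_def using p p' p'' differentiableI_vector[OF d(1)] differentiableI_vector[OF d(2)] by (auto simp: c1 c2)
  show "L_shift c f U lam p = h"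
    by (auto simp: L_shift_def L_op_def c1 c2 p''_def fun_eq_iff algebra_simps)
  show "cderiv p = p'" by (rule c1)
qed

lemma sum_fun_apply: "(\<Sum>i\<in>I. F i) x = (\<Sum>i\<in>I. F i x)" for F :: "'i \<Rightarrow> 'a \<Rightarrow> 'b::comm_monoid_add"
  by (induction I rule: infinite_finite_induct) auto

locale operator_tower = jordan_tower "of_real c" "\<lambda>x. of_real (deriv f (U x)) - lam" Y Y' m
  for c :: real and f U :: "real \<Rightarrow> real" and lam :: complex and Y Y' :: "nat \<Rightarrow> real \<Rightarrow> complex" and m :: nat +
  assumes pot: "(\<lambda>x. of_real (deriv f (U x)) - lam) \<in> BUC"
begin

abbreviation pt where "pt \<equiv> (\<lambda>x. complex_of_real (deriv f (U x)) - lam)"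

lemma Y_BUC: "k < m \<Longrightarrow> Y k \<in> BUC"
  using Y_bd[of k] lin2D(1)[OF Y_lin[of k]] by (blast intro: BUC_of_bounded_derivative)

text \<open>Applying \<open>L - lam\<close> shifts a combination of the chain down by one index; the coefficient of \<open>Y 0\<close> is
  lost.\<close>

lemma comb_lin2:
  "lin2 (of_real c) pt (\<lambda>x. \<Sum>i<j. k (Suc i) * Y i x) (\<lambda>x. \<Sum>i<Suc j. k i * Y i x) (\<lambda>x. \<Sum>i<Suc j. k i * Y' i x)"
proof -
  have "lin2 (of_real c) pt (\<lambda>x. \<Sum>i<Suc j. k i * (if i = 0 then 0 else Y (i - 1) x))
     (\<lambda>x. \<Sum>i<Suc j. k i * Y i x) (\<lambda>x. \<Sum>i<Suc j. k i * Y' i x)"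
    by (rule lin2_sum) (rule Y_lin)
  moreover have "(\<Sum>i<Suc j. k i * (if i = 0 then 0 else Y (i - 1) x)) = (\<Sum>i<j. k (Suc i) * Y i x)" for x
    by (subst sum.lessThan_Suc_shift) simp
  ultimately show ?thesis by (simp only:)
qed

lemma comb_bounded:
  assumes "\<And>i. i < j \<Longrightarrow> \<exists>B. \<forall>x\<in>S. norm (Y i x) \<le> B \<and> norm (Y' i x) \<le> B"
  shows "\<exists>B. \<forall>x\<in>S. norm (\<Sum>i<j. k i * Y i x) \<le> B \<and> norm (\<Sum>i<j. k i * Y' i x) \<le> B"
proof -
  obtain B where B: "\<And>i x. i < j \<Longrightarrow> x \<in> S \<Longrightarrow> norm (Y i x) \<le> B i \<and> norm (Y' i x) \<le> B i"
    using assms by metis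
  show ?thesis
    using B by (intro exI[of _ "\<Sum>i<j. norm (k i) * B i"])
      (auto intro!: sum_norm_le simp: norm_mult mult_left_mono)
qed

lemma comb_in_ker_power: "j \<le> m \<Longrightarrow> (\<lambda>x. \<Sum>i<j. k i * Y i x) \<in> ker_power c f U lam j"
proof (induction j arbitrary: k)
  case (Suc j)
  have "\<exists>B. \<forall>x\<in>UNIV. norm (Y i x) \<le> B \<and> norm (Y' i x) \<le> B" if "i < Suc j" for i
    using Y_bd[of i] Suc.prems that by simp
  from comb_bounded[where j = "Suc j" and k = k, OF this] obtain B
    where "\<forall>x\<in>UNIV. norm (\<Sum>i<Suc j. k i * Y i x) \<le> B \<and> norm (\<Sum>i<Suc j. k i * Y' i x) \<le> B" ..
  note B = bspec[OF this UNIV_I]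
  have h: "(\<lambda>x. \<Sum>i<j. k (Suc i) * Y i x) \<in> BUC"
    using Suc.prems by (intro BUC_sum[where p = Y and k = "\<lambda>i. k (Suc i)"] Y_BUC) simp
  note dom = lin2_dom_L[OF comb_lin2[where j = j and k = k] conjunct1[OF B] conjunct2[OF B] h pot]
  have "(\<lambda>x. \<Sum>i<Suc j. k i * Y i x) \<in> dom_L" "L_shift c f U lam (\<lambda>x. \<Sum>i<Suc j. k i * Y i x) = (\<lambda>x. \<Sum>i<j. k (Suc i) * Y i x)"
    by (fact dom(1), fact dom(2))
  moreover have "(\<lambda>x. \<Sum>i<j. k (Suc i) * Y i x) \<in> ker_power c f U lam j"
    using Suc.prems by (intro Suc.IH) simp
  ultimately show ?case by (simp only: ker_power.simps mem_Collect_eq)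
qed simp

text \<open>If \<open>(L - lam) p\<close> is a combination of \<open>Y 0, ..., Y (m - 1)\<close>, then \<open>p\<close> differs from the shifted
  combination by a homogeneous solution bounded on the left, a multiple of \<open>Y 0\<close>. So \<open>p\<close> is a
  combination of \<open>Y 0, ..., Y m\<close>, and \<open>Y m\<close> cannot occur, being unbounded while the rest is bounded.\<close>

lemma ker_power_subset: "p \<in> ker_power c f U lam j \<Longrightarrow> \<exists>k. p = (\<lambda>x. \<Sum>i<m. k i * Y i x)"
proof (induction j arbitrary: p)
  case 0
  then show ?case by (intro exI[of _ "\<lambda>_. 0"]) auto
next
  case (Suc j)
  then have p: "p \<in> dom_L" and "L_shift c f U lam p \<in> ker_power c f U lam j" by auto
  then obtain k where k: "L_shift c f U lam p = (\<lambda>x. \<Sum>i<m. k i * Y i x)" using Suc.IH by blast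
  \<comment> \<open>Coefficients shifted up by one index.\<close>
  define k' where "k' = case_nat 0 k"
  define S S' where "S = (\<lambda>x. \<Sum>i<Suc m. k' i * Y i x)" and "S' = (\<lambda>x. \<Sum>i<Suc m. k' i * Y' i x)"
  have "lin2 (of_real c) pt (\<lambda>x. L_shift c f U lam p x - (\<Sum>i<m. k' (Suc i) * Y i x)) (\<lambda>x. p x - S x) (\<lambda>x. cderiv p x - S' x)"
    unfolding S_def S'_def by (intro lin2_diff dom_L_lin2[OF p] comb_lin2)
  then have hom: "lin2 (of_real c) pt (\<lambda>_. 0) (\<lambda>x. p x - S x) (\<lambda>x. cderiv p x - S' x)"
    by (simp add: k k'_def)
  obtain P where P: "\<And>x. norm (p x) \<le> P" using p BUC_bounded[of p] by (auto simp: dom_L_def)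
  obtain P' where P': "\<And>x. norm (cderiv p x) \<le> P'" using p BUC_bounded[of "cderiv p"] by (auto simp: dom_L_def)
  obtain B where B: "\<And>x. x \<in> {..0} \<Longrightarrow> norm (S x) \<le> B \<and> norm (S' x) \<le> B"
  proof -
    have "\<exists>B. \<forall>x\<in>{..0}. norm (Y i x) \<le> B \<and> norm (Y' i x) \<le> B" if "i < Suc m" for i
      using Y_left[of i] by auto
    from comb_bounded[where j = "Suc m" and k = k', OF this] show thesis
      using that unfolding S_def S'_def by blast
  qed
  have "norm (p x - S x) \<le> max P P' + B \<and> norm (cderiv p x - S' x) \<le> max P P' + B" if "x \<le> 0" for x
    using P[of x] P'[of x] B[of x] that
    by (intro conjI order_trans[OF norm_triangle_ineq4] add_mono) auto
  from Y_prop[OF hom this] obtain b where b: "\<And>x. p x - S x = b * Y 0 x" "\<And>x. cderiv p x - S' x = b * Y' 0 x" by blast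
  define e where "e = k'(0 := b)"
  have k'0: "k' 0 = 0" by (simp add: k'_def)
  have pe: "p x = (\<Sum>i<m. e i * Y i x) + e m * Y m x" "cderiv p x = (\<Sum>i<m. e i * Y' i x) + e m * Y' m x" for x
  proof -
    have "p x = S x + b * Y 0 x" "cderiv p x = S' x + b * Y' 0 x" using b[of x] by (auto simp: algebra_simps)
    moreover have shift: "(\<Sum>i<Suc m. e i * Z i) = (\<Sum>i<Suc m. k' i * Z i) + b * Z 0" for Z :: "nat \<Rightarrow> complex"
      unfolding e_def sum.lessThan_Suc_shift by (simp add: k'0)
    ultimately show "p x = (\<Sum>i<m. e i * Y i x) + e m * Y m x" "cderiv p x = (\<Sum>i<m. e i * Y' i x) + e m * Y' m x"
      using shift[of "\<lambda>i. Y i x"] shift[of "\<lambda>i. Y' i x"] by (simp_all add: S_def S'_def)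
  qed
  have "e m = 0"
  proof (rule ccontr)
    assume em: "e m \<noteq> 0"
    have "\<exists>B. \<forall>x\<in>UNIV. norm (Y i x) \<le> B \<and> norm (Y' i x) \<le> B" if "i < m" for i
      using Y_bd[OF that] by simp
    from comb_bounded[where j = m and k = e, OF this] obtain D
      where "\<forall>x\<in>UNIV. norm (\<Sum>i<m. e i * Y i x) \<le> D \<and> norm (\<Sum>i<m. e i * Y' i x) \<le> D" ..
    note D = bspec[OF this UNIV_I]
    have "norm (Y m x) \<le> (max P P' + D) / norm (e m) \<and> norm (Y' m x) \<le> (max P P' + D) / norm (e m)" for x
    proof -
      have "Y m x = (p x - (\<Sum>i<m. e i * Y i x)) / e m" "Y' m x = (cderiv p x - (\<Sum>i<m. e i * Y' i x)) / e m"
        unfolding pe[of x] using em by simp_all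
      moreover have "norm (p x - (\<Sum>i<m. e i * Y i x)) \<le> max P P' + D" "norm (cderiv p x - (\<Sum>i<m. e i * Y' i x)) \<le> max P P' + D"
        using P[of x] P'[of x] D[of x] by (intro order_trans[OF norm_triangle_ineq4] add_mono; auto)+
      ultimately show ?thesis by (auto simp: norm_divide divide_right_mono)
    qed
    with Y_unbd show False by blast
  qed
  then show ?case using pe by (intro exI[of _ e]) (auto simp: fun_eq_iff)
qed

text \<open>Applying \<open>L - lam\<close> to a vanishing combination kills the coefficient of \<open>Y 0\<close> and shifts the others
  down, so the induction reaches all of them but the first.\<close>

lemma comb_independent: "(\<And>x. (\<Sum>i<j. k i * Y i x) = 0) \<Longrightarrow> i < j \<Longrightarrow> k i = 0"
proof (induction j arbitrary: k i)
  case (Suc j)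
  have zero: "(\<lambda>x. \<Sum>i<Suc j. k i * Y i x) = (\<lambda>_. 0)" using Suc.prems(1) by (simp add: fun_eq_iff)
  note D = lin2D[OF comb_lin2[where j = j and k = k]]
  have z': "(\<Sum>i<Suc j. k i * Y' i x) = 0" for x
    using vector_derivative_unique_at[OF D(1)[of x, unfolded zero] has_vector_derivative_const] .
  have "(\<Sum>i<j. k (Suc i) * Y i x) = 0" for x
  proof -
    have zf: "(\<lambda>x. \<Sum>i<Suc j. k i * Y' i x) = (\<lambda>_. 0)" using z' by (simp add: fun_eq_iff)
    have "(\<Sum>i<j. k (Suc i) * Y i x) - of_real c * (\<Sum>i<Suc j. k i * Y' i x) - pt x * (\<Sum>i<Suc j. k i * Y i x) = 0"
      using vector_derivative_unique_at[OF D(2)[of x, unfolded zf] has_vector_derivative_const] .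
    then show ?thesis using Suc.prems(1)[of x] z'[of x] by simp
  qed
  from Suc.IH[OF this] have tail: "k (Suc i) = 0" if "i < j" for i using that .
  have "k 0 = 0"
  proof -
    obtain x where x: "Y 0 x \<noteq> 0" using Y_nz by blast
    have "(\<Sum>i<Suc j. k i * Y i x) = k 0 * Y 0 x" unfolding sum.lessThan_Suc_shift using tail by simp
    then show ?thesis using Suc.prems(1)[of x] x by simp
  qed
  with tail show ?case using Suc.prems(2) by (cases i) auto
qed simp

lemma Y_inj: "inj_on Y {..<m}"
proof (rule inj_onI, rule ccontr)
  fix i j assume ij: "i \<in> {..<m}" "j \<in> {..<m}" "Y i = Y j" "i \<noteq> j"
  define k :: "nat \<Rightarrow> complex" where "k = (\<lambda>n. (if n = i then 1 else 0) - (if n = j then 1 else 0))"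
  have "(\<Sum>n<m. k n * Y n x) = 0" for x
  proof -
    have "(\<Sum>n<m. k n * Y n x) = (\<Sum>n<m. (if n = i then Y i x else 0) - (if n = j then Y j x else 0))"
      unfolding k_def by (intro sum.cong) auto
    also have "\<dots> = Y i x - Y j x" using ij by (simp add: sum_subtractf sum.delta)
    finally show ?thesis using ij by simp
  qed
  from comb_independent[OF this, of i] ij show False by (simp add: k_def)
qed

lemma comb_eq_sum:
  "(\<Sum>v\<in>Y ` {..<m}. (\<lambda>x. u v * v x)) = (\<lambda>x. \<Sum>i<m. u (Y i) * Y i x)"
  by (simp add: fun_eq_iff sum_fun_apply sum.reindex[OF Y_inj])

lemma Y_independent: "cfun.independent (Y ` {..<m})"
proof (rule cfun.independent_if_scalars_zero)
  fix u v assume s: "(\<Sum>v\<in>Y ` {..<m}. (\<lambda>x. u v * v x)) = 0" and v: "v \<in> Y ` {..<m}"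
  then obtain i where i: "i < m" "v = Y i" by auto
  have "(\<Sum>i<m. u (Y i) * Y i x) = 0" for x
    using fun_cong[OF s, of x] unfolding comb_eq_sum by simp
  from comb_independent[OF this i(1)] show "u v = 0" by (simp add: i)
qed simp

lemma gen_eigenspace_eq: "gen_eigenspace c f U lam = cfun.span (Y ` {..<m})"
proof
  show "gen_eigenspace c f U lam \<subseteq> cfun.span (Y ` {..<m})"
  proof
    fix p assume "p \<in> gen_eigenspace c f U lam"
    then obtain k where k: "p = (\<lambda>x. \<Sum>i<m. k i * Y i x)"
      using ker_power_subset by (auto simp: gen_eigenspace_def)
    define u where "u = (\<lambda>v. k (the_inv_into {..<m} Y v))"
    have "p = (\<Sum>v\<in>Y ` {..<m}. (\<lambda>x. u v * v x))"
      unfolding comb_eq_sum k u_def using Y_inj by (auto simp: fun_eq_iff the_inv_into_f_f intro!: sum.cong)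
    then show "p \<in> cfun.span (Y ` {..<m})" by (auto simp: cfun.span_finite)
  qed
  show "cfun.span (Y ` {..<m}) \<subseteq> gen_eigenspace c f U lam"
  proof
    fix p assume "p \<in> cfun.span (Y ` {..<m})"
    then obtain u where "p = (\<Sum>v\<in>Y ` {..<m}. (\<lambda>x. u v * v x))" by (auto simp: cfun.span_finite)
    then have "p = (\<lambda>x. \<Sum>i<m. u (Y i) * Y i x)" by (simp only: comb_eq_sum)
    then have "p \<in> ker_power c f U lam m" using comb_in_ker_power[of m "\<lambda>i. u (Y i)"] by simp
    then show "p \<in> gen_eigenspace c f U lam" unfolding gen_eigenspace_def by blast
  qed
qed

lemma alg_mult_eq: "alg_mult c f U lam = m"
  unfolding alg_mult_def gen_eigenspace_eq cfun.dim_span_eq_card_independent[OF Y_independent]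
  by (simp add: card_image Y_inj)

lemma eigenvalue_iff: "lam \<in> eigenvalues_L c f U \<longleftrightarrow> m > 0"
proof
  assume "lam \<in> eigenvalues_L c f U"
  then obtain p where p: "p \<in> dom_L" "p \<noteq> (\<lambda>x. 0)" "L_op c f U p = (\<lambda>x. lam * p x)"
    by (auto simp: eigenvalues_L_def)
  then have "p \<in> ker_power c f U lam (Suc 0)" by (simp add: L_shift_def)
  then obtain k where "p = (\<lambda>x. \<Sum>i<m. k i * Y i x)" using ker_power_subset by blast
  with p(2) show "m > 0" by (cases m) auto
next
  assume "m > 0"
  then have "(\<lambda>x. \<Sum>i<Suc 0. 1 * Y i x) \<in> ker_power c f U lam (Suc 0)" by (intro comb_in_ker_power) simp
  then have "Y 0 \<in> dom_L" "L_shift c f U lam (Y 0) = (\<lambda>x. 0)" by auto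
  then show "lam \<in> eigenvalues_L c f U"
    unfolding eigenvalues_L_def using Y_nz by (auto intro!: bexI[of _ "Y 0"] simp: L_shift_def fun_eq_iff)
qed

end

section \<open>Geometric phase and winding numbers\<close>

lemma has_vector_derivative_vec2:
  fixes u :: "real \<Rightarrow> complex^2"
  assumes p: "((\<lambda>s. u s $ 1) has_vector_derivative p') (at x within S)"
    and r: "((\<lambda>s. u s $ 2) has_vector_derivative r') (at x within S)"
  shows "(u has_vector_derivative vector [p', r']) (at x within S)"
proof -
  define e1 e2 :: "complex \<Rightarrow> complex^2" where "e1 = (\<lambda>z. vector [z, 0])" and "e2 = (\<lambda>z. vector [0, z])"
  have bl: "bounded_linear e1" "bounded_linear e2"
    unfolding linear_conv_bounded_linear[symmetric] e1_def e2_def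
    by (auto intro!: linearI simp: vec_eq_iff forall_2)
  have dec: "v = e1 (v $ 1) + e2 (v $ 2)" for v :: "complex^2"
    by (simp add: vec_eq_iff forall_2 e1_def e2_def)
  have "((\<lambda>s. e1 (u s $ 1) + e2 (u s $ 2)) has_vector_derivative e1 p' + e2 r') (at x within S)"
    by (intro has_vector_derivative_add bounded_linear.has_vector_derivative[OF bl(1)]
        bounded_linear.has_vector_derivative[OF bl(2)] p r)
  moreover have "e1 p' + e2 r' = vector [p', r']" by (simp add: vec_eq_iff forall_2 e1_def e2_def)
  ultimately show ?thesis unfolding dec[symmetric] by simp
qed

lemma GP_eq:
  fixes u :: "real \<Rightarrow> complex^2"
  assumes u: "\<And>s. s \<in> {0..1} \<Longrightarrow> u s $ 1 = p s" "\<And>s. s \<in> {0..1} \<Longrightarrow> u s $ 2 = r s"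
    and p: "\<And>s. s \<in> {0..1} \<Longrightarrow> (p has_vector_derivative p' s) (at s within {0..1})"
    and r: "\<And>s. s \<in> {0..1} \<Longrightarrow> (r has_vector_derivative r' s) (at s within {0..1})"
  shows "GP u = 1 / (2 * pi) * integral {0..1} (\<lambda>s. Im (p' s * cnj (p s) + r' s * cnj (r s)) /
      Re (p s * cnj (p s) + r s * cnj (r s)))"
  unfolding GP_def
proof (intro arg_cong2[where f = "(*)"] refl integral_cong)
  fix s :: real assume s: "s \<in> {0..1}"
  have "((\<lambda>s. u s $ 1) has_vector_derivative p' s) (at s within {0..1})"
    by (rule has_vector_derivative_transform[OF s _ p[OF s]]) (rule u(1))
  moreover have "((\<lambda>s. u s $ 2) has_vector_derivative r' s) (at s within {0..1})"
    by (rule has_vector_derivative_transform[OF s _ r[OF s]]) (rule u(2))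
  ultimately have "(u has_vector_derivative vector [p' s, r' s]) (at s within {0..1})"
    by (rule has_vector_derivative_vec2)
  then have "vector_derivative u (at s within {0..1}) = vector [p' s, r' s]"
    by (intro vector_derivative_within_closed_interval s) auto
  then show "Im (hprod (vector_derivative u (at s within {0..1})) (u s)) / Re (hprod (u s) (u s)) =
     Im (p' s * cnj (p s) + r' s * cnj (r s)) / Re (p s * cnj (p s) + r s * cnj (r s))"
    using u[OF s] by (simp add: hprod_def UNIV_2)
qed

locale smooth_loop =
  fixes gam gam' :: "real \<Rightarrow> complex"
  assumes simple: "simple_path gam" and loop: "pathfinish gam = pathstart gam"
    and gam'_cont: "continuous_on {0..1} gam'"
    and gam_deriv: "\<And>s. s \<in> {0..1} \<Longrightarrow> (gam has_vector_derivative gam' s) (at s within {0..1})"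
begin

lemma gam_path: "path gam" by (rule simple_path_imp_path[OF simple])

lemma gam_cont: "continuous_on {0..1} gam" using gam_path by (simp add: path_def)

lemma gam_in: "s \<in> {0..1} \<Longrightarrow> gam s \<in> path_image gam" by (simp add: path_image_def)

lemma gam_valid: "valid_path gam"
  unfolding valid_path_def piecewise_C1_differentiable_on_def
proof (intro conjI exI[of _ "{0, 1}"])
  show "gam C1_differentiable_on {0..1} - {0, 1}"
    unfolding C1_differentiable_on_def
  proof (intro exI[of _ gam'] conjI ballI)
    show "(gam has_vector_derivative gam' x) (at x)" if "x \<in> {0..1} - {0, 1}" for x
      using gam_deriv[of x] that at_within_Icc_at[of 0 x 1] by auto
  qed (use gam'_cont in \<open>auto intro: continuous_on_subset\<close>)
qed (auto simp: gam_cont)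

lemma continuous_on_gam: "continuous_on (path_image gam) \<phi> \<Longrightarrow> continuous_on {0..1} (\<lambda>s. \<phi> (gam s))"
  by (rule continuous_on_compose2[OF _ gam_cont]) (auto simp: path_image_def)

lemma has_integral_contour:
  assumes "continuous_on (path_image gam) \<phi>"
  shows "((\<lambda>s. \<phi> (gam s) * gam' s) has_integral contour_integral gam \<phi>) {0..1}"
proof -
  have "(\<lambda>s. \<phi> (gam s) * gam' s) integrable_on {0..1}"
    by (intro integrable_continuous_real continuous_intros continuous_on_gam assms gam'_cont)
  then obtain i where i: "((\<lambda>s. \<phi> (gam s) * gam' s) has_integral i) {0..1}" by blast
  have "(\<phi> has_contour_integral i) gam"
    unfolding has_contour_integral_def
    by (rule has_integral_eq[OF _ i])
       (use vector_derivative_within_closed_interval[OF _ _ gam_deriv] in auto)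
  with i show ?thesis by (simp add: contour_integral_unique)
qed

lemma has_vector_derivative_gam:
  assumes "open A" "path_image gam \<subseteq> A" "w holomorphic_on A" "s \<in> {0..1}"
  shows "((\<lambda>s. w (gam s)) has_vector_derivative deriv w (gam s) * gam' s) (at s within {0..1})"
proof -
  have "(w has_field_derivative deriv w (gam s)) (at (gam s) within gam ` {0..1})"
    by (rule has_field_derivative_at_within, rule holomorphic_derivI[OF assms(3,1)])
       (use assms(2) gam_in[OF assms(4)] in blast)
  from field_vector_diff_chain_within[OF gam_deriv[OF assms(4)] this]
  show ?thesis by (simp add: o_def mult.commute)
qed

text \<open>\<open>2 \<pi> \<i>\<close> times the winding number about 0 of the image of the loop under \<open>w\<close>.\<close>

definition log_integral :: "(complex \<Rightarrow> complex) \<Rightarrow> complex" where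
  "log_integral w = contour_integral gam (\<lambda>z. deriv w z / w z)"

lemma continuous_log_deriv:
  assumes "open A" "path_image gam \<subseteq> A" "w holomorphic_on A" "\<And>z. z \<in> path_image gam \<Longrightarrow> w z \<noteq> 0"
  shows "continuous_on (path_image gam) (\<lambda>z. deriv w z / w z)"
proof -
  have "deriv w holomorphic_on A" using assms by (intro holomorphic_deriv)
  then show ?thesis
    using assms by (intro continuous_intros) (auto intro: continuous_on_subset holomorphic_on_imp_continuous_on)
qed

lemma log_integral_mult:
  assumes A: "open A" "path_image gam \<subseteq> A"
    and w: "w holomorphic_on A" "\<And>z. z \<in> path_image gam \<Longrightarrow> w z \<noteq> 0"
    and v: "v holomorphic_on A" "\<And>z. z \<in> path_image gam \<Longrightarrow> v z \<noteq> 0"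
  shows "log_integral (\<lambda>z. w z * v z) = log_integral w + log_integral v"
proof -
  have "contour_integral gam (\<lambda>z. deriv (\<lambda>z. w z * v z) z / (w z * v z)) =
     contour_integral gam (\<lambda>z. deriv w z / w z + deriv v z / v z)"
  proof (rule contour_integral_cong[OF refl])
    fix z assume z: "z \<in> path_image gam"
    have "(w has_field_derivative deriv w z) (at z)" "(v has_field_derivative deriv v z) (at z)"
      using A w v z by (auto intro: holomorphic_derivI)
    from DERIV_imp_deriv[OF DERIV_mult[OF this]]
    show "deriv (\<lambda>z. w z * v z) z / (w z * v z) = deriv w z / w z + deriv v z / v z"
      using w(2)[OF z] v(2)[OF z] by (simp add: field_simps)
  qed
  also have "\<dots> = log_integral w + log_integral v"
    unfolding log_integral_def
  proof (rule has_integral_unique)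
    show "((\<lambda>s. (deriv w (gam s) / w (gam s) + deriv v (gam s) / v (gam s)) * gam' s) has_integral
        contour_integral gam (\<lambda>z. deriv w z / w z + deriv v z / v z)) {0..1}"
      by (rule has_integral_contour[OF continuous_on_add[OF continuous_log_deriv[OF A w] continuous_log_deriv[OF A v]]])
    show "((\<lambda>s. (deriv w (gam s) / w (gam s) + deriv v (gam s) / v (gam s)) * gam' s) has_integral
        contour_integral gam (\<lambda>z. deriv w z / w z) + contour_integral gam (\<lambda>z. deriv v z / v z)) {0..1}"
      unfolding distrib_right
      by (intro has_integral_add has_integral_contour continuous_log_deriv[OF A w] continuous_log_deriv[OF A v])
  qed
  finally show ?thesis by (simp add: log_integral_def)
qed

text \<open>The geometric phase of \<open>(1, q)\<close> along the loop.\<close>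

definition slope_phase :: "(complex \<Rightarrow> complex) \<Rightarrow> real" where
  "slope_phase q = 1 / (2 * pi) * integral {0..1} (\<lambda>s. Im (deriv q (gam s) * gam' s * cnj (q (gam s))) / (1 + (norm (q (gam s)))\<^sup>2))"

text \<open>Writing a path of vectors as a scalar \<open>w\<close> times \<open>(1, q)\<close> splits its phase: with \<open>u = w (1, q)\<close>,
  \<open>\<langle>u', u\<rangle> / \<langle>u, u\<rangle> = w' / w + q' (cnj q) / (1 + |q|\<^sup>2)\<close>. Loops of eigenvectors for the same eigenvalue
  share \<open>q\<close>, so their phases differ only by winding numbers.\<close>

lemma GP_line:
  fixes u :: "real \<Rightarrow> complex^2"
  assumes A: "open A" "path_image gam \<subseteq> A"
    and w: "w holomorphic_on A" "\<And>z. z \<in> path_image gam \<Longrightarrow> w z \<noteq> 0" and q: "q holomorphic_on A"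
    and u: "\<And>s. s \<in> {0..1} \<Longrightarrow> u s $ 1 = w (gam s)" "\<And>s. s \<in> {0..1} \<Longrightarrow> u s $ 2 = q (gam s) * w (gam s)"
  shows "GP u = Im (log_integral w) / (2 * pi) + slope_phase q"
proof -
  define Q where "Q = (\<lambda>s. Im (deriv q (gam s) * gam' s * cnj (q (gam s))) / (1 + (norm (q (gam s)))\<^sup>2))"
  define l where "l = (\<lambda>s. deriv w (gam s) / w (gam s) * gam' s)"
  have "GP u = 1 / (2 * pi) * integral {0..1} (\<lambda>s.
     Im (deriv w (gam s) * gam' s * cnj (w (gam s)) +
         (q (gam s) * (deriv w (gam s) * gam' s) + deriv q (gam s) * gam' s * w (gam s)) * cnj (q (gam s) * w (gam s))) /
     Re (w (gam s) * cnj (w (gam s)) + q (gam s) * w (gam s) * cnj (q (gam s) * w (gam s))))"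
    by (rule GP_eq[OF u]) (intro has_vector_derivative_mult has_vector_derivative_gam[OF A] w q | assumption)+
  also have "\<dots> = 1 / (2 * pi) * integral {0..1} (\<lambda>s. Im (l s) + Q s)"
  proof (intro arg_cong2[where f = "(*)"] refl integral_cong)
    fix s :: real assume s: "s \<in> {0..1}"
    let ?w = "w (gam s)" and ?q = "q (gam s)" and ?w' = "deriv w (gam s) * gam' s" and ?q' = "deriv q (gam s) * gam' s"
    have w0: "?w \<noteq> 0" using w(2) gam_in[OF s] .
    have pos: "1 + (norm ?q)\<^sup>2 > 0" by (smt (verit) zero_le_power2)
    have eq: "?w' * cnj ?w + (?q * ?w' + ?q' * ?w) * cnj (?q * ?w) =
        of_real ((norm ?w)\<^sup>2) * (of_real (1 + (norm ?q)\<^sup>2) * l s + ?q' * cnj ?q)"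
    proof -
      have n: "complex_of_real ((norm z)\<^sup>2) = z * cnj z" for z by (simp add: complex_mult_cnj cmod_power2)
      have e: "?w' = ?w * l s" using w0 by (simp add: l_def)
      show ?thesis unfolding e of_real_add of_real_1 n by (simp add: algebra_simps)
    qed
    have Im_scale: "Im (of_real a * (of_real b * z + y)) = a * (b * Im z + Im y)" for a b z y by simp
    have "Im (?w' * cnj ?w + (?q * ?w' + ?q' * ?w) * cnj (?q * ?w)) =
       (norm ?w)\<^sup>2 * ((1 + (norm ?q)\<^sup>2) * Im (l s) + Im (?q' * cnj ?q))"
      unfolding eq by (rule Im_scale)
    moreover have "Re (?w * cnj ?w + ?q * ?w * cnj (?q * ?w)) = (norm ?w)\<^sup>2 * (1 + (norm ?q)\<^sup>2)"
    proof -
      have n: "z * cnj z = complex_of_real ((norm z)\<^sup>2)" for z by (simp add: complex_mult_cnj cmod_power2)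
      show ?thesis unfolding n by (simp add: norm_mult power_mult_distrib algebra_simps)
    qed
    moreover have "(norm ?w)\<^sup>2 \<noteq> 0" using w0 by simp
    ultimately show "Im (?w' * cnj ?w + (?q * ?w' + ?q' * ?w) * cnj (?q * ?w)) /
        Re (?w * cnj ?w + ?q * ?w * cnj (?q * ?w)) = Im (l s) + Q s"
      using pos by (simp add: Q_def add_divide_distrib)
  qed
  also have "integral {0..1} (\<lambda>s. Im (l s) + Q s) = Im (log_integral w) + integral {0..1} Q"
  proof -
    have "((\<lambda>s. Im (l s)) has_integral Im (log_integral w)) {0..1}"
      unfolding l_def log_integral_def
      using has_integral_linear[OF has_integral_contour[OF continuous_log_deriv[OF A w]] bounded_linear_Im]
      by (simp add: o_def)
    moreover have "continuous_on {0..1} Q"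
    proof -
      have c: "continuous_on {0..1} (\<lambda>s. q (gam s))" "continuous_on {0..1} (\<lambda>s. deriv q (gam s))"
        using holomorphic_on_imp_continuous_on[OF q] holomorphic_on_imp_continuous_on[OF holomorphic_deriv[OF q A(1)]] A(2)
        by (auto intro!: continuous_on_gam intro: continuous_on_subset)
      have "1 + (norm (q (gam s)))\<^sup>2 \<noteq> 0" for s by (smt (verit) zero_le_power2)
      then show ?thesis unfolding Q_def by (intro continuous_intros c gam'_cont) auto
    qed
    then have "(Q has_integral integral {0..1} Q) {0..1}" by (intro integrable_integral integrable_continuous_real)
    ultimately show ?thesis by (intro integral_unique has_integral_add)
  qed
  finally show ?thesis unfolding slope_phase_def Q_def[symmetric] by (simp add: field_simps)
qed

text \<open>Cauchy's inequality on discs of a common radius around the points of \<open>K\<close>.\<close>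

lemma uniform_limit_deriv_on_compact:
  assumes A: "open A" and K: "compact K" "K \<subseteq> A"
    and hol: "\<And>x::real. F x holomorphic_on A" "G holomorphic_on A" and lim: "uniform_limit A F G at_top"
  shows "uniform_limit K (\<lambda>x. deriv (F x)) (deriv G) at_top"
proof (rule uniform_limitI)
  fix e :: real assume e: "e > 0"
  obtain r where r: "r > 0" "(\<Union>z\<in>K. cball z r) \<subseteq> A"
    by (rule compact_subset_open_imp_cball_epsilon_subset[OF K(1) A K(2)])
  have "e * r / 2 > 0" using e r by simp
  from uniform_limitD[OF lim this]
  show "\<forall>\<^sub>F x in at_top. \<forall>z\<in>K. dist (deriv (F x) z) (deriv G z) < e"
  proof (elim eventually_mono, intro ballI)
    fix x z assume *: "\<forall>z\<in>A. dist (F x z) (G z) < e * r / 2" and z: "z \<in> K"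
    have sub: "cball z r \<subseteq> A" using r z by blast
    have h: "(\<lambda>z. F x z - G z) holomorphic_on A" by (intro holomorphic_intros hol)
    have "norm ((deriv ^^ 1) (\<lambda>z. F x z - G z) z) \<le> fact 1 * (e * r / 2) / r ^ 1"
    proof (rule Cauchy_inequality)
      show "(\<lambda>z. F x z - G z) holomorphic_on ball z r" using h sub ball_subset_cball by (blast intro: holomorphic_on_subset)
      show "continuous_on (cball z r) (\<lambda>z. F x z - G z)" using h sub holomorphic_on_imp_continuous_on continuous_on_subset by blast
      show "norm (F x y - G y) \<le> e * r / 2" if "norm (z - y) = r" for y
      proof -
        have "y \<in> A" using sub that by (auto simp: dist_norm)
        then show ?thesis using * by (auto simp: dist_norm intro: less_imp_le)
      qed
    qed (rule r)
    moreover have "(deriv ^^ 1) (\<lambda>z. F x z - G z) z = deriv (F x) z - deriv G z"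
      using hol A K z by (auto intro!: deriv_diff holomorphic_on_imp_differentiable_at)
    ultimately show "dist (deriv (F x) z) (deriv G z) < e" using r e by (simp add: dist_norm)
  qed
qed

text \<open>The integrand of the phase is a quotient of polynomials in the components, their derivatives and
  conjugates. All of these converge uniformly along the loop, and the denominator of the limit is
  bounded below by compactness.\<close>

lemma GP_uniform_limit:
  fixes u :: "real \<Rightarrow> real \<Rightarrow> complex^2" and v :: "real \<Rightarrow> complex^2" and F1 F2 :: "real \<Rightarrow> complex \<Rightarrow> complex"
  assumes A: "open A" "path_image gam \<subseteq> A"
    and hol: "\<And>x. F1 x holomorphic_on A" "\<And>x. F2 x holomorphic_on A" "G1 holomorphic_on A" "G2 holomorphic_on A"
    and lim: "uniform_limit A F1 G1 at_top" "uniform_limit A F2 G2 at_top"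
    and F_nz: "\<And>x z. z \<in> path_image gam \<Longrightarrow> F1 x z \<noteq> 0 \<or> F2 x z \<noteq> 0"
    and G_nz: "\<And>z. z \<in> path_image gam \<Longrightarrow> G1 z \<noteq> 0 \<or> G2 z \<noteq> 0"
    and u: "\<And>x s. s \<in> {0..1} \<Longrightarrow> u x s $ 1 = F1 x (gam s)" "\<And>x s. s \<in> {0..1} \<Longrightarrow> u x s $ 2 = F2 x (gam s)"
    and v: "\<And>s. s \<in> {0..1} \<Longrightarrow> v s $ 1 = G1 (gam s)" "\<And>s. s \<in> {0..1} \<Longrightarrow> v s $ 2 = G2 (gam s)"
  shows "((\<lambda>x. GP (u x)) \<longlongrightarrow> GP v) at_top"
proof -
  let ?I = "{0..1::real}"
  define num where "num = (\<lambda>F G s. Im (deriv F (gam s) * gam' s * cnj (F (gam s)) + deriv G (gam s) * gam' s * cnj (G (gam s))))"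
  define den where "den = (\<lambda>F G s. Re (F (gam s) * cnj (F (gam s)) + G (gam s) * cnj (G (gam s))))"
  have den_pos: "den F G s > 0" if "F (gam s) \<noteq> 0 \<or> G (gam s) \<noteq> 0" for F G s
  proof -
    have "den F G s = (norm (F (gam s)))\<^sup>2 + (norm (G (gam s)))\<^sup>2"
      unfolding den_def cmod_power2 by (simp add: power2_eq_square)
    then show ?thesis using that by (auto simp: add_pos_nonneg add_nonneg_pos)
  qed
  have K: "compact (path_image gam)" by (rule compact_path_image[OF gam_path])
  have cont: "continuous_on ?I (\<lambda>s. h (gam s))" "continuous_on ?I (\<lambda>s. deriv h (gam s))" if "h holomorphic_on A" for h
    using holomorphic_on_imp_continuous_on[OF that] holomorphic_on_imp_continuous_on[OF holomorphic_deriv[OF that A(1)]] A(2)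
    by (auto intro!: continuous_on_gam intro: continuous_on_subset)
  have bdd: "bounded (h ` ?I)" if "continuous_on ?I h" for h :: "real \<Rightarrow> 'a::metric_space"
    using that by (intro compact_imp_bounded compact_continuous_image) auto
  have cn: "continuous_on ?I (num F G)" and cd: "continuous_on ?I (den F G)"
    if "F holomorphic_on A" "G holomorphic_on A" for F G
    unfolding num_def den_def by (intro continuous_intros cont that gam'_cont)+
  have GP_pair: "GP y = 1 / (2 * pi) * integral ?I (\<lambda>s. num F G s / den F G s)"
    if "F holomorphic_on A" "G holomorphic_on A" "\<And>s. s \<in> ?I \<Longrightarrow> y s $ 1 = F (gam s)" "\<And>s. s \<in> ?I \<Longrightarrow> y s $ 2 = G (gam s)"
    for y :: "real \<Rightarrow> complex^2" and F G
    unfolding num_def den_def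
    by (rule GP_eq[OF that(3,4)]) (auto intro!: has_vector_derivative_gam[OF A] that)
  define f where "f = (\<lambda>x s. num (F1 x) (F2 x) s / den (F1 x) (F2 x) s)"
  define f0 where "f0 = (\<lambda>s. num G1 G2 s / den G1 G2 s)"
  have cont_f: "continuous_on ?I (f x)" for x
    unfolding f_def
  proof (rule continuous_on_divide[OF cn[OF hol(1,2)] cd[OF hol(1,2)]], rule ballI)
    fix s assume "s \<in> ?I"
    from den_pos[of "F1 x" s "F2 x"] F_nz[OF gam_in[OF this], of x]
    show "den (F1 x) (F2 x) s \<noteq> 0" by simp
  qed
  have g_in: "gam \<in> ?I \<rightarrow> A" "gam \<in> ?I \<rightarrow> path_image gam" using A(2) gam_in by auto
  have l: "uniform_limit ?I (\<lambda>x s. F1 x (gam s)) (\<lambda>s. G1 (gam s)) at_top"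
     "uniform_limit ?I (\<lambda>x s. F2 x (gam s)) (\<lambda>s. G2 (gam s)) at_top"
     "uniform_limit ?I (\<lambda>x s. deriv (F1 x) (gam s)) (\<lambda>s. deriv G1 (gam s)) at_top"
     "uniform_limit ?I (\<lambda>x s. deriv (F2 x) (gam s)) (\<lambda>s. deriv G2 (gam s)) at_top"
    by (rule uniform_limit_compose'[OF lim(1) g_in(1)] uniform_limit_compose'[OF lim(2) g_in(1)]
        uniform_limit_compose'[OF uniform_limit_deriv_on_compact[OF A(1) K A(2) hol(1,3) lim(1)] g_in(2)]
        uniform_limit_compose'[OF uniform_limit_deriv_on_compact[OF A(1) K A(2) hol(2,4) lim(2)] g_in(2)])+
  have lcnj: "uniform_limit ?I (\<lambda>x s. cnj (F1 x (gam s))) (\<lambda>s. cnj (G1 (gam s))) at_top"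
     "uniform_limit ?I (\<lambda>x s. cnj (F2 x (gam s))) (\<lambda>s. cnj (G2 (gam s))) at_top"
    by (intro bounded_linear.uniform_limit[OF bounded_linear_cnj] l)+
  have l_num: "uniform_limit ?I (\<lambda>x s. num (F1 x) (F2 x) s) (num G1 G2) at_top"
    unfolding num_def
    by (intro bounded_linear.uniform_limit[OF bounded_linear_Im] uniform_limit_add uniform_lim_mult l lcnj uniform_limit_const
        bdd continuous_intros cont hol gam'_cont)
  have l_den: "uniform_limit ?I (\<lambda>x s. den (F1 x) (F2 x) s) (den G1 G2) at_top"
    unfolding den_def
    by (intro bounded_linear.uniform_limit[OF bounded_linear_Re] uniform_limit_add uniform_lim_mult l lcnj
        bdd continuous_intros cont hol)
  obtain s0 where s0: "s0 \<in> ?I" "\<And>s. s \<in> ?I \<Longrightarrow> den G1 G2 s0 \<le> den G1 G2 s"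
    using continuous_attains_inf[OF compact_Icc _ cd[OF hol(3,4)]] by auto
  have ul: "uniform_limit ?I f f0 at_top"
    unfolding f_def f0_def
  proof (rule uniform_lim_divide[OF l_num l_den])
    show "bounded (num G1 G2 ` ?I)" by (rule bdd[OF cn[OF hol(3,4)]])
    show "den G1 G2 s0 > 0" using den_pos[of G1 s0 G2] G_nz[OF gam_in[OF s0(1)]] by simp
    show "den G1 G2 s0 \<le> norm (den G1 G2 s)" if "s \<in> ?I" for s using s0(2)[OF that] by simp
  qed
  obtain I J where IJ: "\<And>n. (f n has_integral I n) ?I" "(f0 has_integral J) ?I" "(I \<longlongrightarrow> J) at_top"
    by (rule uniform_limit_integral[OF ul cont_f]) auto
  have "((\<lambda>x. integral ?I (f x)) \<longlongrightarrow> integral ?I f0) at_top"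
    using IJ(3) unfolding integral_unique[OF IJ(1)] integral_unique[OF IJ(2)] .
  note L = this
  have GPu: "GP (u x) = 1 / (2 * pi) * integral ?I (f x)" for x
    unfolding f_def by (rule GP_pair[OF hol(1,2) u])
  have GPv: "GP v = 1 / (2 * pi) * integral ?I f0"
    unfolding f0_def by (rule GP_pair[OF hol(3,4) v])
  show ?thesis unfolding GPu GPv by (rule tendsto_mult_left[OF L])
qed

lemma inside_props:
  shows "open (inside (path_image gam))" "connected (inside (path_image gam))"
    "inside (path_image gam) \<noteq> {}" "compact (path_image gam \<union> inside (path_image gam))"
    "connected (- (path_image gam \<union> inside (path_image gam)))"
    "\<And>z. z \<notin> path_image gam \<Longrightarrow> z \<notin> inside (path_image gam) \<Longrightarrow> z \<in> outside (path_image gam)"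
proof -
  note J = Jordan_inside_outside[OF simple loop]
  show "open (inside (path_image gam))" "connected (inside (path_image gam))" "inside (path_image gam) \<noteq> {}"
    using J by auto
  have J': "inside (path_image gam) \<inter> outside (path_image gam) = {}"
    "inside (path_image gam) \<union> outside (path_image gam) = - path_image gam" using J by simp_all
  have eq: "- (path_image gam \<union> inside (path_image gam)) = outside (path_image gam)" using J' by blast
  show "connected (- (path_image gam \<union> inside (path_image gam)))" unfolding eq using J by auto
  have "closed (path_image gam \<union> inside (path_image gam))" unfolding closed_def eq using J by auto
  moreover have "bounded (path_image gam \<union> inside (path_image gam))"
    using J bounded_path_image[OF gam_path] by auto
  ultimately show "compact (path_image gam \<union> inside (path_image gam))" by (simp add: compact_eq_bounded_closed)
  show "z \<in> outside (path_image gam)" if "z \<notin> path_image gam" "z \<notin> inside (path_image gam)" for z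
    using eq that by blast
qed

text \<open>The loop together with its inside is a compact set with connected complement, so by Borsuk's theorem
  the nowhere vanishing extension \<open>e\<close> has a continuous logarithm on it. Along the loop, \<open>w\<close> is then the
  exponential of a closed path, and this is contractible in the punctured plane.\<close>

lemma log_integral_zero:
  assumes A: "open A" "path_image gam \<subseteq> A"
    and w: "w holomorphic_on A" "\<And>z. z \<in> path_image gam \<Longrightarrow> w z \<noteq> 0"
    and ext: "continuous_on (path_image gam \<union> inside (path_image gam)) e"
      "\<And>z. z \<in> path_image gam \<union> inside (path_image gam) \<Longrightarrow> e z \<noteq> 0"
      "\<And>z. z \<in> path_image gam \<Longrightarrow> e z = w z"
  shows "log_integral w = 0"
proof -
  let ?C = "path_image gam \<union> inside (path_image gam)"
  have bor: "Borsukian ?C" unfolding Borsukian_separation_compact[OF inside_props(4)] by (rule inside_props(5))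
  have "\<exists>h. continuous_on ?C h \<and> (\<forall>z\<in>?C. e z = exp (h z))"
    by (rule bor[unfolded Borsukian_continuous_logarithm, rule_format]) (use ext(1,2) in auto)
  then obtain h where h: "continuous_on ?C h" "\<And>z. z \<in> ?C \<Longrightarrow> e z = exp (h z)" by blast
  have an: "w analytic_on path_image gam" using A w(1) analytic_on_open analytic_on_subset by blast
  have hol_nbhd: "valid_path (w \<circ> gam)" by (rule valid_path_compose_analytic[OF gam_valid an]) simp
  have nz: "0 \<notin> path_image (w \<circ> gam)" using w(2) by (auto simp: path_image_def)
  have hp: "path (h \<circ> gam)" using h(1) by (intro path_continuous_image gam_path) (auto intro: continuous_on_subset)
  let ?a = "h (gam 0)"
  have "homotopic_loops UNIV (h \<circ> gam) (\<lambda>_. ?a)"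
    by (rule homotopic_loops_linear) (use hp loop in \<open>auto simp: pathfinish_def pathstart_def path_def\<close>)
  then have hom: "homotopic_loops (- {0}) (exp \<circ> (h \<circ> gam)) (exp \<circ> (\<lambda>_. ?a))"
    by (rule homotopic_loops_continuous_image) (auto intro!: continuous_intros)
  have "homotopic_loops (- {0}) (w \<circ> gam) (exp \<circ> (h \<circ> gam))"
    by (rule homotopic_loops_eq)
       (use h(2) ext(3) gam_in nz valid_path_imp_path[OF hol_nbhd] loop in \<open>auto simp: pathfinish_def pathstart_def\<close>)
  from homotopic_loops_trans[OF this hom]
  have "\<exists>a. homotopic_loops (- {0}) (w \<circ> gam) (\<lambda>_. a)" by (auto simp: o_def)
  then have "winding_number (w \<circ> gam) 0 = 0"
    using winding_number_homotopic_loops_null_eq[OF valid_path_imp_path[OF hol_nbhd] nz] by blast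
  then have "contour_integral (w \<circ> gam) (\<lambda>z. 1 / (z - 0)) = 0"
    using winding_number_valid_path[OF hol_nbhd nz] by simp
  then show ?thesis
    using contour_integral_comp_analyticW[OF an gam_valid order.refl, of "\<lambda>z. 1 / z"]
    by (simp add: log_integral_def)
qed

text \<open>The argument principle requires a domain with finitely many zeros. \<open>D\<close> may have infinitely many
  zeros in \<open>Om\<close>; the domain \<open>S\<close> keeps only those inside the loop.\<close>

lemma log_integral_zeros:
  assumes Om: "open Om" "simply_connected Om" "path_image gam \<subseteq> Om"
    and D: "D holomorphic_on Om" "\<And>z. z \<in> path_image gam \<Longrightarrow> D z \<noteq> 0"
    and orient: "positively_oriented gam"
  shows "inside (path_image gam) \<subseteq> Om" "finite {z \<in> inside (path_image gam). D z = 0}"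
    "log_integral D = 2 * pi * \<i> * (\<Sum>z | z \<in> inside (path_image gam) \<and> D z = 0. of_int (zorder D z))"
proof -
  let ?K = "path_image gam"
  have conn: "connected Om" by (rule simply_connected_imp_connected[OF Om(2)])
  show sub: "inside ?K \<subseteq> Om"
  proof
    fix z assume z: "z \<in> inside ?K"
    have "winding_number gam z = 1" using orient z by (auto simp: positively_oriented_def)
    then show "z \<in> Om" using simply_connected_imp_winding_number_zero[OF Om(2) gam_path Om(3) loop, of z] by auto
  qed
  have ncon: "\<not> D constant_on Om" if "\<exists>z\<in>Om. D z = 0"
  proof
    assume "D constant_on Om"
    then obtain k where k: "\<And>z. z \<in> Om \<Longrightarrow> D z = k" by (auto simp: constant_on_def)
    have "gam 0 \<in> ?K" by (intro gam_in) auto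
    then show False using that k D(2) Om(3) by (metis subsetD)
  qed
  have finC: "finite {z \<in> ?K \<union> inside ?K. D z = 0}"
  proof (cases "\<exists>z\<in>Om. D z = 0")
    case True
    show ?thesis
      by (rule holomorphic_compact_finite_zeros[OF D(1) Om(1) conn inside_props(4) _ ncon[OF True]]) (use sub Om(3) in auto)
  next
    case False
    then have "{z \<in> ?K \<union> inside ?K. D z = 0} = {}" using sub Om(3) by auto
    then show ?thesis by (simp only: finite.emptyI)
  qed
  then show fin: "finite {z \<in> inside ?K. D z = 0}" by (rule rev_finite_subset) auto
  have cnt: "countable {z \<in> Om. D z = 0}"
  proof (cases "\<exists>z\<in>Om. D z = 0")
    case True
    obtain F :: "nat \<Rightarrow> complex set" where F: "\<And>n. compact (F n)" "\<And>n. F n \<subseteq> Om" "\<Union>(range F) = Om"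
      by (rule open_Union_compact_subsets[OF Om(1)]) blast
    have "finite {z \<in> F n. D z = 0}" for n
      by (rule holomorphic_compact_finite_zeros[OF D(1) Om(1) conn F(1) F(2) ncon[OF True]])
    then have "countable (\<Union>n. {z \<in> F n. D z = 0})" by (intro countable_UN) (auto intro: countable_finite)
    also have "(\<Union>n. {z \<in> F n. D z = 0}) = {z \<in> Om. D z = 0}" using F(3) by auto
    finally show ?thesis .
  next
    case False
    then have "{z \<in> Om. D z = 0} = {}" by auto
    then show ?thesis by (simp only: countable_empty)
  qed
  define R where "R = Om - {z \<in> Om. D z = 0}"
  define S where "S = R \<union> inside ?K"
  have R_eq: "R = Om \<inter> D -` (- {0})" by (auto simp: R_def)
  have R_open: "open R" unfolding R_eq
    by (rule continuous_open_preimage[OF holomorphic_on_imp_continuous_on[OF D(1)] Om(1)]) auto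
  have R_conn: "connected R" unfolding R_def by (rule connected_open_diff_countable[OF _ Om(1) conn cnt]) simp
  have "infinite (inside ?K)"
    using inside_props(1,3) finite_imp_not_open by blast
  then have "\<not> inside ?K \<subseteq> {z \<in> inside ?K. D z = 0}" using fin finite_subset by blast
  then have meet: "R \<inter> inside ?K \<noteq> {}" using sub by (auto simp: R_def)
  have S: "open S" "connected S"
    unfolding S_def using R_open R_conn inside_props(1,2) meet by (auto intro: connected_Un)
  have S_sub: "S \<subseteq> Om" using sub by (auto simp: S_def R_def)
  have pz: "{w \<in> S. D w = 0 \<or> w \<in> {}} = {z \<in> inside ?K. D z = 0}" by (auto simp: S_def R_def)
  have K_S: "?K \<subseteq> S - {w \<in> S. D w = 0 \<or> w \<in> {}}" using D(2) Om(3) by (auto simp: S_def R_def)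
  have "contour_integral gam (\<lambda>x. deriv D x * 1 / D x) =
      2 * pi * \<i> * (\<Sum>p\<in>{w \<in> S. D w = 0 \<or> w \<in> {}}. winding_number gam p * 1 * of_int (zorder D p))"
  proof (rule argument_principle[OF S _ _ gam_valid loop K_S])
    show "D holomorphic_on S - {}" using D(1) S_sub by (auto intro: holomorphic_on_subset)
    show "\<forall>z. z \<notin> S \<longrightarrow> winding_number gam z = 0"
    proof (intro allI impI)
      fix z assume "z \<notin> S"
      then have "z \<notin> ?K" "z \<notin> inside ?K" using K_S by (auto simp: S_def)
      then have "z \<in> outside ?K" by (rule inside_props(6))
      then show "winding_number gam z = 0" by (rule winding_number_zero_in_outside[OF gam_path loop])
    qed
    show "finite {w \<in> S. D w = 0 \<or> w \<in> {}}" unfolding pz by (rule fin)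
  qed auto
  also have "(\<Sum>p\<in>{w \<in> S. D w = 0 \<or> w \<in> {}}. winding_number gam p * 1 * of_int (zorder D p)) =
      (\<Sum>z | z \<in> inside ?K \<and> D z = 0. of_int (zorder D z))"
    unfolding pz by (rule sum.cong) (use orient in \<open>auto simp: positively_oriented_def\<close>)
  finally show "log_integral D = 2 * pi * \<i> * (\<Sum>z | z \<in> inside ?K \<and> D z = 0. of_int (zorder D z))"
    by (simp add: log_integral_def)
qed

end

section \<open>Multiplicities and the asymptotic phase\<close>

context pulse_operator
begin

lemma q_Lipschitz: "norm (q lam s - q lam t) \<le> Lg * \<bar>s - t\<bar>"
  using g_lip[of s t] by (simp add: q_def)

lemma q_BUC: "q lam \<in> BUC"
  using q_bounded[of lam] lipschitz_real_imp_uniformly_continuous[OF q_Lipschitz]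
  by (auto simp: BUC_def bounded_iff)

text \<open>The order of a zero as the index of the first nonvanishing Taylor coefficient; it exists because
  \<open>evans\<close> is not identically zero on the connected set \<open>Omega\<close>.\<close>

lemma evans_order:
  assumes "connected Omega" "lam0 \<in> Omega" "\<exists>z\<in>Omega. evans z \<noteq> 0"
  obtains m where "\<And>i. i < m \<Longrightarrow> taylor i evans lam0 = 0" "taylor m evans lam0 \<noteq> 0" "zorder evans lam0 = int m"
    "evans lam0 = 0 \<longleftrightarrow> m > 0"
proof -
  have "\<exists>n. (deriv ^^ n) evans lam0 \<noteq> 0"
    using holomorphic_fun_eq_0_on_connected[OF evans_holomorphic Omega_open assms(1) _ assms(2)] assms(3) by blast
  define m where "m = (LEAST n. (deriv ^^ n) evans lam0 \<noteq> 0)"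
  have m: "(deriv ^^ m) evans lam0 \<noteq> 0"
    unfolding m_def by (rule LeastI_ex) fact
  have lt: "(deriv ^^ i) evans lam0 = 0" if "i < m" for i
    using not_less_Least[of i "\<lambda>n. (deriv ^^ n) evans lam0 \<noteq> 0"] that by (auto simp: m_def)
  show ?thesis
  proof (rule that[of m])
    show "zorder evans lam0 = int m"
      using evans_holomorphic Omega_open assms(2) m lt
      by (intro zorder_zero_eqI') (auto simp: analytic_at)
    show "evans lam0 = 0 \<longleftrightarrow> m > 0" using m lt[of 0] by (cases m) auto
  qed (use m lt in \<open>auto simp: taylor_def\<close>)
qed

text \<open>Where \<open>evans\<close> vanishes, \<open>ym\<close> is a multiple of \<open>yp\<close> and therefore decays at both ends. Applied on a
  loop in the resolvent set, this shows that \<open>evans\<close> is not identically zero, from which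
  \<open>eigenvalue_multiplicity\<close> starts.\<close>

lemma evans_zero_eigenvalue:
  assumes lam: "lam \<in> Omega" and z: "evans lam = 0"
    and pot: "\<And>x. of_real (deriv f (U x)) - lam = q lam x"
  shows "lam \<in> eigenvalues_L c f U"
proof -
  have q_eq: "q lam = (\<lambda>x. of_real (deriv f (U x)) - lam)" by (simp add: pot fun_eq_iff)
  obtain x0 where x0: "yp lam x0 \<noteq> 0" using yp_nonzero[OF lam] .
  have "yp lam x0 * ym' lam x0 - yp' lam x0 * ym lam x0 = 0"
    using wronskian_evans[OF lam, of x0] z by (simp add: algebra_simps)
  then obtain k where k: "\<And>x. ym lam x = k * yp lam x" "\<And>x. ym' lam x = k * yp' lam x"
    using lin2_proportional[OF yp_lin2[OF lam] ym_lin2[OF lam] q_bounded] x0 by metis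
  from local_bounds[OF lam] obtain r M \<delta> where r: "r > 0" "\<delta> > 0" "M > 0"
    and ymb: "\<And>l x. l \<in> cball lam r \<Longrightarrow> x \<le> 0 \<Longrightarrow> norm (ym l x) \<le> M * exp (\<delta> * x) \<and> norm (ym' l x) \<le> M * exp (\<delta> * x)"
    and ypb: "\<And>l x. l \<in> cball lam r \<Longrightarrow> x \<ge> 0 \<Longrightarrow> norm (yp l x) \<le> M * exp (- \<delta> * x) \<and> norm (yp' l x) \<le> M * exp (- \<delta> * x)"
    by metis
  have lr: "lam \<in> cball lam r" using r by simp
  define B where "B = max M (norm k * M)"
  have bd: "norm (ym lam x) \<le> B \<and> norm (ym' lam x) \<le> B" for x
  proof (cases "x \<le> 0")
    case True
    have "M * exp (\<delta> * x) \<le> M * 1" using r True by (intro mult_left_mono) (auto simp: mult_le_0_iff)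
    with ymb[OF lr True] show ?thesis by (auto simp: B_def)
  next
    case False
    then have x: "x \<ge> 0" by simp
    have "M * exp (- \<delta> * x) \<le> M * 1" using r x by (intro mult_left_mono) auto
    with ypb[OF lr x] have "norm (yp lam x) \<le> M" "norm (yp' lam x) \<le> M" by auto
    then have "norm (ym lam x) \<le> norm k * M" "norm (ym' lam x) \<le> norm k * M"
      unfolding k norm_mult by (auto intro!: mult_left_mono)
    then show ?thesis by (auto simp: B_def)
  qed
  have lin: "lin2 (of_real c) (\<lambda>x. of_real (deriv f (U x)) - lam) (\<lambda>x. 0) (ym lam) (ym' lam)"
    using ym_lin2[OF lam] unfolding q_eq .
  have "ym lam \<in> dom_L" "L_shift c f U lam (ym lam) = (\<lambda>x. 0)"
    using lin2_dom_L[OF lin conjunct1[OF bd] conjunct2[OF bd] BUC_zero q_BUC[of lam, unfolded q_eq]] by auto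
  moreover have "ym lam \<noteq> (\<lambda>x. 0)" using ym_nonzero[OF lam] by (metis (full_types))
  ultimately show ?thesis unfolding eigenvalues_L_def
    by (auto intro!: bexI[of _ "ym lam"] simp: L_shift_def fun_eq_iff)
qed

lemma eigenvalue_multiplicity:
  assumes "connected Omega" "\<exists>z\<in>Omega. evans z \<noteq> 0" and lam: "lam \<in> Omega"
    and pot: "\<And>x. of_real (deriv f (U x)) - lam = q lam x"
  shows "lam \<in> eigenvalues_L c f U \<longleftrightarrow> evans lam = 0" "int (alg_mult c f U lam) = zorder evans lam"
proof -
  obtain m where m: "\<And>i. i < m \<Longrightarrow> taylor i evans lam = 0" "taylor m evans lam \<noteq> 0" "zorder evans lam = int m"
    "evans lam = 0 \<longleftrightarrow> m > 0"
    using evans_order[OF assms(1) lam assms(2)] by metis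
  have q_eq: "q lam = (\<lambda>x. of_real (deriv f (U x)) - lam)" by (simp add: pot fun_eq_iff)
  obtain Y Y' where "jordan_tower (of_real c) (q lam) Y Y' m"
    using jordan_chain[where m = m, OF lam m(1,2)] by blast
  then interpret operator_tower c f U lam Y Y' m
    using q_BUC[of lam] unfolding q_eq by (intro operator_tower.intro operator_tower_axioms.intro)
  show "lam \<in> eigenvalues_L c f U \<longleftrightarrow> evans lam = 0" using eigenvalue_iff m(4) by simp
  show "int (alg_mult c f U lam) = zorder evans lam" using alg_mult_eq m(3) by simp
qed

text \<open>The difference to the Jost solution tends to 0 at \<open>-\<infinity>\<close> with its derivative. Its Wronskian with the
  Jost solution vanishes, so it is a multiple of the Jost solution, and the factor is 0 because the
  Jost solution tends to 1.\<close>

lemma jost_unique: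
  assumes lam: "lam \<in> Omega" and lin: "lin2 (nu lam) g (\<lambda>_. 0) p v"
    and lim: "(p \<longlongrightarrow> k) at_bot" "(v \<longlongrightarrow> 0) at_bot"
  shows "p x = k * jost g (nu lam) x" "v x = k * jost' g (nu lam) x"
proof -
  define P where "P = (\<lambda>x. p x - k * jost g (nu lam) x)"
  define V where "V = (\<lambda>x. v x - k * jost' g (nu lam) x)"
  note J = jost_lin2[OF lam] and Jb = left.jost_at_bot[OF nu_pos(2)[OF lam]]
  have PV: "lin2 (nu lam) g (\<lambda>_. 0) P V"
    unfolding P_def V_def using lin2_diff[OF lin lin2_scale[OF J, of k]] by simp
  have limP: "(P \<longlongrightarrow> k - k * 1) at_bot" and limV: "(V \<longlongrightarrow> 0 - k * 0) at_bot"
    unfolding P_def V_def by (intro tendsto_intros lim Jb)+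
  obtain x0 where x0: "jost g (nu lam) x0 \<noteq> 0"
    using ym_nonzero[OF lam] by (metis mult_zero_right ym_def)
  have e: "((\<lambda>x. exp (nu lam * complex_of_real x)) \<longlongrightarrow> 0) at_bot"
    by (rule exp_linear_tendsto_0(1)[OF nu_pos(2)[OF lam]])
  have l: "((\<lambda>x. exp (nu lam * of_real x) * jost g (nu lam) x) \<longlongrightarrow> 0 * 1) at_bot"
    "((\<lambda>x. exp (nu lam * of_real x) * jost' g (nu lam) x) \<longlongrightarrow> 0 * 0) at_bot"
    by (intro tendsto_intros e Jb)+
  have small: "\<forall>\<^sub>F x in at_bot. norm (h x) \<le> 1" if "(h \<longlongrightarrow> 0) at_bot" for h :: "real \<Rightarrow> complex"
    using order_tendstoD(2)[OF tendsto_norm_zero[OF that], of 1] by (auto elim!: eventually_mono)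
  have "jost g (nu lam) x0 * V x0 - jost' g (nu lam) x0 * P x0 = 0"
    by (rule wronskian_vanishes[OF J PV, of at_bot 1])
       (use l eventually_conj[OF small[of P] small[of V]] limP limV in auto)
  then obtain b where b: "\<And>x. P x = b * jost g (nu lam) x" "\<And>x. V x = b * jost' g (nu lam) x"
    using lin2_proportional[OF J PV g_bounded] x0 by metis
  have "((\<lambda>x. b * jost g (nu lam) x) \<longlongrightarrow> b * 1) at_bot" by (intro tendsto_intros Jb)
  moreover have "((\<lambda>x. b * jost g (nu lam) x) \<longlongrightarrow> 0) at_bot" using limP by (simp add: b(1)[abs_def])
  ultimately have "b * 1 = 0" by (rule tendsto_unique[rotated]) simp
  then show "p x = k * jost g (nu lam) x" "v x = k * jost' g (nu lam) x"
    using b[of x] by (auto simp: P_def V_def)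
qed

lemma jost_not_both_zero:
  assumes lam: "lam \<in> Omega"
  shows "jost g (nu lam) x \<noteq> 0 \<or> jost' g (nu lam) x \<noteq> 0"
proof (rule ccontr)
  assume "\<not> ?thesis"
  then have "jost g (nu lam) t = 0" for t
    using lin2_unique(1)[OF jost_lin2[OF lam] g_bounded, of x t] by simp
  then show False using ym_nonzero[OF lam] by (metis mult_zero_right ym_def)
qed

text \<open>The vector \<open>u x\<close> is \<open>wm\<close> times a vector that converges, uniformly near the loop, to \<open>evans\<close> times the
  eigenvector \<open>(1, mup)\<close>. So the limiting phase differs from that of \<open>up = wp (1, mup)\<close> by the winding
  numbers of \<open>wm\<close>, \<open>evans\<close> and \<open>wp\<close>; the first and the last are 0 since \<open>wm\<close> and \<open>wp\<close> have zero-free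
  continuous extensions, and the argument principle evaluates the second one.\<close>

lemma asymptotic_phase:
  fixes u :: "real \<Rightarrow> real \<Rightarrow> complex^2" and up :: "real \<Rightarrow> complex^2"
  assumes sc: "simply_connected Omega"
    and lp: "smooth_loop gam gam'" "path_image gam \<subseteq> Omega" and orient: "positively_oriented gam"
    and evans_nz: "\<And>z. z \<in> path_image gam \<Longrightarrow> evans z \<noteq> 0"
    and wm: "wm analytic_on path_image gam" "\<And>z. z \<in> path_image gam \<Longrightarrow> wm z \<noteq> 0"
    and wp: "wp analytic_on path_image gam" "\<And>z. z \<in> path_image gam \<Longrightarrow> wp z \<noteq> 0"
    and em: "continuous_on (path_image gam \<union> inside (path_image gam)) em"
      "\<And>z. z \<in> path_image gam \<union> inside (path_image gam) \<Longrightarrow> em z \<noteq> 0" "\<And>z. z \<in> path_image gam \<Longrightarrow> em z = wm z"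
    and ep: "continuous_on (path_image gam \<union> inside (path_image gam)) ep"
      "\<And>z. z \<in> path_image gam \<union> inside (path_image gam) \<Longrightarrow> ep z \<noteq> 0" "\<And>z. z \<in> path_image gam \<Longrightarrow> ep z = wp z"
    and u: "\<And>x s. s \<in> {0..1} \<Longrightarrow> u x s $ 1 = wm (gam s) * jost g (nu (gam s)) x"
      "\<And>x s. s \<in> {0..1} \<Longrightarrow> u x s $ 2 = wm (gam s) * (mup (gam s) * jost g (nu (gam s)) x + jost' g (nu (gam s)) x)"
    and up: "\<And>s. s \<in> {0..1} \<Longrightarrow> up s $ 1 = wp (gam s)"
      "\<And>s. s \<in> {0..1} \<Longrightarrow> up s $ 2 = mup (gam s) * wp (gam s)"
  shows "\<exists>l. ((\<lambda>x. GP (u x)) \<longlongrightarrow> l) at_top \<and>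
      l - GP up = (\<Sum>z | z \<in> inside (path_image gam) \<and> evans z = 0. real_of_int (zorder evans z))"
proof -
  interpret smooth_loop gam gam' by (rule lp(1))
  let ?K = "path_image gam"
  obtain Am where Am: "open Am" "?K \<subseteq> Am" "wm holomorphic_on Am" using wm(1) analytic_on_holomorphic by blast
  obtain Ap where Ap: "open Ap" "?K \<subseteq> Ap" "wp holomorphic_on Ap" using wp(1) analytic_on_holomorphic by blast
  define A1 where "A1 = Am \<inter> Ap \<inter> Omega"
  have A1: "open A1" "?K \<subseteq> A1" using Am Ap Omega_open lp(2) by (auto simp: A1_def)
  have hol1: "wm holomorphic_on A1" "wp holomorphic_on A1" "nu holomorphic_on A1" "mup holomorphic_on A1" "evans holomorphic_on A1"
    by (rule holomorphic_on_subset[OF Am(3)] holomorphic_on_subset[OF Ap(3)] holomorphic_on_subset[OF nu_holomorphic]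
      holomorphic_on_subset[OF mup_holomorphic] holomorphic_on_subset[OF evans_holomorphic]; auto simp: A1_def)+
  have K: "compact ?K" by (rule compact_path_image[OF gam_path])
  have bdd: "\<exists>B. \<forall>z\<in>?K. norm (h z) < B" if "h holomorphic_on A1" for h :: "complex \<Rightarrow> complex"
  proof -
    have "continuous_on ?K h" using that A1(2) holomorphic_on_imp_continuous_on continuous_on_subset by blast
    then have "bounded (h ` ?K)" using K by (intro compact_imp_bounded compact_continuous_image)
    then obtain B where "\<And>z. z \<in> ?K \<Longrightarrow> norm (h z) \<le> B" by (auto simp: bounded_iff)
    then show ?thesis by (intro exI[of _ "B + 1"]) force
  qed
  obtain B1 B2 B3 where B: "\<And>z. z \<in> ?K \<Longrightarrow> norm (wm z) < B1" "\<And>z. z \<in> ?K \<Longrightarrow> norm (mup z) < B2"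
      "\<And>z. z \<in> ?K \<Longrightarrow> norm (evans z) < B3"
    using bdd[OF hol1(1)] bdd[OF hol1(4)] bdd[OF hol1(5)] by metis
  obtain \<rho> where \<rho>: "\<rho> > 0" "\<And>z. z \<in> ?K \<Longrightarrow> \<rho> < Re (nu z)"
  proof -
    have cn: "continuous_on ?K (\<lambda>z. Re (nu z))"
      by (intro continuous_on_Re continuous_on_subset[OF holomorphic_on_imp_continuous_on[OF hol1(3)] A1(2)])
    obtain z0 where "z0 \<in> ?K" "\<And>z. z \<in> ?K \<Longrightarrow> Re (nu z0) \<le> Re (nu z)"
      using continuous_attains_inf[OF K _ cn] path_image_nonempty by blast
    moreover from this have "Re (nu z0) > 0" using nu_pos(2) lp(2) by blast
    ultimately show thesis by (intro that[of "Re (nu z0) / 2"]) force+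
  qed
  \<comment> \<open>A neighbourhood of the loop on which \<open>Re nu\<close> is bounded below, for uniform convergence, and the
    factors are bounded, so that products converge uniformly too.\<close>
  define A where "A = {z \<in> A1. \<rho> < Re (nu z) \<and> norm (wm z) < B1 \<and> norm (mup z) < B2 \<and> norm (evans z) < B3}"
  have A_eq: "A = (A1 \<inter> (\<lambda>z. Re (nu z)) -` {\<rho><..}) \<inter> (A1 \<inter> (\<lambda>z. norm (wm z)) -` {..<B1})
      \<inter> (A1 \<inter> (\<lambda>z. norm (mup z)) -` {..<B2}) \<inter> (A1 \<inter> (\<lambda>z. norm (evans z)) -` {..<B3})"
    by (auto simp: A_def)
  have A: "open A" "?K \<subseteq> A"
  proof -
    show "open A" unfolding A_eq
      by (intro open_Int continuous_open_preimage A1 continuous_on_Re continuous_on_norm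
          holomorphic_on_imp_continuous_on[OF hol1(1)] holomorphic_on_imp_continuous_on[OF hol1(3)]
          holomorphic_on_imp_continuous_on[OF hol1(4)] holomorphic_on_imp_continuous_on[OF hol1(5)]) auto
    show "?K \<subseteq> A" using A1(2) \<rho>(2) B by (auto simp: A_def)
  qed
  have A_sub: "A \<subseteq> A1" "A \<subseteq> Omega" by (auto simp: A_def A1_def)
  have hol: "wm holomorphic_on A" "wp holomorphic_on A" "mup holomorphic_on A" "evans holomorphic_on A"
    using hol1 A_sub(1) holomorphic_on_subset by blast+
  have hj: "(\<lambda>z. jost g (nu z) x) holomorphic_on A" "(\<lambda>z. jost' g (nu z) x) holomorphic_on A" for x
    using jost_hol(1,2)[of x] A_sub(2) holomorphic_on_subset by blast+
  have nuA: "nu \<in> A \<rightarrow> {\<nu>. Re \<nu> \<ge> \<rho>}" by (auto simp: A_def)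
  have lj: "uniform_limit A (\<lambda>x z. jost g (nu z) x) evans at_top" "uniform_limit A (\<lambda>x z. jost' g (nu z) x) (\<lambda>_. 0) at_top"
    using uniform_limit_compose'[OF left.jost_uniform_at_top[OF \<rho>(1)] nuA]
      uniform_limit_compose'[OF left.jost'_uniform_at_top[OF \<rho>(1)] nuA]
    by (simp_all add: evans_def[abs_def])
  have bds: "bounded (wm ` A)" "bounded (mup ` A)" "bounded (evans ` A)"
    unfolding bounded_iff by (rule exI[of _ B1] exI[of _ B2] exI[of _ B3]; auto simp: A_def intro: less_imp_le)+
  have bd2: "bounded ((\<lambda>z. mup z * evans z + 0) ` A)"
  proof -
    have "norm (mup z * evans z + 0) \<le> \<bar>B2\<bar> * \<bar>B3\<bar>" if "z \<in> A" for z
      using that by (auto simp: norm_mult A_def intro!: mult_mono)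
    then show ?thesis unfolding bounded_iff by blast
  qed
  define F1 where "F1 = (\<lambda>x z. wm z * jost g (nu z) x)"
  define F2 where "F2 = (\<lambda>x z. wm z * (mup z * jost g (nu z) x + jost' g (nu z) x))"
  define G1 where "G1 = (\<lambda>z. wm z * evans z)"
  define G2 where "G2 = (\<lambda>z. wm z * (mup z * evans z + 0))"
  have lF: "uniform_limit A F1 G1 at_top" "uniform_limit A F2 G2 at_top"
    unfolding F1_def F2_def G1_def G2_def
    by (intro uniform_lim_mult uniform_limit_add uniform_limit_const lj bds bd2)+
  define v :: "real \<Rightarrow> complex^2" where "v = (\<lambda>s. vector [G1 (gam s), G2 (gam s)])"
  have lim: "((\<lambda>x. GP (u x)) \<longlongrightarrow> GP v) at_top"
  proof (rule GP_uniform_limit[OF A _ _ _ _ lF])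
    show "F1 x holomorphic_on A" "F2 x holomorphic_on A" "G1 holomorphic_on A" "G2 holomorphic_on A" for x
      unfolding F1_def F2_def G1_def G2_def by (intro holomorphic_intros hol hj)+
    show "F1 x z \<noteq> 0 \<or> F2 x z \<noteq> 0" if "z \<in> ?K" for x z
      using jost_not_both_zero[of z x] lp(2) wm(2)[OF that] that by (auto simp: F1_def F2_def)
    show "G1 z \<noteq> 0 \<or> G2 z \<noteq> 0" if "z \<in> ?K" for z
      using evans_nz[OF that] wm(2)[OF that] by (simp add: G1_def)
  qed (use u in \<open>auto simp: F1_def F2_def v_def\<close>)
  have G1nz: "wm z * evans z \<noteq> 0" if "z \<in> ?K" for z using evans_nz[OF that] wm(2)[OF that] by simp
  have GPv: "GP v = Im (log_integral (\<lambda>z. wm z * evans z)) / (2 * pi) + slope_phase mup"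
    by (rule GP_line[OF A _ G1nz hol(3)]) (auto intro!: holomorphic_intros hol simp: v_def G1_def G2_def)
  have GPp: "GP up = Im (log_integral wp) / (2 * pi) + slope_phase mup"
    by (rule GP_line[OF A hol(2) wp(2) hol(3) up])
  have "log_integral (\<lambda>z. wm z * evans z) = log_integral wm + log_integral evans"
    by (rule log_integral_mult[OF A hol(1) wm(2) hol(4) evans_nz])
  moreover have "log_integral wm = 0" by (rule log_integral_zero[OF A hol(1) wm(2) em])
  moreover have "log_integral wp = 0" by (rule log_integral_zero[OF A hol(2) wp(2) ep])
  moreover have "log_integral evans = 2 * pi * \<i> * (\<Sum>z | z \<in> inside ?K \<and> evans z = 0. of_int (zorder evans z))"
    by (rule log_integral_zeros[OF Omega_open sc lp(2) evans_holomorphic evans_nz orient])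
  moreover have "(\<Sum>z | z \<in> inside ?K \<and> evans z = 0. of_int (zorder evans z) :: complex) =
      of_real (\<Sum>z | z \<in> inside ?K \<and> evans z = 0. real_of_int (zorder evans z))" by simp
  ultimately have "GP v - GP up = (\<Sum>z | z \<in> inside ?K \<and> evans z = 0. real_of_int (zorder evans z))"
    unfolding GPv GPp by (simp del: of_real_sum of_real_of_int_eq)
  with lim show ?thesis by blast
qed

end

section \<open>The linearization about a travelling wave\<close>

text \<open>Two roots with real parts of different sign are distinct, so they sum to \<open>-c\<close>. Their difference
  \<open>2 m2 + c\<close> squares to the discriminant and has positive real part, which makes it the principal square
  root. This fixes the eigenvalue \<open>m2\<close> as a holomorphic function of \<open>lam\<close>.\<close>

lemma csqrt_root_gap:
  fixes m1 m2 lam :: complex and c d :: real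
  assumes r1: "m1\<^sup>2 + of_real c * m1 = lam - of_real d" and r2: "m2\<^sup>2 + of_real c * m2 = lam - of_real d"
    and s: "Re m1 < 0" "0 < Re m2"
  shows "csqrt (of_real (c\<^sup>2) + 4 * (lam - of_real d)) = 2 * m2 + of_real c"
    "\<bar>c\<bar> < Re (csqrt (of_real (c\<^sup>2) + 4 * (lam - of_real d)))"
proof -
  have "(m1 - m2) * (m1 + m2 + of_real c) = (m1\<^sup>2 + of_real c * m1) - (m2\<^sup>2 + of_real c * m2)"
    by (simp add: algebra_simps power2_eq_square)
  then have "(m1 - m2) * (m1 + m2 + of_real c) = 0" unfolding r1 r2 by simp
  moreover have "m1 \<noteq> m2" using s by auto
  ultimately have "m1 + m2 + of_real c = 0" by (metis mult_eq_0_iff right_minus_eq)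
  then have sum: "m1 = - m2 - of_real c" by algebra
  have sq: "(2 * m2 + of_real c)\<^sup>2 = of_real (c\<^sup>2) + 4 * (lam - of_real d)"
    unfolding r2[symmetric] by (simp add: power2_eq_square algebra_simps)
  have Re_m1: "Re m1 = - Re m2 - c" unfolding sum by simp
  then have pos: "\<bar>c\<bar> < Re (2 * m2 + of_real c)" using s by (simp add: abs_if)
  show eq: "csqrt (of_real (c\<^sup>2) + 4 * (lam - of_real d)) = 2 * m2 + of_real c"
    by (rule csqrt_unique[OF sq]) (use pos in linarith)
  show "\<bar>c\<bar> < Re (csqrt (of_real (c\<^sup>2) + 4 * (lam - of_real d)))" unfolding eq by (rule pos)
qed

lemma eigenvector_companion:
  fixes v :: "complex^2"
  assumes "eigenvector (vector [vector [0, 1], vector [k, b]]) mu v"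
  shows "v $ 2 = mu * v $ 1" "v $ 1 \<noteq> 0" "mu\<^sup>2 - b * mu = k"
proof -
  have v0: "v \<noteq> 0" and e: "(vector [vector [0, 1], vector [k, b]] :: complex^2^2) *v v = mu *s v"
    using assms by (auto simp: eigenvector_def)
  have 1: "v $ 2 = mu * v $ 1"
    using arg_cong[OF e, of "\<lambda>w :: complex^2. w $ 1"] by (simp add: matrix_vector_mult_def UNIV_2)
  have 2: "k * v $ 1 + b * v $ 2 = mu * v $ 2"
    using arg_cong[OF e, of "\<lambda>w :: complex^2. w $ 2"] by (simp add: matrix_vector_mult_def UNIV_2)
  show v1: "v $ 1 \<noteq> 0" using v0 1 by (auto simp: vec_eq_iff forall_2)
  show "v $ 2 = mu * v $ 1" by (rule 1)
  have "(mu\<^sup>2 - b * mu - k) * v $ 1 = 0" using 2 unfolding 1 by (simp add: algebra_simps power2_eq_square)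
  with v1 show "mu\<^sup>2 - b * mu = k" by simp
qed

lemma A_inf_eq:
  fixes A_inf :: "complex \<Rightarrow> complex^2^2"
  assumes cont: "continuous_on UNIV (deriv f)" and lim: "(U \<longlongrightarrow> u0) F" and F: "F \<noteq> bot"
    and A: "(A_mat c f U lam \<longlongrightarrow> A_inf lam) F"
  shows "A_inf lam = vector [vector [0, 1], vector [lam - of_real (deriv f u0), - of_real c]]"
proof -
  have "isCont (deriv f) u0" using cont by (simp add: continuous_on_eq_continuous_at)
  then have "((\<lambda>x. deriv f (U x)) \<longlongrightarrow> deriv f u0) F" using lim by (rule isCont_tendsto_compose)
  then have l21: "((\<lambda>x. lam - complex_of_real (deriv f (U x))) \<longlongrightarrow> lam - of_real (deriv f u0)) F"
    by (intro tendsto_intros)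
  have ent: "((\<lambda>x. A_mat c f U lam x $ i $ j) \<longlongrightarrow> A_inf lam $ i $ j) F" for i j
    by (intro tendsto_vec_nth A)
  have "A_inf lam $ 1 $ 1 = 0" "A_inf lam $ 1 $ 2 = 1" "A_inf lam $ 2 $ 2 = - of_real c"
    using ent[of 1 1] ent[of 1 2] ent[of 2 2] F by (simp_all add: A_mat_def tendsto_const_iff)
  moreover have "A_inf lam $ 2 $ 1 = lam - of_real (deriv f u0)"
    using tendsto_unique[OF F ent[of 2 1]] l21 by (simp add: A_mat_def)
  ultimately show ?thesis by (simp add: vec_eq_iff forall_2)
qed

lemma resolvent_no_eigenvalue:
  assumes "lam \<notin> spectrum_L c f U" "(\<lambda>x. complex_of_real (deriv f (U x)) - lam) \<in> BUC"
  shows "lam \<notin> eigenvalues_L c f U"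
proof
  assume "lam \<in> eigenvalues_L c f U"
  then obtain p where p: "p \<in> dom_L" "p \<noteq> (\<lambda>x. 0)" "L_op c f U p = (\<lambda>x. lam * p x)"
    by (auto simp: eigenvalues_L_def)
  have "inj_on (L_shift c f U lam) dom_L"
    using assms by (simp add: spectrum_L_def resolvent_set_def bij_betw_def)
  moreover have "L_shift c f U lam p = (\<lambda>x. 0)" using p by (simp add: L_shift_def)
  moreover have "(\<lambda>x. 0) \<in> dom_L" "L_shift c f U lam (\<lambda>x. 0) = (\<lambda>x. 0)"
    using lin2_dom_L[OF lin2_zero, of 0] BUC_zero assms(2) by auto
  ultimately show False using p by (metis inj_onD)
qed

text \<open>\<open>U\<close> takes values in a compact interval, on which \<open>f'\<close> is Lipschitz because \<open>f''\<close> is continuous. So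
  \<open>f' (U x)\<close> inherits the decay of \<open>U\<close> and, \<open>U'\<close> being bounded, its Lipschitz continuity.\<close>

lemma wave_lipschitz:
  fixes f U :: "real \<Rightarrow> real"
  assumes f: "\<forall>x. deriv f field_differentiable (at x)" "continuous_on UNIV (deriv (deriv f))"
    and U: "\<forall>x. U field_differentiable (at x)" and C: "C > 0" and a: "a > 0"
    and plus: "\<forall>x\<ge>0. \<bar>U x - Uplus\<bar> \<le> C * exp (- a * x)"
    and minus: "\<forall>x\<le>0. \<bar>U x - Uminus\<bar> \<le> C * exp (a * x)"
    and dU: "\<forall>x. \<bar>deriv U x\<bar> \<le> C * exp (- a * \<bar>x\<bar>)"
    and eq: "deriv f Uplus = d" "deriv f Uminus = d"
  obtains L where "L \<ge> 0" "\<And>x. \<bar>deriv f (U x) - d\<bar> \<le> L * exp (- a * \<bar>x\<bar>)"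
    "\<And>x y. \<bar>deriv f (U x) - deriv f (U y)\<bar> \<le> L * \<bar>x - y\<bar>"
proof -
  define R where "R = \<bar>Uplus\<bar> + \<bar>Uminus\<bar> + C"
  have UR: "U x \<in> {-R..R}" for x
  proof (cases "x \<ge> 0")
    case True
    have "C * exp (- a * x) \<le> C * 1" using True C a by (intro mult_left_mono) auto
    with plus True have "\<bar>U x - Uplus\<bar> \<le> C" by (smt (verit))
    then show ?thesis unfolding R_def by auto
  next
    case False
    then have "C * exp (a * x) \<le> C * 1" using C a by (intro mult_left_mono) (auto simp: mult_le_0_iff)
    with minus False have "\<bar>U x - Uminus\<bar> \<le> C" by (smt (verit))
    then show ?thesis unfolding R_def by auto
  qed
  have limR: "Uplus \<in> {-R..R}" "Uminus \<in> {-R..R}" using C by (auto simp: R_def)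
  have "compact (deriv (deriv f) ` {-R..R})"
    by (intro compact_continuous_image continuous_on_subset[OF f(2)]) auto
  then have "bounded (deriv (deriv f) ` {-R..R})" by (rule compact_imp_bounded)
  then obtain B where "\<forall>y\<in>deriv (deriv f) ` {-R..R}. norm y \<le> B" unfolding bounded_iff by blast
  then have B: "\<bar>deriv (deriv f) y\<bar> \<le> B" if "y \<in> {-R..R}" for y using that by simp
  have B0: "B \<ge> 0" using B[OF limR(1)] by linarith
  have lip_f: "\<bar>deriv f s - deriv f t\<bar> \<le> B * \<bar>s - t\<bar>" if "s \<in> {-R..R}" "t \<in> {-R..R}" for s t
  proof -
    have "norm (deriv f s - deriv f t) \<le> B * norm (s - t)"
    proof (rule field_differentiable_bound[where S = "{-R..R}" and f' = "deriv (deriv f)"])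
      show "(deriv f has_field_derivative deriv (deriv f) z) (at z within {-R..R})" for z
        using f(1) DERIV_deriv_iff_field_differentiable by (blast intro: has_field_derivative_at_within)
    qed (use that B in auto)
    then show ?thesis by simp
  qed
  have lip_U: "\<bar>U x - U y\<bar> \<le> C * \<bar>x - y\<bar>" for x y
  proof -
    have "norm (U x - U y) \<le> C * norm (x - y)"
    proof (rule field_differentiable_bound[where S = UNIV and f' = "deriv U"])
      show "(U has_field_derivative deriv U z) (at z within UNIV)" for z
        using U DERIV_deriv_iff_field_differentiable by blast
      show "norm (deriv U z) \<le> C" for z
      proof -
        have "C * exp (- a * \<bar>z\<bar>) \<le> C * 1" using C a by (intro mult_left_mono) auto
        with dU[rule_format, of z] show ?thesis by simp
      qed
    qed auto
    then show ?thesis by simp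
  qed
  show ?thesis
  proof (rule that[of "B * C"])
    show "B * C \<ge> 0" using B0 C by simp
    show "\<bar>deriv f (U x) - d\<bar> \<le> B * C * exp (- a * \<bar>x\<bar>)" for x
    proof (cases "x \<ge> 0")
      case True
      have "\<bar>deriv f (U x) - deriv f Uplus\<bar> \<le> B * \<bar>U x - Uplus\<bar>" by (rule lip_f[OF UR limR(1)])
      also have "\<dots> \<le> B * (C * exp (- a * x))" using plus True B0 by (intro mult_left_mono) auto
      finally show ?thesis using True by (simp add: eq mult.assoc)
    next
      case False
      have "\<bar>deriv f (U x) - deriv f Uminus\<bar> \<le> B * \<bar>U x - Uminus\<bar>" by (rule lip_f[OF UR limR(2)])
      also have "\<dots> \<le> B * (C * exp (a * x))" using minus False B0 by (intro mult_left_mono) auto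
      finally show ?thesis using False by (simp add: eq mult.assoc)
    qed
    show "\<bar>deriv f (U x) - deriv f (U y)\<bar> \<le> B * C * \<bar>x - y\<bar>" for x y
      using order_trans[OF lip_f[OF UR UR] mult_left_mono[OF lip_U B0]] by (simp add: mult.assoc)
  qed
qed

theorem theorem3p19:
  fixes f U :: "real \<Rightarrow> real"
    and c a C kappa Uplus Uminus :: real
    and A_inf :: "complex \<Rightarrow> complex^2^2"
    and Omega :: "complex set"
    and mu1 mu2 :: "complex \<Rightarrow> complex"
    and gam :: "real \<Rightarrow> complex"
    and Xplus Xminus :: "complex \<Rightarrow> complex^2"
    and Z :: "complex \<Rightarrow> real \<Rightarrow> complex^2"
  defines "K \<equiv> path_image gam"
  assumes f_C2: "\<forall>x. f field_differentiable (at x)"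
      "\<forall>x. deriv f field_differentiable (at x)"
      "continuous_on UNIV (deriv (deriv f))"
    and U_diff: "\<forall>x. U field_differentiable (at x)"
      "\<forall>x. deriv U field_differentiable (at x)"
    and wave: "\<forall>x. deriv (deriv U) x + c * deriv U x + f (U x) = 0"
    and limits: "(U \<longlongrightarrow> Uplus) at_top" "(U \<longlongrightarrow> Uminus) at_bot"
    and pos: "a > 0" "C > 0"
    and decay_plus: "\<forall>x\<ge>0. \<bar>U x - Uplus\<bar> \<le> C * exp (- a * x)"
    and decay_minus: "\<forall>x\<le>0. \<bar>U x - Uminus\<bar> \<le> C * exp (a * x)"
    and decay_deriv: "\<forall>x. \<bar>deriv U x\<bar> \<le> C * exp (- a * \<bar>x\<bar>)"
    and A_plus: "\<forall>lam. (A_mat c f U lam \<longlongrightarrow> A_inf lam) at_top"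
    and A_minus: "\<forall>lam. (A_mat c f U lam \<longlongrightarrow> A_inf lam) at_bot"
    and Omega: "open Omega" "simply_connected Omega"
    and Omega_spectrum: "Omega \<inter> spectrum_L c f U \<subseteq> discrete_eigenvalues_L c f U"
    and hyperbolic: "\<forall>lam\<in>Omega. eigenvalue (A_inf lam) (mu1 lam) \<and> eigenvalue (A_inf lam) (mu2 lam)
      \<and> Re (mu1 lam) < 0 \<and> 0 < Re (mu2 lam)"
    and curve: "simple_path gam" "pathfinish gam = pathstart gam" "smooth_curve gam"
      "positively_oriented gam"
    and K_subset: "K \<subseteq> Omega"
    and K_spectrum: "K \<inter> spectrum_L c f U = {}"
    and kappa: "0 < kappa" "kappa < a / 2"
    and Xplus: "reference_path A_inf mu2 K Xplus"
    and Xminus: "reference_path A_inf mu2 K Xminus"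
    and Z: "center_unstable_manifold (A_mat c f U) mu2 kappa K Xminus Z"
    and nondeg: "nondegenerate A_inf mu2 K Xplus" "nondegenerate A_inf mu2 K Xminus"
  shows "finite (eigenvalues_L c f U \<inter> inside K) \<and>
    (\<exists>l. ((\<lambda>x. GP (\<lambda>s. Z (gam s) (tanh (kappa * x)))) \<longlongrightarrow> l) at_top \<and>
         l - GP (\<lambda>s. Xplus (gam s)) =
           real (\<Sum>lam\<in>eigenvalues_L c f U \<inter> inside K. alg_mult c f U lam))"
proof -
  have f'_cont: "continuous_on UNIV (deriv f)"
    using f_C2(2) by (intro continuous_at_imp_continuous_on) (auto intro: field_differentiable_imp_continuous_at)
  define d where "d = deriv f Uplus"
  have A_eq: "A_inf lam = vector [vector [0, 1], vector [lam - of_real d, - of_real c]]" for lam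
    unfolding d_def by (rule A_inf_eq[OF f'_cont limits(1)]) (use A_plus in auto)
  have "A_inf 0 = vector [vector [0, 1], vector [0 - of_real (deriv f Uminus), - of_real c]]"
    by (rule A_inf_eq[OF f'_cont limits(2)]) (use A_minus in auto)
  from arg_cong[OF this, of "\<lambda>M :: complex^2^2. M $ 2 $ 1"] have d_minus: "deriv f Uminus = d"
    unfolding A_eq by simp
  obtain L where L: "L \<ge> 0" "\<And>x. \<bar>deriv f (U x) - d\<bar> \<le> L * exp (- a * \<bar>x\<bar>)"
    "\<And>x y. \<bar>deriv f (U x) - deriv f (U y)\<bar> \<le> L * \<bar>x - y\<bar>"
    using wave_lipschitz[OF f_C2(2,3) U_diff(1) pos(2,1) decay_plus decay_minus decay_deriv d_def[symmetric] d_minus] by blast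
  define g where "g = (\<lambda>x. complex_of_real (deriv f (U x) - d))"
  have roots: "csqrt (of_real (c\<^sup>2) + 4 * (lam - of_real d)) = 2 * mu2 lam + of_real c"
     "\<bar>c\<bar> < Re (csqrt (of_real (c\<^sup>2) + 4 * (lam - of_real d)))" if om: "lam \<in> Omega" for lam
  proof -
    obtain v1 v2 where "eigenvector (A_inf lam) (mu1 lam) v1" "eigenvector (A_inf lam) (mu2 lam) v2"
      using bspec[OF hyperbolic om] by (auto simp: eigenvalue_def)
    then have "(mu1 lam)\<^sup>2 + of_real c * mu1 lam = lam - of_real d" "(mu2 lam)\<^sup>2 + of_real c * mu2 lam = lam - of_real d"
      unfolding A_eq by (auto dest!: eigenvector_companion(3))
    from csqrt_root_gap[OF this] bspec[OF hyperbolic om]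
    show "csqrt (of_real (c\<^sup>2) + 4 * (lam - of_real d)) = 2 * mu2 lam + of_real c"
     "\<bar>c\<bar> < Re (csqrt (of_real (c\<^sup>2) + 4 * (lam - of_real d)))" by auto
  qed
  interpret pulse_operator c d a L L g Omega
  proof
    show "norm (g t) \<le> L * exp (- a * \<bar>t\<bar>)" for t unfolding g_def norm_of_real using L(2) by simp
    show "norm (g s - g t) \<le> L * \<bar>s - t\<bar>" for s t
      using L(3)[of s t] unfolding g_def of_real_diff[symmetric] norm_of_real by simp
  qed (use pos L Omega roots in auto)
  have mu2_eq: "mu2 lam = mup lam" if "lam \<in> Omega" for lam
    using roots(1)[OF that] by (simp add: mup_def nu_def)
  have pot: "of_real (deriv f (U x)) - lam = q lam x" for x lam
    unfolding q_def unfolding g_def by simp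
  have pot_BUC: "(\<lambda>x. complex_of_real (deriv f (U x)) - lam) \<in> BUC" for lam
    unfolding pot using q_BUC[of lam] by simp
  have K_sub: "path_image gam \<subseteq> Omega" using K_subset by (simp add: K_def)
  obtain gam' where loop: "smooth_loop gam gam'"
  proof -
    obtain g' where "continuous_on {0..1} g'" "\<forall>s\<in>{0..1}. (gam has_vector_derivative g' s) (at s within {0..1}) \<and> g' s \<noteq> 0"
      using curve(3) by (auto simp: smooth_curve_def)
    then show thesis using curve(1,2) by (intro that[of g']) (simp add: smooth_loop_def)
  qed
  interpret loop: smooth_loop gam gam' by (rule loop)
  have evans_nz: "evans z \<noteq> 0" if "z \<in> path_image gam" for z
  proof
    assume "evans z = 0"
    then have "z \<in> eigenvalues_L c f U" using evans_zero_eigenvalue[OF _ _ pot] that K_sub by blast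
    moreover have "z \<notin> eigenvalues_L c f U"
      using K_spectrum that by (intro resolvent_no_eigenvalue pot_BUC) (auto simp: K_def)
    ultimately show False by blast
  qed
  note zeros = loop.log_integral_zeros[OF Omega K_sub evans_holomorphic evans_nz curve(4)]
  have conn: "connected Omega" by (rule simply_connected_imp_connected[OF Omega(2)])
  have "gam 0 \<in> path_image gam" by (intro loop.gam_in) auto
  then have ex: "\<exists>z\<in>Omega. evans z \<noteq> 0" using evans_nz K_sub by blast
  note mult = eigenvalue_multiplicity[OF conn ex _ pot]
  have ev_set: "eigenvalues_L c f U \<inter> inside K = {z. z \<in> inside (path_image gam) \<and> evans z = 0}"
    using mult(1) zeros(1) by (auto simp: K_def)
  have ref: "X lam $ 1 \<noteq> 0" "X lam $ 2 = mup lam * X lam $ 1"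
    if "reference_path A_inf mu2 K X" "lam \<in> path_image gam" for X :: "complex \<Rightarrow> complex^2" and lam
  proof -
    have lam: "lam \<in> Omega" using that K_sub by blast
    have "eigenvector (A_inf lam) (mu2 lam) (X lam)" using that by (auto simp: reference_path_def K_def)
    from eigenvector_companion[OF this[unfolded A_eq]]
    show "X lam $ 1 \<noteq> 0" "X lam $ 2 = mup lam * X lam $ 1" by (simp_all add: mu2_eq[OF lam])
  qed
  have ext: "\<exists>w e. w analytic_on path_image gam \<and> (\<forall>z\<in>path_image gam. w z = X z $ 1)
      \<and> continuous_on (path_image gam \<union> inside (path_image gam)) e
      \<and> (\<forall>z\<in>path_image gam \<union> inside (path_image gam). e z \<noteq> 0) \<and> (\<forall>z\<in>path_image gam. e z = X z $ 1)"
    if X: "reference_path A_inf mu2 K X" and nd: "nondegenerate A_inf mu2 K X" for X :: "complex \<Rightarrow> complex^2"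
  proof -
    obtain G :: "complex \<Rightarrow> complex^2" where G: "\<And>i. (\<lambda>lam. G lam $ i) analytic_on K" "\<And>lam. lam \<in> K \<Longrightarrow> G lam = X lam"
      using nd by (auto simp: nondegenerate_def)
    obtain E :: "complex \<Rightarrow> complex^2" where E: "\<And>lam. lam \<in> K \<Longrightarrow> E lam = X lam" "continuous_on (K \<union> inside K) E"
      "\<And>lam. lam \<in> inside K \<Longrightarrow> eigenvector (A_inf lam) (mu2 lam) (E lam)"
      using nd unfolding nondegenerate_def by blast
    have "E z $ 1 \<noteq> 0" if "z \<in> K \<union> inside K" for z
    proof (cases "z \<in> K")
      case True
      then show ?thesis using E(1) ref(1)[OF X, of z] by (simp add: K_def)
    next
      case False
      then show ?thesis using that E(3) eigenvector_companion(2) unfolding A_eq by blast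
    qed
    moreover have "continuous_on (K \<union> inside K) (\<lambda>z. E z $ 1)" by (intro continuous_intros E(2))
    ultimately show ?thesis using G E(1)
      by (intro exI[of _ "\<lambda>z. G z $ 1"] exI[of _ "\<lambda>z. E z $ 1"]) (auto simp: K_def)
  qed
  obtain wm em where m: "wm analytic_on path_image gam" "\<And>z. z \<in> path_image gam \<Longrightarrow> wm z = Xminus z $ 1"
      "continuous_on (path_image gam \<union> inside (path_image gam)) em"
      "\<And>z. z \<in> path_image gam \<union> inside (path_image gam) \<Longrightarrow> em z \<noteq> 0" "\<And>z. z \<in> path_image gam \<Longrightarrow> em z = Xminus z $ 1"
    using ext[OF Xminus nondeg(2)] by blast
  obtain wp ep where p: "wp analytic_on path_image gam" "\<And>z. z \<in> path_image gam \<Longrightarrow> wp z = Xplus z $ 1"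
      "continuous_on (path_image gam \<union> inside (path_image gam)) ep"
      "\<And>z. z \<in> path_image gam \<union> inside (path_image gam) \<Longrightarrow> ep z \<noteq> 0" "\<And>z. z \<in> path_image gam \<Longrightarrow> ep z = Xplus z $ 1"
    using ext[OF Xplus nondeg(1)] by blast
  have Z_eq: "Z lam (tanh (kappa * x)) $ 1 = Xminus lam $ 1 * jost g (nu lam) x"
     "Z lam (tanh (kappa * x)) $ 2 = Xminus lam $ 1 * (mup lam * jost g (nu lam) x + jost' g (nu lam) x)"
    if lamK: "lam \<in> path_image gam" for lam x
  proof -
    have lam: "lam \<in> Omega" using K_sub that by blast
    define P where "P = (\<lambda>y. Z lam (tanh (kappa * y)))"
    have dP: "(P has_vector_derivative ((A_mat c f U lam x - mat (mu2 lam)) *v P x)) (at x)" for x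
      using Z lamK by (auto simp: center_unstable_manifold_def P_def K_def)
    have limP: "(P \<longlongrightarrow> Xminus lam) at_bot"
      using Z lamK by (auto simp: center_unstable_manifold_def P_def K_def)
    have comp: "((\<lambda>y. P y $ i) has_vector_derivative (((A_mat c f U lam x - mat (mu2 lam)) *v P x) $ i)) (at x)" for i x
      by (rule bounded_linear.has_vector_derivative[OF bounded_linear_vec_nth dP])
    have d1: "((\<lambda>y. P y $ 1) has_vector_derivative (P x $ 2 - mup lam * P x $ 1)) (at x)" for x
      using comp[of 1 x] by (simp add: matrix_vector_mult_def UNIV_2 A_mat_def mat_def mu2_eq[OF lam])
    have d2: "((\<lambda>y. P y $ 2) has_vector_derivative ((lam - of_real (deriv f (U x))) * P x $ 1 + (- of_real c - mup lam) * P x $ 2)) (at x)" for x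
      using comp[of 2 x] by (simp add: matrix_vector_mult_def UNIV_2 A_mat_def mat_def mu2_eq[OF lam])
    \<comment> \<open>In the coordinates \<open>(P $ 1, v)\<close> the B system becomes \<open>u'' + nu u' + g u = 0\<close>, and the eigenvector
      direction becomes \<open>v = 0\<close>.\<close>
    define v where "v = (\<lambda>y. P y $ 2 - mup lam * P y $ 1)"
    have lin: "lin2 (nu lam) g (\<lambda>_. 0) (\<lambda>y. P y $ 1) v"
      unfolding lin2_def
    proof (intro allI conjI)
      fix x
      show "((\<lambda>y. P y $ 1) has_vector_derivative v x) (at x)" using d1 by (simp add: v_def)
      have "(v has_vector_derivative ((lam - of_real (deriv f (U x))) * P x $ 1 + (- of_real c - mup lam) * P x $ 2) - mup lam * (P x $ 2 - mup lam * P x $ 1)) (at x)"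
        unfolding v_def by (intro has_vector_derivative_diff has_vector_derivative_mult_right d1 d2)
      moreover have "((lam - of_real (deriv f (U x))) * P x $ 1 + (- of_real c - mup lam) * P x $ 2) - mup lam * (P x $ 2 - mup lam * P x $ 1)
          = 0 - nu lam * v x - g x * P x $ 1"
      proof -
        have "mum lam = - of_real c - mup lam" using mu_sum[of lam] by algebra
        then have nu: "nu lam = 2 * mup lam + of_real c" using mu_diff[of lam] by (simp add: algebra_simps)
        have "mup lam * (- of_real c - mup lam) = of_real d - lam"
          using mu_prod[of lam] \<open>mum lam = - of_real c - mup lam\<close> by simp
        then have lam_eq: "lam = of_real d + mup lam * (of_real c + mup lam)" by (simp add: algebra_simps)
        have gx: "complex_of_real (deriv f (U x)) = g x + of_real d" by (simp add: g_def)
        have e: "lam - of_real (deriv f (U x)) = mup lam * (of_real c + mup lam) - g x"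
          unfolding gx by (subst lam_eq) simp
        show ?thesis unfolding e nu v_def by (simp add: algebra_simps)
      qed
      ultimately show "(v has_vector_derivative 0 - nu lam * v x - g x * P x $ 1) (at x)" by simp
    qed
    have lim1: "((\<lambda>y. P y $ 1) \<longlongrightarrow> Xminus lam $ 1) at_bot" by (intro tendsto_vec_nth limP)
    have "(v \<longlongrightarrow> Xminus lam $ 2 - mup lam * Xminus lam $ 1) at_bot"
      unfolding v_def by (intro tendsto_intros tendsto_vec_nth limP)
    then have lim2: "(v \<longlongrightarrow> 0) at_bot" using ref(2)[OF Xminus lamK] by simp
    have "P x $ 1 = Xminus lam $ 1 * jost g (nu lam) x" "v x = Xminus lam $ 1 * jost' g (nu lam) x"
      by (rule jost_unique[OF lam lin lim1 lim2])+
    then show "Z lam (tanh (kappa * x)) $ 1 = Xminus lam $ 1 * jost g (nu lam) x"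
     "Z lam (tanh (kappa * x)) $ 2 = Xminus lam $ 1 * (mup lam * jost g (nu lam) x + jost' g (nu lam) x)"
      by (auto simp: P_def v_def algebra_simps)
  qed
  have "\<exists>l. ((\<lambda>x. GP (\<lambda>s. Z (gam s) (tanh (kappa * x)))) \<longlongrightarrow> l) at_top \<and>
      l - GP (\<lambda>s. Xplus (gam s)) = (\<Sum>z | z \<in> inside (path_image gam) \<and> evans z = 0. real_of_int (zorder evans z))"
  proof (rule asymptotic_phase[OF Omega(2) loop K_sub curve(4) evans_nz m(1) _ p(1) _ m(3,4) _ p(3,4)])
    show "wm z \<noteq> 0" if "z \<in> path_image gam" for z using m(2) ref(1)[OF Xminus] that by simp
    show "wp z \<noteq> 0" if "z \<in> path_image gam" for z using p(2) ref(1)[OF Xplus] that by simp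
    show "em z = wm z" if "z \<in> path_image gam" for z using m(2,5)[OF that] by simp
    show "ep z = wp z" if "z \<in> path_image gam" for z using p(2,5)[OF that] by simp
    fix s :: real assume "s \<in> {0..1}"
    then have s: "gam s \<in> path_image gam" by (rule loop.gam_in)
    show "Z (gam s) (tanh (kappa * x)) $ 1 = wm (gam s) * jost g (nu (gam s)) x"
      "Z (gam s) (tanh (kappa * x)) $ 2 = wm (gam s) * (mup (gam s) * jost g (nu (gam s)) x + jost' g (nu (gam s)) x)" for x
      unfolding m(2)[OF s] by (rule Z_eq[OF s])+
    show "Xplus (gam s) $ 1 = wp (gam s)" using p(2)[OF s] by simp
    show "Xplus (gam s) $ 2 = mup (gam s) * wp (gam s)" unfolding p(2)[OF s] by (rule ref(2)[OF Xplus s])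
  qed
  moreover have "(\<Sum>z | z \<in> inside (path_image gam) \<and> evans z = 0. real_of_int (zorder evans z)) =
      real (\<Sum>lam\<in>eigenvalues_L c f U \<inter> inside K. alg_mult c f U lam)"
    unfolding ev_set of_nat_sum
  proof (rule sum.cong[OF refl])
    fix z assume "z \<in> {z. z \<in> inside (path_image gam) \<and> evans z = 0}"
    then have "z \<in> Omega" using zeros(1) by blast
    from mult(2)[OF this] show "real_of_int (zorder evans z) = real (alg_mult c f U z)"
      by (metis of_int_of_nat_eq)
  qed
  moreover have "finite (eigenvalues_L c f U \<inter> inside K)" unfolding ev_set using zeros(2) by simp
  ultimately show ?thesis by simp
qed

end
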